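(* Let $d\ge1$ and let $\Phi$ be a stationary and isotropic Poisson hyperplane process in $\mathbb{R}^d$ with intensity $\lambda>0$ (i.e. the orientation distribution $\Theta$ is the uniform distribution on $S_+^{d-1}$). Let $k\in\{0,\ldots,d-1\}$, let $\lambda_k=a_{d,k}\lambda^{d-k}$ be the intensity of the $k$-flat intersection process induced by $\Phi$, let $\widehat\lambda_{k,r}=\Psi_k(B_r^d)/(\kappa_{d-k}r^{d-k})$, where $\Psi_k(B_r^d)$ is the number of induced $k$-flats hitting $B_r^d$, and let $a_{d,k}$, $b_j$ be the constants defined in the context. Then $$\frac{\sqrt r}{b_{d-k}}\,a_{d,k}^{-1/(2(d-k))}\Big(\widehat\lambda_{k,r}^{\,1/(2(d-k))}-\lambda_k^{1/(2(d-k))}\Big)\xrightarrow[r\to\infty]{\mathrm{d}}\mathcal{N}(0,1),$$ which is equivalent to $\mathbb{P}(\lambda_k\in I_{k,r}^{(d)}(\alpha))\to1-\alpha$ as $r\to\infty$ for any $\alpha\in(0,1)$, where $$I_{k,r}^{(d)}(\alpha)=\left[\left(\widehat\lambda_{k,r}^{\,1/(2(d-k))}-\frac{a_{d,k}^{1/(2(d-k))}b_{d-k}}{\sqrt r}z_{1-\alpha/2}\right)^{2(d-k)},\ \left(\widehat\lambda_{k,r}^{\,1/(2(d-k))}+\frac{a_{d,k}^{1/(2(d-k))}b_{d-k}}{\sqrt r}z_{1-\alpha/2}\right)^{2(d-k)}\right]$$ and $z_{1-\alpha/2}$ denotes the $(1-\alpha/2)$-quantile of the standard normal distribution. Moreover,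 the interval $$J_{k,r}^{(d)}(\alpha)=\left[\left(\Big(\frac{\widehat\lambda_{k,r}}{a_{d,k}}\Big)^{1/(2(d-k))}-\frac{b_{d-k}}{\sqrt r}z_{1-\alpha/2}\right)^{2},\ \left(\Big(\frac{\widehat\lambda_{k,r}}{a_{d,k}}\Big)^{1/(2(d-k))}+\frac{b_{d-k}}{\sqrt r}z_{1-\alpha/2}\right)^{2}\right]$$ satisfies $\mathbb{P}(\lambda\in J_{k,r}^{(d)}(\alpha))\to1-\alpha$ as $r\to\infty$.
   Context: Notation. $B_r^d=\{x\in\mathbb{R}^d:\|x\|\le r\}$; $S_+^{d-1}=\{x\in\mathbb{R}^d:\|x\|=1,\ x_d\ge 0\}$; $H(p,v)=\{x\in\mathbb{R}^d:\langle x,v\rangle=p\}$; $\chi(K)=1$ if $K\ne\varnothing$, $\chi(\varnothing)=0$; $\kappa_j=\pi^{j/2}/\Gamma(j/2+1)$ is the volume of the unit ball in $\mathbb{R}^j$ ($\kappa_0=1$); $\xrightarrow{\mathrm{d}}$ is convergence in distribution. Poisson hyperplane process. $\Phi$ is the random collection of hyperplanes $H(P_i,V_i)$, $i\ge1$, where $\sum_{i\ge1}\delta_{(P_i,V_i)}$ is a Poisson process on $\mathbb{R}\times S_+^{d-1}$ with intensity measure $\lambda\,dp\,\Theta(dv)$, with $\Theta$ the uniform distribution (normalized surface measure) on $S_+^{d-1}$. $$\Psi_k(B_r^d)=\frac1{(d-k)!}\sum^{*}\chi\Big(\bigcap_{j=1}^{d-k}H(P_{i_j},V_{i_j})\cap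 B_r^d\Big),$$ the sum running over all tuples of pairwise distinct indices $i_1,\dots,i_{d-k}$; it counts the $k$-flats (intersections of $d-k$ distinct hyperplanes of $\Phi$) hitting $B_r^d$. The intensity of the $k$-flat process is $\lambda_k=\mathbb{E}\Psi_k(B_r^d)/(\kappa_{d-k}r^{d-k})$ (independent of $r>0$). Constants: $$a_{d,k}=\binom dk\frac{\kappa_d}{\kappa_k}\left(\frac{\kappa_{d-1}}{d\kappa_d}\right)^{d-k},\qquad b_j=\frac{2^{j-1}(j-1)!\,\kappa_{j-1}}{\sqrt{2(2j-1)!}\;\kappa_j}\quad(j=1,2,\ldots).$$ *)

theory Defs
  imports "HOL-Probability.Probability"
begin

text \<open>
  The Euclidean space of dimension \<open>d\<close> is a type \<open>'a :: euclidean_space\<close> with \<open>d = DIM('a)\<close>; the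
  last coordinate of \<open>x\<close> is \<open>x \<bullet> e\<close> for a vector \<open>e \<in> Basis\<close>, which is a parameter because \<open>Basis\<close>
  is unordered.
\<close>

section \<open>The uniform distribution on the half sphere\<close>

definition half_sphere :: "'a::euclidean_space \<Rightarrow> 'a set" where
  "half_sphere e = {x. norm x = 1 \<and> 0 \<le> x \<bullet> e}"

text \<open>
  Spherical Lebesgue measure: \<open>\<sigma>(A)\<close> is \<open>d\<close> times the volume of \<open>{t x | 0 < t \<le> 1, x \<in> A}\<close> for \<open>A\<close>
  contained in the unit sphere. This cone is the preimage of \<open>A\<close> under \<open>sgn x = x / \<parallel>x\<parallel>\<close>, restricted
  to the punctured unit ball.
\<close>

definition sphere_measure :: "'a::euclidean_space measure" where
  "sphere_measure = scale_measure (of_nat DIM('a))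
     (distr (restrict_space lborel (cball 0 1 - {0})) borel sgn)"

definition half_sphere_uniform :: "'a::euclidean_space \<Rightarrow> 'a measure" where
  "half_sphere_uniform e =
     restrict_space (uniform_measure sphere_measure (half_sphere e)) (half_sphere e)"

section \<open>Poisson processes\<close>

text \<open>The value on \<open>B\<close> of the point process \<open>\<Sum>\<^sub>i \<delta>(X\<^sub>i)\<close>.\<close>

definition point_count :: "(nat \<Rightarrow> 'w \<Rightarrow> 'b) \<Rightarrow> 'b set \<Rightarrow> 'w \<Rightarrow> ennreal" where
  "point_count X B \<omega> = (\<Sum>i. indicator B (X i \<omega>))"

text \<open>
  A Poisson variable with parameter \<open>\<infinity>\<close> is almost surely \<open>\<infinity>\<close>, i.e. it takes every finite value
  with probability 0.
\<close>

definition poisson_prob :: "ennreal \<Rightarrow> nat \<Rightarrow> real" where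
  "poisson_prob m n = (if m = \<infinity> then 0 else exp (- enn2real m) * enn2real m ^ n / fact n)"

definition poisson_process :: "'w measure \<Rightarrow> 'b measure \<Rightarrow> (nat \<Rightarrow> 'w \<Rightarrow> 'b) \<Rightarrow> bool" where
  "poisson_process M \<mu> X \<longleftrightarrow>
     (\<forall>i. X i \<in> M \<rightarrow>\<^sub>M \<mu>) \<and>
     (\<forall>B\<in>sets \<mu>. \<forall>n::nat.
        measure M {\<omega>\<in>space M. point_count X B \<omega> = of_nat n} = poisson_prob (emeasure \<mu> B) n) \<and>
     (\<forall>(B :: nat \<Rightarrow> 'b set) m. (\<forall>j<m. B j \<in> sets \<mu>) \<longrightarrow> disjoint_family_on B {..<m} \<longrightarrow>
        prob_space.indep_vars M (\<lambda>_. borel) (\<lambda>j. point_count X (B j)) {..<m})"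

section \<open>The isotropic Poisson hyperplane process and its intersection flats\<close>

definition hyperplane :: "real \<Rightarrow> 'a::euclidean_space \<Rightarrow> 'a set" where
  "hyperplane p v = {x. x \<bullet> v = p}"

text \<open>
  The hyperplanes of the process are \<open>hyperplane (P i \<omega>) (V i \<omega>)\<close>. Since the space of the intensity
  measure is \<open>UNIV \<times> half_sphere e\<close>, all \<open>V i\<close> take values in the half sphere.
\<close>

definition poisson_hyperplane_process ::
  "'w measure \<Rightarrow> 'a::euclidean_space \<Rightarrow> real \<Rightarrow> (nat \<Rightarrow> 'w \<Rightarrow> real) \<Rightarrow> (nat \<Rightarrow> 'w \<Rightarrow> 'a) \<Rightarrow> bool" where
  "poisson_hyperplane_process M e lam P V \<longleftrightarrow>
     poisson_process M (scale_measure (ennreal lam) (lborel \<Otimes>\<^sub>M half_sphere_uniform e))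
       (\<lambda>i \<omega>. (P i \<omega>, V i \<omega>))"

text \<open>
  The number \<open>\<Psi>\<^sub>k(B\<^sub>r)\<close> of \<open>k\<close>-flats hitting the ball of radius \<open>r\<close>, for a configuration \<open>(p, v)\<close> of
  hyperplanes. The tuples of pairwise distinct indices are distinct lists. If infinitely many tuples
  contribute, which has probability 0 for the Poisson process, the real-valued sum is 0.
\<close>

definition flat_count ::
  "nat \<Rightarrow> real \<Rightarrow> (nat \<Rightarrow> real) \<Rightarrow> (nat \<Rightarrow> 'a::euclidean_space) \<Rightarrow> real" where
  "flat_count k r p v =
     1 / fact (DIM('a) - k) *
     (\<Sum>\<^sub>\<infinity>is\<in>{is. length is = DIM('a) - k \<and> distinct is}.
        of_bool ((\<Inter>i\<in>set is. hyperplane (p i) (v i)) \<inter> cball 0 r \<noteq> {}))"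

definition intensity_estimator ::
  "nat \<Rightarrow> real \<Rightarrow> (nat \<Rightarrow> real) \<Rightarrow> (nat \<Rightarrow> 'a::euclidean_space) \<Rightarrow> real" where
  "intensity_estimator k r p v =
     flat_count k r p v / (unit_ball_vol (real (DIM('a) - k)) * r ^ (DIM('a) - k))"

section \<open>Constants and confidence intervals\<close>

definition a_const :: "nat \<Rightarrow> nat \<Rightarrow> real" where
  "a_const d k =
     real (d choose k) * (unit_ball_vol (real d) / unit_ball_vol (real k)) *
     (unit_ball_vol (real (d - 1)) / (real d * unit_ball_vol (real d))) ^ (d - k)"

definition b_const :: "nat \<Rightarrow> real" where
  "b_const j =
     2 ^ (j - 1) * fact (j - 1) * unit_ball_vol (real (j - 1)) /
     (sqrt (2 * fact (2 * j - 1)) * unit_ball_vol (real j))"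

definition std_normal_quantile :: "real \<Rightarrow> real" where
  "std_normal_quantile q = Inf {x. q \<le> cdf std_normal_distribution x}"

text \<open>In the intervals, \<open>l\<close> stands for the value of the estimator of the intensity of the \<open>k\<close>-flats.\<close>

definition conf_interval_I :: "nat \<Rightarrow> nat \<Rightarrow> real \<Rightarrow> real \<Rightarrow> real \<Rightarrow> real set" where
  "conf_interval_I d k \<alpha> r l =
     (let s = 1 / (2 * real (d - k));
          h = a_const d k powr s * b_const (d - k) / sqrt r * std_normal_quantile (1 - \<alpha> / 2)
      in {(l powr s - h) ^ (2 * (d - k)) .. (l powr s + h) ^ (2 * (d - k))})"

definition conf_interval_J :: "nat \<Rightarrow> nat \<Rightarrow> real \<Rightarrow> real \<Rightarrow> real \<Rightarrow> real set" where
  "conf_interval_J d k \<alpha> r l =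
     (let s = 1 / (2 * real (d - k));
          h = b_const (d - k) / sqrt r * std_normal_quantile (1 - \<alpha> / 2)
      in {((l / a_const d k) powr s - h)\<^sup>2 .. ((l / a_const d k) powr s + h)\<^sup>2})"

section \<open>Convergence in distribution\<close>

text \<open>
  As in \<^const>\<open>weak_conv_m\<close>, but for a family of random variables indexed by a filtered set
  instead of a sequence of distributions.
\<close>

definition conv_in_distr ::
  "'w measure \<Rightarrow> ('i \<Rightarrow> 'w \<Rightarrow> real) \<Rightarrow> real measure \<Rightarrow> 'i filter \<Rightarrow> bool" where
  "conv_in_distr M Y \<nu> F \<longleftrightarrow>
     (\<forall>x. isCont (cdf \<nu>) x \<longrightarrow> ((\<lambda>i. cdf (distr M borel (Y i)) x) \<longlongrightarrow> cdf \<nu> x) F)"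

end

theory Submission
  imports Defs "HOL-Probability.Probability"
begin

text \<open>
  With \<open>m = d - k\<close>, the number of \<open>k\<close>-flats hitting the ball is a Poisson U-statistic of order \<open>m\<close>. Its
  mean and the conditional mean given one hyperplane \<open>(p, v)\<close>, which is a multiple of
  \<open>(r\<^sup>2 - p\<^sup>2) ^ ((m - 1) / 2)\<close>, follow from the Campbell formula by intersecting with one hyperplane at a
  time. Subtracting the linear statistic of the conditional mean cancels the part of the variance of order
  \<open>r ^ (2 m - 1)\<close>: only pairs of \<open>m\<close>-tuples with at least two common hyperplanes contribute to the
  remainder, whose second moment is \<open>O(r ^ (2 m - 2))\<close>. The characteristic function of the linear
  statistic is explicit and gives the central limit theorem. Since \<open>y \<mapsto> y ^ (1 / (2 m))\<close> is
  increasing, the delta method reduces to moving the argument of the distribution function, and for large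
  \<open>r\<close> both intervals cover their parameter exactly when the standardized variable is at most the quantile in
  absolute value.
\<close>

section \<open>Gaussian integrals and projections\<close>

text \<open>The hypothesis speaks only of the counts \<open>point_count X B\<close>: their Poisson
  law and their independence on disjoint sets. Nothing is given about the joint law of the
  enumerated points \<open>X i\<close>, so the multivariate Campbell formula has to be recovered
  from counts; this is what the partition into cells is for. Mean projection lengths are computed
  from Gaussian integrals because a Gaussian vector factorizes along every orthonormal basis, while
  the uniform distribution on the sphere does not. The root 1 / (2 m) stabilizes the variance. The
  asymptotic standard deviation of the estimator is proportional to lam ^ (m - 1/2), the derivative
  of the root at the limit to lam ^ (1/2 - m), and in the product the intensity drops out. What is
  left is \<open>b_const\<close>, the trace of a Beta integral of the squared conditional mean,
  while \<open>a_const\<close> is a telescoping product of mean projection lengths.\<close>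

lemma nn_integral_lborel_translate:
  fixes f :: "'a::euclidean_space \<Rightarrow> ennreal"
  assumes [measurable]: "f \<in> borel_measurable borel"
  shows "(\<integral>\<^sup>+x. f (a + x) \<partial>lborel) = (\<integral>\<^sup>+x. f x \<partial>lborel)"
proof -
  have "(\<integral>\<^sup>+x. f x \<partial>lborel) = (\<integral>\<^sup>+x. f x \<partial>distr lborel borel (\<lambda>x. a + x))"
    using lborel_affine[of 1 a] by (simp add: density_1)
  then show ?thesis by (simp add: nn_integral_distr)
qed

lemma nn_integral_lborel_reflect:
  fixes f :: "'a::euclidean_space \<Rightarrow> ennreal"
  assumes [measurable]: "f \<in> borel_measurable borel"
  shows "(\<integral>\<^sup>+x. f (- x) \<partial>lborel) = (\<integral>\<^sup>+x. f x \<partial>lborel)"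
proof -
  have "(\<integral>\<^sup>+x. f x \<partial>lborel) = (\<integral>\<^sup>+x. f x \<partial>distr lborel borel (\<lambda>x::'a. - x))"
    using lborel_affine[of "-1" "0::'a"] by (simp add: density_1)
  then show ?thesis by (simp add: nn_integral_distr)
qed

lemma nn_integral_lborel_scale:
  fixes f :: "'a::euclidean_space \<Rightarrow> ennreal"
  assumes [measurable]: "f \<in> borel_measurable borel" and "s > 0"
  shows "(\<integral>\<^sup>+x. f x \<partial>lborel) = ennreal (s ^ DIM('a)) * (\<integral>\<^sup>+x. f (s *\<^sub>R x) \<partial>lborel)"
proof -
  have "(\<integral>\<^sup>+x. f x \<partial>lborel)
      = (\<integral>\<^sup>+x. f x \<partial>density (distr lborel borel (\<lambda>x::'a. s *\<^sub>R x)) (\<lambda>_. \<bar>s\<bar>^DIM('a)))"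
    using lborel_affine[of s "0::'a"] \<open>s > 0\<close> by simp
  also have "\<dots> = ennreal (s ^ DIM('a)) * (\<integral>\<^sup>+x. f (s *\<^sub>R x) \<partial>lborel)"
    using \<open>s > 0\<close>
    by (simp add: nn_integral_density nn_integral_distr nn_integral_cmult ennreal_power)
  finally show ?thesis .
qed

text \<open>
  Uniqueness of Haar measure in the form needed: multiply by \<open>\<integral>g\<close> for the indicator \<open>g\<close> of the unit
  ball, which the isometry preserves, and use translation invariance under a double integral.
\<close>

lemma nn_integral_lborel_orthogonal_transformation:
  fixes f :: "'a::euclidean_space \<Rightarrow> ennreal" and T :: "'a \<Rightarrow> 'a"
  assumes f[measurable]: "f \<in> borel_measurable borel" and T: "orthogonal_transformation T"
  shows "(\<integral>\<^sup>+x. f (T x) \<partial>lborel) = (\<integral>\<^sup>+x. f x \<partial>lborel)"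
proof -
  define g :: "'a \<Rightarrow> ennreal" where "g = indicator (cball 0 1)"
  have g[measurable]: "g \<in> borel_measurable borel" unfolding g_def by (intro borel_measurable_indicator) simp
  have lin: "linear T" using T by (simp add: orthogonal_transformation_def)
  have T_m[measurable]: "T \<in> borel_measurable borel"
    using lin by (intro borel_measurable_continuous_onI linear_continuous_on)
      (simp add: linear_conv_bounded_linear)
  have gT: "g (T x) = g x" for x :: 'a
    using T by (simp add: g_def indicator_def orthogonal_transformation)
  have g_int: "(\<integral>\<^sup>+x. g x \<partial>lborel) = ennreal (unit_ball_vol (real DIM('a)))"
    unfolding g_def by (simp add: emeasure_cball)
  have inv: "\<exists>b. T b = - y" for y
    using orthogonal_transformation_surj[OF T] by (metis surjD)
  have "(\<integral>\<^sup>+x. f (T x) \<partial>lborel) * (\<integral>\<^sup>+y. g y \<partial>lborel)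
      = (\<integral>\<^sup>+x. f (T x) * (\<integral>\<^sup>+y. g (T x + y) \<partial>lborel) \<partial>lborel)"
    by (simp add: nn_integral_lborel_translate nn_integral_multc)
  also have "\<dots> = (\<integral>\<^sup>+x. (\<integral>\<^sup>+y. f (T x) * g (T x + y) \<partial>lborel) \<partial>lborel)"
    by (intro nn_integral_cong nn_integral_cmult[symmetric]) measurable
  also have "\<dots> = (\<integral>\<^sup>+y. (\<integral>\<^sup>+x. f (T x) * g (T x + y) \<partial>lborel) \<partial>lborel)"
    by (rule lborel_pair.Fubini') measurable
  also have "\<dots> = (\<integral>\<^sup>+y. (\<integral>\<^sup>+x. f (T x - y) * g (T x) \<partial>lborel) \<partial>lborel)"
  proof (rule nn_integral_cong)
    fix y :: 'a
    obtain b where b: "T b = - y" using inv by blast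
    have "(\<integral>\<^sup>+x. f (T x) * g (T x + y) \<partial>lborel) = (\<integral>\<^sup>+x. f (T (b + x)) * g (T (b + x) + y) \<partial>lborel)"
      by (rule nn_integral_lborel_translate[symmetric]) measurable
    then show "(\<integral>\<^sup>+x. f (T x) * g (T x + y) \<partial>lborel) = (\<integral>\<^sup>+x. f (T x - y) * g (T x) \<partial>lborel)"
      by (simp add: linear_add[OF lin] b)
  qed
  also have "\<dots> = (\<integral>\<^sup>+x. (\<integral>\<^sup>+y. f (T x - y) * g (T x) \<partial>lborel) \<partial>lborel)"
    by (rule lborel_pair.Fubini') measurable
  also have "\<dots> = (\<integral>\<^sup>+x. (\<integral>\<^sup>+y. f y \<partial>lborel) * g x \<partial>lborel)"
  proof (rule nn_integral_cong)
    fix x :: 'a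
    have "(\<integral>\<^sup>+y. f (T x - y) \<partial>lborel) = (\<integral>\<^sup>+y. f (T x + y) \<partial>lborel)"
      using nn_integral_lborel_reflect[of "\<lambda>y. f (T x + y)"] by simp
    then show "(\<integral>\<^sup>+y. f (T x - y) * g (T x) \<partial>lborel) = (\<integral>\<^sup>+y. f y \<partial>lborel) * g x"
      by (simp add: nn_integral_multc nn_integral_lborel_translate gT)
  qed
  also have "\<dots> = (\<integral>\<^sup>+y. f y \<partial>lborel) * (\<integral>\<^sup>+y. g y \<partial>lborel)"
    by (simp add: nn_integral_cmult)
  finally show ?thesis
    unfolding g_int mult_right_ennreal_cancel using unit_ball_vol_pos[of "real DIM('a)"] by linarith
qed

text \<open>The half lines form an intersection-stable generator, so their masses determine the
  measure; for \<open>s \<le> 0\<close> the mass is squeezed to 0 by \<open>c * t ^ n\<close> with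
  \<open>t\<close> decreasing to 0. Radial laws, where the power is the growth of the volume of a
  ball, obtain their density in this way.\<close>

lemma measure_eq_power_density:
  fixes N :: "real measure"
  assumes sets: "sets N = sets borel" and n: "n > 0" and c: "c \<ge> 0"
    and N: "\<And>s. s > 0 \<Longrightarrow> emeasure N {..s} = ennreal (c * s ^ n)"
  shows "N = density lborel (\<lambda>s. ennreal (c * real n * s ^ (n - 1)) * indicator {0..} s)"
    (is "N = ?D")
proof (rule measure_eqI_generator_eq[where E = "range atMost" and \<Omega> = UNIV and A = "\<lambda>i::nat. {..real i + 1}"])
  have D: "emeasure ?D {..s} = ennreal (c * s ^ n)" if "s > 0" for s
  proof -
    have "emeasure ?D {..s} = (\<integral>\<^sup>+x. ennreal (c * real n * x ^ (n - 1)) * indicator {0..s} x \<partial>lborel)"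
      by (subst emeasure_density) (auto intro!: nn_integral_cong simp: indicator_def)
    also have "\<dots> = ennreal (c * s ^ n - c * 0 ^ n)"
      using that c n
      by (intro nn_integral_FTC_Icc) (auto intro!: derivative_eq_intros simp: mult.assoc)
    finally show ?thesis using n by (simp add: zero_power)
  qed
  have zero: "emeasure L {..s} = 0"
    if L: "sets L = sets borel" "\<And>s. s > 0 \<Longrightarrow> emeasure L {..s} = ennreal (c * s ^ n)" and "s \<le> 0"
    for s and L :: "real measure"
  proof -
    have "emeasure L {..s} \<le> ennreal (c * (1 / Suc i) ^ n)" for i
    proof -
      have "emeasure L {..s} \<le> emeasure L {..1 / Suc i}"
        by (rule emeasure_mono) (use that in \<open>auto intro: order_trans[of _ 0]\<close>)
      then show ?thesis using L(2)[of "1 / Suc i"] by simp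
    qed
    moreover have "(\<lambda>i. ennreal (c * (1 / Suc i) ^ n)) \<longlonglongrightarrow> ennreal (c * 0 ^ n)"
      by (intro tendsto_intros LIMSEQ_Suc[OF lim_1_over_n])
    ultimately have "emeasure L {..s} \<le> ennreal (c * 0 ^ n)"
      by (intro LIMSEQ_le_const) auto
    then show ?thesis using n by (simp add: zero_power)
  qed
  show "emeasure N X = emeasure ?D X" if X_in: "X \<in> range atMost" for X :: "real set"
  proof -
    obtain s where X: "X = {..s}" using X_in by blast
    show ?thesis
    proof (cases "s > 0")
      case True show ?thesis unfolding X N[OF True] D[OF True] ..
    next
      case False
      then have "s \<le> 0" by simp
      show ?thesis
        unfolding X
        using zero[OF sets N \<open>s \<le> 0\<close>] zero[of ?D, OF _ D \<open>s \<le> 0\<close>] by simp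
    qed
  qed
  show "Int_stable (range (atMost :: real \<Rightarrow> _))" by (auto simp: Int_stable_def)
  show "sets N = sigma_sets UNIV (range atMost)"
    by (simp add: sets borel_eq_atMost)
  show "sets ?D = sigma_sets UNIV (range atMost)"
    by (simp add: borel_eq_atMost)
  show "(\<Union>i::nat. {..real i + 1}) = UNIV"
    by (auto intro: exI[of _ "nat \<lceil>x\<rceil>" for x]) (meson le_add_same_cancel1 order_trans real_nat_ceiling_ge zero_le_one)
  show "emeasure N {..real i + 1} \<noteq> \<infinity>" for i :: nat
    using N[of "real i + 1"] by simp
qed auto

text \<open>The radial factor of an unnormalized Gaussian integral in dimension
  \<open>n + 1\<close>.\<close>

definition gauss_moment :: "nat \<Rightarrow> ennreal" where
  "gauss_moment n = (\<integral>\<^sup>+s. ennreal (s ^ n * exp (- s\<^sup>2 / 2)) * indicator {0..} s \<partial>lborel)"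

text \<open>Polar coordinates: the law of the norm is determined by the volumes of balls. A product
  space takes the place of a Euclidean type because the dimension \<open>card A\<close> varies
  within the proof.\<close>

lemma nn_integral_norm_PiM:
  fixes A :: "'i set"
  assumes A: "finite A" "A \<noteq> {}" and [measurable]: "w \<in> borel_measurable borel"
  shows "(\<integral>\<^sup>+f. w (sqrt (\<Sum>i\<in>A. (f i)\<^sup>2)) \<partial>Pi\<^sub>M A (\<lambda>_. lborel)) =
    ennreal (real (card A) * unit_ball_vol (real (card A))) *
      (\<integral>\<^sup>+s. ennreal (s ^ (card A - 1)) * indicator {0..} s * w s \<partial>lborel)"
proof -
  define n where "n = card A"
  have n: "n > 0" unfolding n_def using A by (simp add: card_gt_0_iff)
  let ?nm = "\<lambda>f. sqrt (\<Sum>i\<in>A. (f i)\<^sup>2) :: real"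
  let ?N = "distr (Pi\<^sub>M A (\<lambda>_. lborel)) borel ?nm"
  have N: "?N = density lborel (\<lambda>s. ennreal (unit_ball_vol n * real n * s ^ (n - 1)) * indicator {0..} s)"
  proof (rule measure_eq_power_density)
    fix s :: real assume "s > 0"
    have "emeasure ?N {..s} = emeasure (Pi\<^sub>M A (\<lambda>_. lborel)) ({f. ?nm f \<le> s} \<inter> space (Pi\<^sub>M A (\<lambda>_. lborel)))"
      by (subst emeasure_distr) (auto intro!: arg_cong2[where f=emeasure])
    then show "emeasure ?N {..s} = ennreal (unit_ball_vol n * s ^ n)"
      using emeasure_cball_aux[OF A(1) \<open>s > 0\<close>] by (simp add: n_def)
  qed (use n in auto)
  have "(\<integral>\<^sup>+f. w (?nm f) \<partial>Pi\<^sub>M A (\<lambda>_. lborel)) = (\<integral>\<^sup>+s. w s \<partial>?N)"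
    by (subst nn_integral_distr) auto
  also have "\<dots> = (\<integral>\<^sup>+s. ennreal (real n * unit_ball_vol n) * (ennreal (s ^ (n - 1)) * indicator {0..} s * w s) \<partial>lborel)"
    unfolding N by (subst nn_integral_density)
      (auto intro!: nn_integral_cong simp: indicator_def ennreal_mult' ennreal_mult mult_ac)
  finally show ?thesis by (simp add: nn_integral_cmult n_def)
qed

lemma nn_integral_gauss: "(\<integral>\<^sup>+(x::real). ennreal (exp (- x\<^sup>2 / 2)) \<partial>lborel) = ennreal (sqrt (2 * pi))"
proof -
  have "(\<integral>\<^sup>+(x::real). ennreal (std_normal_density x) \<partial>lborel) = 1"
    using prob_space.emeasure_space_1[OF prob_space_normal_density[of 1 0]]
    by (simp add: emeasure_density)
  then have "ennreal (sqrt (2 * pi)) * (\<integral>\<^sup>+(x::real). ennreal (std_normal_density x) \<partial>lborel) = ennreal (sqrt (2 * pi))"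
    by simp
  moreover have "ennreal (sqrt (2 * pi)) * (\<integral>\<^sup>+(x::real). ennreal (std_normal_density x) \<partial>lborel)
    = (\<integral>\<^sup>+(x::real). ennreal (exp (- x\<^sup>2 / 2)) \<partial>lborel)"
    by (subst nn_integral_cmult[symmetric])
      (auto intro!: nn_integral_cong simp: std_normal_density_def ennreal_mult'[symmetric])
  ultimately show ?thesis by simp
qed

lemma nn_integral_gauss_PiM:
  assumes A: "finite A"
  shows "(\<integral>\<^sup>+f. ennreal (exp (- (\<Sum>i\<in>A. (f i)\<^sup>2) / 2)) \<partial>Pi\<^sub>M A (\<lambda>_. lborel)) = ennreal (sqrt (2 * pi) ^ card A)"
proof -
  interpret product_sigma_finite "\<lambda>_. lborel" by standard
  have "ennreal (exp (- (\<Sum>i\<in>A. (f i)\<^sup>2) / 2)) = (\<Prod>i\<in>A. ennreal (exp (- (f i)\<^sup>2 / 2)))" for f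
    using A by (simp add: prod_ennreal exp_sum[symmetric] sum_negf sum_divide_distrib)
  then show ?thesis
    using A product_nn_integral_prod[of A "\<lambda>_ x. ennreal (exp (- x\<^sup>2 / 2))"]
    by (simp only: nn_integral_gauss prod_constant) (simp add: ennreal_power)
qed

text \<open>The Gaussian integral over \<open>Suc n\<close> coordinates is computed twice, as a
  product of one-dimensional integrals and radially.\<close>

lemma gauss_moment_eq:
  "gauss_moment n = ennreal (sqrt (2 * pi) ^ Suc n / (real (Suc n) * unit_ball_vol (real (Suc n))))"
proof -
  let ?A = "{..<Suc n}" and ?c = "real (Suc n) * unit_ball_vol (real (Suc n))"
  have c: "?c > 0" by simp
  have "ennreal (sqrt (2 * pi) ^ Suc n) = (\<integral>\<^sup>+f. ennreal (exp (- (\<Sum>i\<in>?A. (f i)\<^sup>2) / 2)) \<partial>Pi\<^sub>M ?A (\<lambda>_. lborel))"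
    by (subst nn_integral_gauss_PiM) auto
  also have "\<dots> = (\<integral>\<^sup>+f. (\<lambda>s. ennreal (exp (- s\<^sup>2 / 2))) (sqrt (\<Sum>i\<in>?A. (f i)\<^sup>2)) \<partial>Pi\<^sub>M ?A (\<lambda>_. lborel))"
    by (intro nn_integral_cong) (simp add: sum_nonneg del: sum.lessThan_Suc)
  also have "\<dots> = ennreal ?c * (\<integral>\<^sup>+s. ennreal (s ^ n) * indicator {0..} s * ennreal (exp (- s\<^sup>2 / 2)) \<partial>lborel)"
    by (subst nn_integral_norm_PiM) (auto simp del: of_nat_Suc simp: lessThan_empty_iff)
  also have "(\<integral>\<^sup>+s. ennreal (s ^ n) * indicator {0..} s * ennreal (exp (- s\<^sup>2 / 2)) \<partial>lborel) = gauss_moment n"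
    unfolding gauss_moment_def
    by (auto intro!: nn_integral_cong simp: indicator_def ennreal_mult)
  finally have *: "ennreal ?c * gauss_moment n = ennreal (sqrt (2 * pi) ^ Suc n)" ..
  have "ennreal (sqrt (2 * pi) ^ Suc n / ?c) = ennreal (sqrt (2 * pi) ^ Suc n) / ennreal ?c"
    using c by (intro divide_ennreal[symmetric]) auto
  also have "\<dots> = gauss_moment n"
    unfolding *[symmetric] using c
    by (metis ennreal_mult_divide_eq ennreal_eq_0_iff ennreal_neq_top linorder_not_less mult.commute order_less_le)
  finally show ?thesis ..
qed


lemma ennreal_mult_left_cancel_real:
  assumes "c > 0" "ennreal c * x = ennreal c * y"
  shows "x = y"
  using assms by (simp add: ennreal_mult_cancel_left)

section \<open>Orthonormal sets and Gaussian means of projection lengths\<close>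

definition orthonormal :: "'a::euclidean_space set \<Rightarrow> bool" where
  "orthonormal B \<longleftrightarrow> pairwise orthogonal B \<and> (\<forall>b\<in>B. norm b = 1)"

lemma orthonormal_finite: "orthonormal B \<Longrightarrow> finite B"
  by (auto simp: orthonormal_def intro: pairwise_orthogonal_imp_finite)

lemma orthonormal_inner: "orthonormal B \<Longrightarrow> b \<in> B \<Longrightarrow> c \<in> B \<Longrightarrow> b \<bullet> c = (if b = c then 1 else 0)"
  by (auto simp: orthonormal_def pairwise_def orthogonal_def norm_eq_1)

text \<open>The norm of the orthogonal projection of \<open>v\<close> to the span of an orthonormal set.\<close>

definition proj_norm :: "'a::euclidean_space set \<Rightarrow> 'a \<Rightarrow> real" where
  "proj_norm B v = sqrt (\<Sum>b\<in>B. (v \<bullet> b)\<^sup>2)"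

lemma proj_norm_measurable[measurable]: "proj_norm B \<in> borel_measurable borel"
  unfolding proj_norm_def[abs_def] by measurable

lemma proj_norm_nonneg: "0 \<le> proj_norm B v"
  by (simp add: proj_norm_def sum_nonneg)

lemma proj_norm_scaleR: "proj_norm B (c *\<^sub>R v) = \<bar>c\<bar> * proj_norm B v"
  by (simp add: proj_norm_def power_mult_distrib sum_distrib_left[symmetric] real_sqrt_mult)

text \<open>\<open>B\<close> is completed to an orthonormal basis \<open>C\<close>, and a bijection
  from \<open>Basis\<close> to \<open>C\<close> that sends \<open>B0\<close> to \<open>B\<close>
  extends linearly to an isometry. Isometries preserve Lebesgue measure and the norm, so projections
  to the span of \<open>B\<close> can be treated as projections to coordinates.\<close>

lemma orthonormal_extend_basis:
  fixes B :: "'a::euclidean_space set"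
  assumes B: "orthonormal B"
  obtains T :: "'a \<Rightarrow> 'a" and B0 where "orthogonal_transformation T" "B0 \<subseteq> Basis" "card B0 = card B"
    "\<And>x. proj_norm B (T x) = proj_norm B0 x"
proof -
  have ind: "independent B"
    using B by (intro pairwise_orthogonal_independent) (auto simp: orthonormal_def)
  obtain U where U: "U \<inter> insert 0 B = {}" "pairwise orthogonal (B \<union> U)" "span (B \<union> U) = span (B \<union> Basis)"
    using orthogonal_extension_strong[of B Basis] B unfolding orthonormal_def by blast
  define C where "C = B \<union> (\<lambda>u. u /\<^sub>R norm u) ` U"
  have "pairwise orthogonal C"
  proof -
    have ortho: "x \<bullet> y = 0" if "x \<in> B \<union> U" "y \<in> B \<union> U" "x \<noteq> y" for x y
      using pairwiseD[OF U(2) that] by (simp add: orthogonal_def)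
    have "x \<noteq> u" if "x \<in> B" "u \<in> U" for x u using that U(1) by auto
    then have 1: "x \<bullet> u = 0" "u \<bullet> x = 0" if "x \<in> B" "u \<in> U" for x u using that by (auto intro!: ortho)
    have 2: "u \<bullet> u' = 0" if "u \<in> U" "u' \<in> U" "u /\<^sub>R norm u \<noteq> u' /\<^sub>R norm u'" for u u'
      using that by (intro ortho) auto
    have 3: "x \<bullet> y = 0" if "x \<in> B" "y \<in> B" "x \<noteq> y" for x y
      using that by (intro ortho) auto
    show ?thesis
      unfolding C_def by (intro pairwiseI) (auto simp: orthogonal_def 1 2 3)
  qed
  moreover have "norm (u /\<^sub>R norm u) = 1" if "u \<in> U" for u
  proof -
    have "norm u \<noteq> 0" using that U(1) by auto
    then show ?thesis by simp
  qed
  ultimately have C: "orthonormal C"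
    using B unfolding orthonormal_def C_def by auto
  have finC: "finite C" using C by (rule orthonormal_finite)
  have "B \<union> U \<subseteq> span C"
  proof
    fix x assume "x \<in> B \<union> U"
    then show "x \<in> span C"
    proof
      assume "x \<in> U"
      then have "norm x \<noteq> 0" "x /\<^sub>R norm x \<in> C" using U(1) by (auto simp: C_def)
      then have "x = norm x *\<^sub>R (x /\<^sub>R norm x)" "x /\<^sub>R norm x \<in> C" by simp_all
      then show ?thesis by (metis span_base span_scale)
    qed (auto simp: C_def intro: span_base)
  qed
  then have "span (B \<union> U) \<subseteq> span C" by (simp add: span_minimal)
  then have span: "span C = UNIV"
    unfolding U(3) using span_mono[of Basis "B \<union> Basis"] by auto
  have "independent C"
    using C by (intro pairwise_orthogonal_independent) (auto simp: orthonormal_def)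
  then have "card C = DIM('a)"
    using span by (metis dim_UNIV dim_eq_card_independent dim_span)
  moreover have BC: "B \<subseteq> C" by (simp add: C_def)
  ultimately have "card B \<le> DIM('a)" by (metis card_mono finC)
  then obtain B0 where B0: "B0 \<subseteq> (Basis::'a set)" "card B0 = card B" by (metis obtain_subset_with_card_n)
  have fB: "finite B0" "finite B" using B0(1) BC finC finite_subset by (auto intro: finite_subset)
  obtain \<tau>1 where t1: "bij_betw \<tau>1 B0 B" using fB B0(2) by (metis finite_same_card_bij)
  have "card (Basis - B0) = card (C - B)"
    using B0 BC fB \<open>card C = DIM('a)\<close> by (simp add: card_Diff_subset)
  then obtain \<tau>2 where t2: "bij_betw \<tau>2 (Basis - B0) (C - B)"
    using finC by (metis finite_Basis finite_Diff finite_same_card_bij)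
  define \<tau> where "\<tau> x = (if x \<in> B0 then \<tau>1 x else \<tau>2 x)" for x
  have t1': "bij_betw \<tau> B0 B" using t1 by (subst bij_betw_cong[where g=\<tau>1]) (auto simp: \<tau>_def)
  have t2': "bij_betw \<tau> (Basis - B0) (C - B)"
    using t2 by (subst bij_betw_cong[where g=\<tau>2]) (auto simp: \<tau>_def)
  have t: "bij_betw \<tau> Basis C"
    using bij_betw_combine[OF t1' t2'] B0(1) BC by (simp add: Un_absorb1)
  define T where "T x = (\<Sum>b\<in>Basis. (x \<bullet> b) *\<^sub>R \<tau> b)" for x :: 'a
  have lin: "linear T"
    unfolding T_def
    by (intro linearI) (simp_all add: inner_add_left scaleR_add_left sum.distrib scaleR_sum_right)
  have T_inner: "T x \<bullet> \<tau> b = x \<bullet> b" if "b \<in> Basis" for x b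
  proof -
    have "T x \<bullet> \<tau> b = (\<Sum>c\<in>Basis. (x \<bullet> c) * (\<tau> c \<bullet> \<tau> b))"
      by (simp add: T_def inner_sum_left)
    also have "\<dots> = (\<Sum>c\<in>Basis. if c = b then x \<bullet> c else 0)"
    proof (rule sum.cong)
      fix c :: 'a assume c: "c \<in> Basis"
      have "\<tau> c \<in> C" "\<tau> b \<in> C" "\<tau> c = \<tau> b \<longleftrightarrow> c = b"
        using t c that by (auto simp: bij_betw_def inj_on_def)
      then show "x \<bullet> c * (\<tau> c \<bullet> \<tau> b) = (if c = b then x \<bullet> c else 0)"
        using orthonormal_inner[OF C] by simp
    qed simp
    also have "\<dots> = x \<bullet> b" using that by (simp add: sum.delta)
    finally show ?thesis .
  qed
  have "T x \<bullet> T y = x \<bullet> y" for x y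
  proof -
    have "T x \<bullet> T y = (\<Sum>b\<in>Basis. (y \<bullet> b) * (T x \<bullet> \<tau> b))"
      by (simp add: T_def[of y] inner_sum_right)
    also have "\<dots> = x \<bullet> y" by (simp add: T_inner euclidean_inner[of x y] mult.commute)
    finally show ?thesis .
  qed
  then have "orthogonal_transformation T" using lin by (simp add: orthogonal_transformation_def)
  moreover have "proj_norm B (T x) = proj_norm B0 x" for x
  proof -
    have "(\<Sum>b\<in>B. (T x \<bullet> b)\<^sup>2) = (\<Sum>b\<in>B0. (T x \<bullet> \<tau> b)\<^sup>2)"
      using sum.reindex_bij_betw[OF t1', of "\<lambda>b. (T x \<bullet> b)\<^sup>2"] by simp
    also have "\<dots> = (\<Sum>b\<in>B0. (x \<bullet> b)\<^sup>2)" using B0(1) by (intro sum.cong) (auto simp: T_inner)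
    finally show ?thesis by (simp add: proj_norm_def)
  qed
  ultimately show ?thesis using that B0 by blast
qed

text \<open>After a rotation \<open>B\<close> consists of coordinate vectors and the Gaussian weight
  factorizes: the coordinates outside \<open>B0\<close> contribute powers of
  \<open>sqrt (2 * pi)\<close>, those in \<open>B0\<close> a radial integral. The projection norm
  raises the radial power from \<open>card B - 1\<close> to \<open>card B\<close>, the index of the
  moment.\<close>

lemma nn_integral_proj_norm_gauss:
  fixes B :: "'a::euclidean_space set"
  assumes B: "orthonormal B" "B \<noteq> {}"
  shows "(\<integral>\<^sup>+x. ennreal (proj_norm B x * exp (- (norm x)\<^sup>2 / 2)) \<partial>lborel) =
    ennreal (real (card B) * unit_ball_vol (real (card B)) * sqrt (2 * pi) ^ (DIM('a) - card B)) * gauss_moment (card B)"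
proof -
  interpret product_sigma_finite "\<lambda>_::'a. lborel :: real measure" by standard
  obtain T :: "'a \<Rightarrow> 'a" and B0 where T: "orthogonal_transformation T" and B0: "B0 \<subseteq> Basis" "card B0 = card B"
    and TB: "\<And>x. proj_norm B (T x) = proj_norm B0 x"
    using orthonormal_extend_basis[OF B(1)] by metis
  have finB0: "finite B0" using B0(1) finite_Basis by (rule finite_subset)
  have neB0: "B0 \<noteq> {}" using B0(2) B orthonormal_finite[OF B(1)] by auto
  have nT: "norm (T x) = norm x" for x using T by (simp add: orthogonal_transformation)
  let ?J = "Basis - B0"
  let ?f = "\<lambda>f. ennreal (sqrt (\<Sum>b\<in>B0. (f b)\<^sup>2) * exp (- (\<Sum>b\<in>Basis. (f b)\<^sup>2) / 2))"
  let ?g = "\<lambda>f. ennreal (sqrt (\<Sum>b\<in>B0. (f b)\<^sup>2) * exp (- (\<Sum>b\<in>B0. (f b)\<^sup>2) / 2))"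
  let ?h = "\<lambda>f. ennreal (exp (- (\<Sum>b\<in>?J. (f b)\<^sup>2) / 2))"
  let ?L = "\<lambda>f. \<Sum>b\<in>Basis. f b *\<^sub>R b :: 'a"
  have Lb: "?L f \<bullet> b = f b" if "b \<in> Basis" for f b
    using that by (simp add: inner_sum_left_Basis)
  have "(\<integral>\<^sup>+x. ennreal (proj_norm B x * exp (- (norm x)\<^sup>2 / 2)) \<partial>lborel)
      = (\<integral>\<^sup>+x. ennreal (proj_norm B (T x) * exp (- (norm (T x))\<^sup>2 / 2)) \<partial>lborel)"
    by (rule nn_integral_lborel_orthogonal_transformation[OF _ T, symmetric]) measurable
  also have "\<dots> = (\<integral>\<^sup>+x. ennreal (proj_norm B0 x * exp (- (norm x)\<^sup>2 / 2)) \<partial>lborel)"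
    by (simp add: nT TB)
  also have "\<dots> = (\<integral>\<^sup>+f. ennreal (proj_norm B0 (?L f) * exp (- (norm (?L f))\<^sup>2 / 2)) \<partial>Pi\<^sub>M Basis (\<lambda>_. lborel))"
    by (subst lborel_eq) (subst nn_integral_distr, auto)
  also have "\<dots> = (\<integral>\<^sup>+f. ?f f \<partial>Pi\<^sub>M Basis (\<lambda>_. lborel))"
  proof (rule nn_integral_cong)
    fix f :: "'a \<Rightarrow> real"
    have "proj_norm B0 (?L f) = sqrt (\<Sum>b\<in>B0. (f b)\<^sup>2)"
      unfolding proj_norm_def using B0(1) by (intro arg_cong[where f=sqrt] sum.cong) (auto simp: Lb)
    moreover have "(norm (?L f))\<^sup>2 = (\<Sum>b\<in>Basis. (f b)\<^sup>2)"
      unfolding power2_norm_eq_inner by (subst euclidean_inner) (simp add: Lb power2_eq_square)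
    ultimately show "ennreal (proj_norm B0 (?L f) * exp (- (norm (?L f))\<^sup>2 / 2)) = ?f f" by simp
  qed
  also have "\<dots> = (\<integral>\<^sup>+f. ?f f \<partial>Pi\<^sub>M (B0 \<union> ?J) (\<lambda>_. lborel))"
    using B0(1) by (simp add: Un_absorb1)
  also have "\<dots> = (\<integral>\<^sup>+x. (\<integral>\<^sup>+y. ?f (merge B0 ?J (x, y)) \<partial>Pi\<^sub>M ?J (\<lambda>_. lborel)) \<partial>Pi\<^sub>M B0 (\<lambda>_. lborel))"
  proof (rule product_nn_integral_fold)
    have comp: "(\<lambda>f. f b) \<in> borel_measurable (Pi\<^sub>M Basis (\<lambda>_. lborel :: real measure))" if "b \<in> Basis" for b :: 'a
      using measurable_component_singleton[OF that, of "\<lambda>_. lborel :: real measure"] by simp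
    have [measurable]: "(\<lambda>f. \<Sum>b\<in>A. (f b)\<^sup>2) \<in> borel_measurable (Pi\<^sub>M Basis (\<lambda>_. lborel :: real measure))"
      if "A \<subseteq> Basis" for A :: "'a set"
    proof (intro borel_measurable_sum)
      fix b assume "b \<in> A"
      then have [measurable]: "(\<lambda>f. f b) \<in> borel_measurable (Pi\<^sub>M Basis (\<lambda>_. lborel :: real measure))"
        using that by (intro comp) auto
      show "(\<lambda>f. (f b)\<^sup>2) \<in> borel_measurable (Pi\<^sub>M Basis (\<lambda>_. lborel :: real measure))" by measurable
    qed
    have "?f \<in> borel_measurable (Pi\<^sub>M Basis (\<lambda>_. lborel))"
      using B0(1) by measurable
    then show "?f \<in> borel_measurable (Pi\<^sub>M (B0 \<union> ?J) (\<lambda>_. lborel))"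
      using B0(1) by (simp add: Un_absorb1)
  qed (use finB0 in auto)
  also have "\<dots> = (\<integral>\<^sup>+x. (\<integral>\<^sup>+y. ?g x * ?h y \<partial>Pi\<^sub>M ?J (\<lambda>_. lborel)) \<partial>Pi\<^sub>M B0 (\<lambda>_. lborel))"
  proof (intro nn_integral_cong)
    fix x y :: "'a \<Rightarrow> real"
    let ?m = "merge B0 ?J (x, y)"
    have 1: "(\<Sum>b\<in>B0. (?m b)\<^sup>2) = (\<Sum>b\<in>B0. (x b)\<^sup>2)" by (intro sum.cong) (auto simp: merge_def)
    have 2: "(\<Sum>b\<in>?J. (?m b)\<^sup>2) = (\<Sum>b\<in>?J. (y b)\<^sup>2)" by (intro sum.cong) (auto simp: merge_def)
    have 3: "(\<Sum>b\<in>Basis. (?m b)\<^sup>2) = (\<Sum>b\<in>B0. (x b)\<^sup>2) + (\<Sum>b\<in>?J. (y b)\<^sup>2)"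
      unfolding 1[symmetric] 2[symmetric] using B0(1)
      by (subst sum.union_disjoint[symmetric]) (auto simp: finB0 Un_absorb1)
    show "?f ?m = ?g x * ?h y"
      unfolding 1 3 by (simp add: ennreal_mult'[symmetric] exp_add[symmetric] sum_nonneg add_divide_distrib)
  qed
  also have "\<dots> = (\<integral>\<^sup>+x. ?g x \<partial>Pi\<^sub>M B0 (\<lambda>_. lborel)) * ennreal (sqrt (2 * pi) ^ card ?J)"
    using nn_integral_gauss_PiM[of ?J] by (simp add: nn_integral_cmult nn_integral_multc)
  also have "(\<integral>\<^sup>+x. ?g x \<partial>Pi\<^sub>M B0 (\<lambda>_. lborel))
      = (\<integral>\<^sup>+x. (\<lambda>s. ennreal (s * exp (- s\<^sup>2 / 2))) (sqrt (\<Sum>b\<in>B0. (x b)\<^sup>2)) \<partial>Pi\<^sub>M B0 (\<lambda>_. lborel))"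
    by (intro nn_integral_cong) (simp add: sum_nonneg)
  also have "\<dots> = ennreal (real (card B0) * unit_ball_vol (real (card B0))) *
      (\<integral>\<^sup>+s. ennreal (s ^ (card B0 - 1)) * indicator {0..} s * ennreal (s * exp (- s\<^sup>2 / 2)) \<partial>lborel)"
    by (rule nn_integral_norm_PiM[OF finB0 neB0]) measurable
  also have "(\<integral>\<^sup>+s. ennreal (s ^ (card B0 - 1)) * indicator {0..} s * ennreal (s * exp (- s\<^sup>2 / 2)) \<partial>lborel) = gauss_moment (card B0)"
    unfolding gauss_moment_def
  proof (rule nn_integral_cong)
    fix s :: real
    have "s ^ card B0 = s ^ (card B0 - 1) * s"
      using neB0 finB0 by (metis card_gt_0_iff power_minus_mult)
    then show "ennreal (s ^ (card B0 - 1)) * indicator {0..} s * ennreal (s * exp (- s\<^sup>2 / 2)) =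
        ennreal (s ^ card B0 * exp (- s\<^sup>2 / 2)) * indicator {0..} s"
      by (auto simp: indicator_def ennreal_mult'[symmetric] mult_ac)
  qed
  also have "card ?J = DIM('a) - card B" using B0 finB0 by (simp add: card_Diff_subset)
  finally show ?thesis
    by (simp add: B0(2) ennreal_mult' mult_ac)
qed

section \<open>The half sphere\<close>

lemma sets_sphere_measure: "sets (sphere_measure :: 'a::euclidean_space measure) = sets borel"
  by (simp add: sphere_measure_def)

lemma half_sphere_sets: "half_sphere e \<in> sets (borel :: 'a::euclidean_space measure)"
proof -
  have "closed {x::'a. norm x = 1 \<and> 0 \<le> x \<bullet> e}"
    by (intro closed_Collect_conj closed_Collect_eq closed_Collect_le continuous_intros)
  then show ?thesis by (simp add: half_sphere_def)
qed

lemma space_half_sphere_uniform: "space (half_sphere_uniform e) = half_sphere (e::'a::euclidean_space)"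
  by (simp add: half_sphere_uniform_def space_restrict_space sphere_measure_def space_scale_measure)

lemma sets_half_sphere_uniform:
  "sets (half_sphere_uniform e) = sets (restrict_space borel (half_sphere (e::'a::euclidean_space)))"
  unfolding half_sphere_uniform_def
  by (rule sets_restrict_space_cong) (simp add: sets_sphere_measure)

lemma measurable_half_sphere_uniform:
  "f \<in> borel \<rightarrow>\<^sub>M N \<Longrightarrow> f \<in> half_sphere_uniform (e::'a::euclidean_space) \<rightarrow>\<^sub>M N"
  by (subst measurable_cong_sets[OF sets_half_sphere_uniform refl]) (rule measurable_restrict_space1)

lemma AE_inner_neq_0:
  fixes e :: "'a::euclidean_space"
  assumes "e \<noteq> 0"
  shows "AE x in lborel. x \<bullet> e \<noteq> 0"
proof -
  have "{x. e \<bullet> x = 0} \<in> null_sets lebesgue"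
    using negligible_hyperplane[of e 0] assms by (simp add: negligible_iff_null_sets)
  moreover have "{x. e \<bullet> x = 0} \<in> sets borel" by measurable
  ultimately have "{x. e \<bullet> x = 0} \<in> null_sets lborel"
    by (metis null_sets_completion_iff sets_lborel)
  from AE_not_in[OF this] show ?thesis by (simp add: inner_commute)
qed

lemma nn_integral_sphere_measure:
  fixes h :: "'a::euclidean_space \<Rightarrow> ennreal"
  assumes [measurable]: "h \<in> borel_measurable borel"
  shows "(\<integral>\<^sup>+v. h v \<partial>sphere_measure) = of_nat DIM('a) * (\<integral>\<^sup>+x. h (sgn x) * indicator (cball 0 1) x \<partial>lborel)"
proof -
  have cb: "cball 0 1 - {0} \<in> sets (borel :: 'a measure)" by simp
  have sgn[measurable]: "(sgn :: 'a \<Rightarrow> 'a) \<in> borel \<rightarrow>\<^sub>M borel"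
    unfolding sgn_div_norm[abs_def] by measurable
  have "(\<integral>\<^sup>+v. h v \<partial>sphere_measure) = of_nat DIM('a) *
      (\<integral>\<^sup>+v. h v \<partial>distr (restrict_space lborel (cball 0 1 - {0::'a})) borel sgn)"
    unfolding sphere_measure_def by (subst nn_integral_scale_measure) auto
  also have "(\<integral>\<^sup>+v. h v \<partial>distr (restrict_space lborel (cball 0 1 - {0::'a})) borel sgn)
      = (\<integral>\<^sup>+x. h (sgn x) \<partial>restrict_space lborel (cball 0 1 - {0::'a}))"
    by (intro nn_integral_distr measurable_restrict_space1) auto
  also have "\<dots> = (\<integral>\<^sup>+x. h (sgn x) * indicator (cball 0 1 - {0}) x \<partial>lborel)"
    by (subst nn_integral_restrict_space) (simp_all add: cb)
  also have "\<dots> = (\<integral>\<^sup>+x. h (sgn x) * indicator (cball 0 1) x \<partial>lborel)"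
  proof (rule nn_integral_cong_AE)
    show "AE x in lborel. h (sgn x) * indicator (cball 0 1 - {0}) x = h (sgn x) * indicator (cball 0 1) x"
      using AE_lborel_singleton[of "0::'a"] by eventually_elim (auto simp: indicator_def)
  qed
  finally show ?thesis .
qed

text \<open>Reflection exchanges the half spheres \<open>0 \<le> x \<bullet> e\<close> and
  \<open>x \<bullet> e \<le> 0\<close>; they share only the equator, whose cone is a null
  set.\<close>

lemma nn_integral_half_sphere_even:
  fixes h :: "'a::euclidean_space \<Rightarrow> ennreal"
  assumes [measurable]: "h \<in> borel_measurable borel" and e: "e \<noteq> 0"
    and even: "\<And>v. h (- v) = h v"
  shows "2 * (\<integral>\<^sup>+v. h v * indicator (half_sphere e) v \<partial>sphere_measure) = (\<integral>\<^sup>+v. h v \<partial>sphere_measure)"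
proof -
  note half_sphere_sets[measurable]
  have cb[measurable]: "cball 0 1 \<in> sets (borel :: 'a measure)" by simp
  have sgn[measurable]: "(sgn :: 'a \<Rightarrow> 'a) \<in> borel \<rightarrow>\<^sub>M borel"
    unfolding sgn_div_norm[abs_def] by measurable
  let ?f = "\<lambda>x. h (sgn x) * indicator (cball 0 1) x"
  have half: "sgn x \<in> half_sphere e \<longleftrightarrow> 0 \<le> x \<bullet> e" if "x \<bullet> e \<noteq> 0" for x
  proof -
    have "x \<noteq> 0" using that by auto
    then have "norm (sgn x) = 1" by (simp add: norm_sgn)
    moreover have "0 \<le> sgn x \<bullet> e \<longleftrightarrow> 0 \<le> x \<bullet> e"
      using \<open>x \<noteq> 0\<close> by (auto simp: sgn_div_norm zero_le_mult_iff)
    ultimately show ?thesis by (simp add: half_sphere_def)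
  qed
  have "(\<integral>\<^sup>+x. h (sgn x) * indicator (half_sphere e) (sgn x) * indicator (cball 0 1) x \<partial>lborel)
      = (\<integral>\<^sup>+x. ?f x * indicator {x. 0 \<le> x \<bullet> e} x \<partial>lborel)"
    using AE_inner_neq_0[OF e] by (intro nn_integral_cong_AE) (auto simp: indicator_def half)
  moreover have "(\<integral>\<^sup>+x. ?f x * indicator {x. 0 \<le> x \<bullet> e} x \<partial>lborel) = (\<integral>\<^sup>+x. ?f x * indicator {x. x \<bullet> e \<le> 0} x \<partial>lborel)"
    using nn_integral_lborel_reflect[of "\<lambda>x. ?f x * indicator {x. 0 \<le> x \<bullet> e} x"]
    by (simp add: sgn_minus even indicator_def)
  moreover have "(\<integral>\<^sup>+x. ?f x * indicator {x. 0 \<le> x \<bullet> e} x \<partial>lborel) + (\<integral>\<^sup>+x. ?f x * indicator {x. x \<bullet> e \<le> 0} x \<partial>lborel)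
      = (\<integral>\<^sup>+x. ?f x \<partial>lborel)"
    using AE_inner_neq_0[OF e]
    by (subst nn_integral_add[symmetric]) (auto intro!: nn_integral_cong_AE simp: indicator_def)
  ultimately show ?thesis
    by (simp add: nn_integral_sphere_measure mult_2 distrib_left[symmetric] mult.left_commute[of 2])
qed

text \<open>For even functions the mean over the half sphere is the mean over the full sphere, and
  hence the mean of \<open>h (sgn x)\<close> over the unit ball. The product form avoids a division
  in \<open>ennreal\<close>.\<close>

lemma nn_integral_half_sphere_uniform:
  fixes h :: "'a::euclidean_space \<Rightarrow> ennreal"
  assumes [measurable]: "h \<in> borel_measurable borel" and e: "e \<noteq> 0"
    and even: "\<And>v. h (- v) = h v"
  shows "(\<integral>\<^sup>+v. h v \<partial>half_sphere_uniform e) * ennreal (unit_ball_vol (real DIM('a)))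
    = (\<integral>\<^sup>+x. h (sgn x) * indicator (cball 0 1) x \<partial>lborel)"
proof -
  let ?H = "half_sphere e" and ?S = "sphere_measure :: 'a measure" and ?\<kappa> = "ennreal (unit_ball_vol (real DIM('a)))"
  note half_sphere_sets[measurable] sets_sphere_measure[measurable_cong]
  let ?d = "of_nat DIM('a) :: ennreal"
  have d: "?d = ennreal (real DIM('a))" by (simp add: ennreal_of_nat_eq_real_of_nat)
  have "emeasure ?S (space ?S) = ?d * ?\<kappa>"
    using nn_integral_sphere_measure[of "\<lambda>_::'a. 1"] by (simp add: emeasure_cball)
  then have H: "2 * emeasure ?S ?H = ?d * ?\<kappa>"
    using nn_integral_half_sphere_even[of "\<lambda>_. 1" e] e by simp
  then have "2 * emeasure ?S ?H = ennreal (real DIM('a) * unit_ball_vol (real DIM('a)))"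
    by (simp add: d ennreal_mult)
  moreover have "real DIM('a) * unit_ball_vol (real DIM('a)) > 0" by simp
  ultimately have fin: "emeasure ?S ?H \<noteq> 0" "emeasure ?S ?H \<noteq> top"
    by (auto simp del: mult_pos_pos simp: ennreal_eq_0_iff ennreal_mult_eq_top_iff not_le)
  have "(\<integral>\<^sup>+v. h v \<partial>half_sphere_uniform e) = (\<integral>\<^sup>+v. h v * indicator ?H v \<partial>uniform_measure ?S ?H)"
    unfolding half_sphere_uniform_def
    by (subst nn_integral_restrict_space) (simp_all add: sets_sphere_measure)
  also have "\<dots> = (\<integral>\<^sup>+v. h v * indicator ?H v * indicator ?H v \<partial>?S) / emeasure ?S ?H"
    by (subst nn_integral_uniform_measure) (auto simp: sets_sphere_measure)
  also have "(\<integral>\<^sup>+v. h v * indicator ?H v * indicator ?H v \<partial>?S) = (\<integral>\<^sup>+v. h v * indicator ?H v \<partial>?S)"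
    by (intro nn_integral_cong) (auto simp: indicator_def)
  finally have "(\<integral>\<^sup>+v. h v \<partial>half_sphere_uniform e) * emeasure ?S ?H = (\<integral>\<^sup>+v. h v * indicator ?H v \<partial>?S)"
    using fin by (simp add: ennreal_divide_times ennreal_divide_self less_top)
  then have "(\<integral>\<^sup>+v. h v \<partial>half_sphere_uniform e) * (2 * emeasure ?S ?H) = (\<integral>\<^sup>+v. h v \<partial>?S)"
    using nn_integral_half_sphere_even[of h e] e even by (simp add: mult.left_commute[of _ 2])
  then have "?d * ((\<integral>\<^sup>+v. h v \<partial>half_sphere_uniform e) * ?\<kappa>) = ?d * (\<integral>\<^sup>+x. h (sgn x) * indicator (cball 0 1) x \<partial>lborel)"
    unfolding H by (simp add: nn_integral_sphere_measure mult_ac)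
  then show ?thesis by (simp add: d ennreal_mult_cancel_left)
qed

lemma prob_space_half_sphere_uniform:
  assumes e: "(e::'a::euclidean_space) \<noteq> 0"
  shows "prob_space (half_sphere_uniform e)"
proof
  have "emeasure (half_sphere_uniform e) (space (half_sphere_uniform e)) * ennreal (unit_ball_vol (real DIM('a)))
      = 1 * ennreal (unit_ball_vol (real DIM('a)))"
    using nn_integral_half_sphere_uniform[of "\<lambda>_::'a. 1" e] e by (simp add: emeasure_cball)
  then show "emeasure (half_sphere_uniform e) (space (half_sphere_uniform e)) = 1"
    unfolding mult_right_ennreal_cancel using unit_ball_vol_pos[of "real DIM('a)"] by linarith
qed

text \<open>
  For \<open>h\<close> homogeneous of degree 0 the pushforward of \<open>h dx\<close> under the norm has a density proportional to
  \<open>s ^ (d - 1)\<close>; this transfers spherical means to Gaussian integrals.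
\<close>

lemma nn_integral_polar:
  fixes h :: "'a::euclidean_space \<Rightarrow> ennreal"
  assumes [measurable]: "h \<in> borel_measurable borel" "w \<in> borel_measurable borel"
    and H: "(\<integral>\<^sup>+x. h (sgn x) * indicator (cball 0 1) x \<partial>lborel) = ennreal H" "H \<ge> 0"
  shows "(\<integral>\<^sup>+x. h (sgn x) * w (norm x) \<partial>lborel) =
     ennreal (H * real DIM('a)) * (\<integral>\<^sup>+s. ennreal (s ^ (DIM('a) - 1)) * indicator {0..} s * w s \<partial>lborel)"
proof -
  have sgn[measurable]: "(sgn :: 'a \<Rightarrow> 'a) \<in> borel \<rightarrow>\<^sub>M borel"
    unfolding sgn_div_norm[abs_def] by measurable
  have cb[measurable]: "cball 0 s \<in> sets (borel :: 'a measure)" for s by simp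
  let ?d = "DIM('a)"
  let ?N = "distr (density lborel (\<lambda>x::'a. h (sgn x))) borel norm"
  have N: "?N = density lborel (\<lambda>s. ennreal (H * real ?d * s ^ (?d - 1)) * indicator {0..} s)"
  proof (rule measure_eq_power_density)
    fix s :: real assume s: "s > 0"
    have "norm -` {..s} = cball (0::'a) s" by auto
    then have "emeasure ?N {..s} = (\<integral>\<^sup>+x. h (sgn x) * indicator (cball 0 s) x \<partial>lborel)"
      by (simp add: emeasure_distr emeasure_density)
    also have "\<dots> = ennreal (s ^ ?d) * (\<integral>\<^sup>+x. h (sgn (s *\<^sub>R x)) * indicator (cball 0 s) (s *\<^sub>R x) \<partial>lborel)"
      by (rule nn_integral_lborel_scale[OF _ s]) measurable
    also have "(\<integral>\<^sup>+x. h (sgn (s *\<^sub>R x)) * indicator (cball 0 s) (s *\<^sub>R x) \<partial>lborel) = (\<integral>\<^sup>+x. h (sgn x) * indicator (cball 0 1) x \<partial>lborel)"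
      using s by (intro nn_integral_cong) (auto simp: indicator_def sgn_scaleR mult_le_cancel_left2)
    finally show "emeasure ?N {..s} = ennreal (H * s ^ ?d)"
      using H s by (simp add: ennreal_mult' mult.commute)
  qed (use H in auto)
  have "(\<integral>\<^sup>+x. h (sgn x) * w (norm x) \<partial>lborel) = (\<integral>\<^sup>+s. w s \<partial>?N)"
    by (simp add: nn_integral_distr nn_integral_density)
  also have "\<dots> = (\<integral>\<^sup>+s. ennreal (H * real ?d) * (ennreal (s ^ (?d - 1)) * indicator {0..} s * w s) \<partial>lborel)"
    unfolding N using H(2) by (subst nn_integral_density)
      (auto intro!: nn_integral_cong simp: indicator_def ennreal_mult' ennreal_mult mult_ac)
  finally show ?thesis by (simp add: nn_integral_cmult)
qed

text \<open>
  The mean norm of the projection of a uniform unit vector of a \<open>d\<close>-dimensional space to an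
  \<open>n\<close>-dimensional subspace.
\<close>

definition mean_proj :: "nat \<Rightarrow> nat \<Rightarrow> real" where
  "mean_proj d n = real n * unit_ball_vol (real n) * unit_ball_vol (real (d - 1)) /
     (unit_ball_vol (real (n - 1)) * (real d * unit_ball_vol (real d)))"

text \<open>The functional equation of \<open>Gamma\<close>. It lowers the indices
  \<open>n + 1\<close> and \<open>d + 1\<close> of the Gaussian moments to \<open>n - 1\<close> and
  \<open>d - 1\<close>, those of \<open>mean_proj\<close>.\<close>

lemma unit_ball_vol_step: "unit_ball_vol (real (Suc (Suc n))) * real (Suc (Suc n)) = 2 * pi * unit_ball_vol (real n)"
proof -
  have G: "Gamma (real (Suc (Suc n)) / 2 + 1) = (real (Suc (Suc n)) / 2) * Gamma (real n / 2 + 1)"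
  proof -
    have "real (Suc (Suc n)) / 2 = real n / 2 + 1" by simp
    moreover have "real n / 2 + 1 \<notin> \<int>\<^sub>\<le>\<^sub>0" using nonpos_Ints_nonpos[of "real n / 2 + 1"] by fastforce
    ultimately show ?thesis by (metis Gamma_plus1)
  qed
  have P: "pi powr (real (Suc (Suc n)) / 2) = pi powr (real n / 2) * pi"
  proof -
    have "real (Suc (Suc n)) / 2 = real n / 2 + 1" by simp
    then show ?thesis by (simp only: powr_add powr_one[OF pi_ge_zero])
  qed
  have "Gamma (real n / 2 + 1) > 0" by (intro Gamma_real_pos) simp
  then show ?thesis unfolding unit_ball_vol_def G P by (simp add: field_simps del: of_nat_Suc)
qed

text \<open>The projection norm is homogeneous of degree 1, so its Gaussian mean is the spherical
  mean times a radial moment. The Gaussian mean is already known by rotation, and comparing the two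
  isolates the spherical mean.\<close>

lemma nn_integral_proj_norm_half_sphere:
  fixes B :: "'a::euclidean_space set"
  assumes B: "orthonormal B" "B \<noteq> {}" and e: "e \<noteq> 0"
  shows "(\<integral>\<^sup>+v. ennreal (proj_norm B v) \<partial>half_sphere_uniform e) = ennreal (mean_proj DIM('a) (card B))"
proof -
  define d where "d = DIM('a)"
  define n where "n = card B"
  have n: "n > 0" unfolding n_def using B orthonormal_finite by (simp add: card_gt_0_iff)
  have d: "d > 0" by (simp add: d_def)
  interpret Q: prob_space "half_sphere_uniform e" using e by (rule prob_space_half_sphere_uniform)
  let ?E = "\<integral>\<^sup>+v. ennreal (proj_norm B v) \<partial>half_sphere_uniform e"
  have n_le: "n \<le> d"
  proof -
    obtain B0 where "B0 \<subseteq> (Basis::'a set)" "card B0 = card B"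
      using orthonormal_extend_basis[OF B(1)] by metis
    then show ?thesis unfolding n_def d_def by (metis card_mono finite_Basis)
  qed
  have le: "proj_norm B v \<le> sqrt (card B)" if "norm v = 1" for v
  proof -
    have "(\<Sum>b\<in>B. (v \<bullet> b)\<^sup>2) \<le> (\<Sum>b\<in>B. 1)"
    proof (rule sum_mono)
      fix b assume "b \<in> B"
      then have "\<bar>v \<bullet> b\<bar> \<le> 1" using Cauchy_Schwarz_ineq2[of v b] B that by (simp add: orthonormal_def)
      then show "(v \<bullet> b)\<^sup>2 \<le> 1" by (simp add: abs_square_le_1)
    qed
    then show ?thesis by (simp add: proj_norm_def)
  qed
  \<comment> \<open>Finiteness of the mean lets the comparison of constants take place in the
    reals.\<close>
  have "?E \<le> (\<integral>\<^sup>+v. ennreal (sqrt (card B)) \<partial>half_sphere_uniform e)"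
    by (intro nn_integral_mono ennreal_leI le) (auto simp: space_half_sphere_uniform half_sphere_def)
  also have "\<dots> < top" by (simp add: Q.emeasure_space_1)
  finally obtain E where E: "?E = ennreal E" "E \<ge> 0" by (cases ?E) auto
  define \<kappa> where "\<kappa> j = unit_ball_vol (real j)" for j
  have \<kappa>: "\<kappa> j > 0" for j by (simp add: \<kappa>_def)
  define q where "q = sqrt (2 * pi)"
  have q: "q > 0" by (simp add: q_def)
  have "(\<integral>\<^sup>+x. ennreal (proj_norm B (sgn x)) * indicator (cball 0 1) x \<partial>lborel) = ennreal (E * \<kappa> d)"
    using nn_integral_half_sphere_uniform[of "\<lambda>v. ennreal (proj_norm B v)" e] e E
    by (simp add: proj_norm_def[of _ "- _"] proj_norm_def[symmetric] ennreal_mult \<kappa>_def d_def)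
  then have "(\<integral>\<^sup>+(x::'a). ennreal (proj_norm B (sgn x)) * ennreal (norm x * exp (- (norm x)\<^sup>2 / 2)) \<partial>lborel)
     = ennreal (E * \<kappa> d * real d) * (\<integral>\<^sup>+s. ennreal (s ^ (d - 1)) * indicator {0..} s * ennreal (s * exp (- s\<^sup>2 / 2)) \<partial>lborel)"
    using E \<kappa> by (subst nn_integral_polar[where H = "E * \<kappa> d" and w = "\<lambda>s. ennreal (s * exp (- s\<^sup>2 / 2))"])
      (auto simp: d_def less_imp_le)
  also have "(\<integral>\<^sup>+s. ennreal (s ^ (d - 1)) * indicator {0..} s * ennreal (s * exp (- s\<^sup>2 / 2)) \<partial>lborel) = gauss_moment d"
    unfolding gauss_moment_def
  proof (rule nn_integral_cong)
    fix s :: real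
    have "s ^ d = s ^ (d - 1) * s" using d by (metis power_minus_mult)
    then show "ennreal (s ^ (d - 1)) * indicator {0..} s * ennreal (s * exp (- s\<^sup>2 / 2)) =
        ennreal (s ^ d * exp (- s\<^sup>2 / 2)) * indicator {0..} s"
      by (auto simp: indicator_def ennreal_mult'[symmetric] mult_ac)
  qed
  also have "(\<integral>\<^sup>+(x::'a). ennreal (proj_norm B (sgn x)) * ennreal (norm x * exp (- (norm x)\<^sup>2 / 2)) \<partial>lborel)
      = (\<integral>\<^sup>+x. ennreal (proj_norm B x * exp (- (norm x)\<^sup>2 / 2)) \<partial>lborel)"
  proof (rule nn_integral_cong)
    fix x :: 'a
    have "proj_norm B x = norm x * proj_norm B (sgn x)"
      using proj_norm_scaleR[of B "norm x" "sgn x"]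
      by (cases "x = 0") (auto simp: sgn_div_norm proj_norm_def)
    then show "ennreal (proj_norm B (sgn x)) * ennreal (norm x * exp (- (norm x)\<^sup>2 / 2)) = ennreal (proj_norm B x * exp (- (norm x)\<^sup>2 / 2))"
      by (simp add: ennreal_mult'[symmetric] proj_norm_nonneg mult_ac)
  qed
  also have "\<dots> = ennreal (real n * \<kappa> n * q ^ (d - n)) * gauss_moment n"
    unfolding nn_integral_proj_norm_gauss[OF B] by (simp add: n_def d_def \<kappa>_def q_def)
  finally have "ennreal (real n * \<kappa> n * q ^ (d - n) * (q ^ Suc n / (real (Suc n) * \<kappa> (Suc n))))
      = ennreal (E * \<kappa> d * real d * (q ^ Suc d / (real (Suc d) * \<kappa> (Suc d))))"
    unfolding gauss_moment_eq q_def[symmetric] \<kappa>_def[symmetric] using q \<kappa> E(2)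
    by (subst (asm) (1 2) ennreal_mult'[symmetric]) (auto simp: less_imp_le)
  then have "real n * \<kappa> n * q ^ (d - n) * (q ^ Suc n / (real (Suc n) * \<kappa> (Suc n)))
      = E * \<kappa> d * real d * (q ^ Suc d / (real (Suc d) * \<kappa> (Suc d)))"
    using q \<kappa> E(2) by (subst (asm) ennreal_inj) (auto simp: less_imp_le)
  moreover have "\<kappa> (Suc n) * real (Suc n) = 2 * pi * \<kappa> (n - 1)" "\<kappa> (Suc d) * real (Suc d) = 2 * pi * \<kappa> (d - 1)"
    using unit_ball_vol_step[of "n - 1"] unit_ball_vol_step[of "d - 1"] n d by (simp_all add: \<kappa>_def)
  moreover have "q ^ (d - n) * q ^ Suc n = q ^ Suc d"
    using n_le by (simp add: power_add[symmetric])
  ultimately have "(real n * \<kappa> n) * q ^ Suc d / (2 * pi * \<kappa> (n - 1)) = E * \<kappa> d * real d * (q ^ Suc d / (2 * pi * \<kappa> (d - 1)))"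
    by (simp only: mult.commute[of "real (Suc _)"] times_divide_eq_right mult.assoc)
  then have "E = mean_proj d n"
    unfolding mean_proj_def \<kappa>_def[symmetric] using q \<kappa>[of d] \<kappa>[of "n - 1"] \<kappa>[of "d - 1"] d
    by (simp add: field_simps)
  then show ?thesis by (simp add: E d_def n_def)
qed

section \<open>The Campbell formula\<close>

text \<open>The sum is the number of indices \<open>i\<close> with \<open>x i \<in> B\<close>.
  Excluding all finite values therefore forces the value infinity.\<close>

lemma suminf_indicator_cases:
  "(\<Sum>i. indicator B (x i)) = (\<infinity>::ennreal) \<or> (\<exists>n. (\<Sum>i. indicator B (x i)) = (of_nat n :: ennreal))"
proof -
  have "(\<Sum>i. indicator B (x i)) = (\<integral>\<^sup>+i. indicator {i. x i \<in> B} i \<partial>count_space UNIV :: ennreal)"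
    by (simp add: nn_integral_count_space_nat indicator_def)
  also have "\<dots> = emeasure (count_space UNIV) {i. x i \<in> B}" by simp
  finally have "(\<Sum>i. indicator B (x i)) = emeasure (count_space UNIV) {i. x i \<in> B}" .
  then show ?thesis
    by (cases "finite {i. x i \<in> B}") (auto simp: emeasure_count_space_finite)
qed

text \<open>The marks live in an arbitrary probability space \<open>Q\<close>: counts and moments
  depend on the geometry only through a kernel, so hyperplanes enter much later. The first
  coordinate alone serves to separate points.\<close>

locale marked_poisson = prob_space M + Q: prob_space Q
  for M :: "'w measure" and Q :: "'c measure" +
  fixes lam :: real and X :: "nat \<Rightarrow> 'w \<Rightarrow> real \<times> 'c"
  assumes lam_pos: "lam > 0"
    and poisson: "poisson_process M (scale_measure (ennreal lam) (lborel \<Otimes>\<^sub>M Q)) X"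
begin

definition \<mu> :: "(real \<times> 'c) measure" where
  "\<mu> = scale_measure (ennreal lam) (lborel \<Otimes>\<^sub>M Q)"

lemma sets_mu[measurable_cong]: "sets \<mu> = sets (borel \<Otimes>\<^sub>M Q)"
  by (simp add: \<mu>_def cong: sets_pair_measure_cong)

lemma space_mu: "space \<mu> = UNIV \<times> space Q"
  by (simp add: \<mu>_def space_scale_measure space_pair_measure)

lemma X_measurable[measurable]: "X i \<in> M \<rightarrow>\<^sub>M \<mu>"
  using poisson by (simp add: poisson_process_def \<mu>_def)

lemma nn_integral_mu:
  assumes [measurable]: "f \<in> borel_measurable \<mu>"
  shows "(\<integral>\<^sup>+x. f x \<partial>\<mu>) = ennreal lam * (\<integral>\<^sup>+v. (\<integral>\<^sup>+p. f (p, v) \<partial>lborel) \<partial>Q)"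
proof -
  interpret pair_sigma_finite "lborel :: real measure" Q ..
  have [measurable]: "f \<in> borel_measurable (lborel \<Otimes>\<^sub>M Q)"
    using assms by (simp add: \<mu>_def measurable_def space_scale_measure)
  have "(\<integral>\<^sup>+x. f x \<partial>\<mu>) = ennreal lam * (\<integral>\<^sup>+x. f x \<partial>(lborel \<Otimes>\<^sub>M Q))"
    unfolding \<mu>_def by (rule nn_integral_scale_measure) measurable
  then show ?thesis by (simp add: nn_integral_snd)
qed

lemma emeasure_mu_strip:
  assumes [measurable]: "A \<in> sets borel"
  shows "emeasure \<mu> (A \<times> space Q) = ennreal lam * emeasure lborel A"
  by (simp add: \<mu>_def Q.emeasure_pair_measure_Times Q.emeasure_space_1)

lemma fst_measurable_mu[measurable]: "fst \<in> \<mu> \<rightarrow>\<^sub>M borel"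
  and snd_measurable_mu[measurable]: "snd \<in> \<mu> \<rightarrow>\<^sub>M Q"
  by (simp_all add: measurable_cong_sets[OF sets_mu refl])

sublocale mu: sigma_finite_measure \<mu>
proof
  show "\<exists>A. countable A \<and> A \<subseteq> sets \<mu> \<and> \<Union> A = space \<mu> \<and> (\<forall>a\<in>A. emeasure \<mu> a \<noteq> \<infinity>)"
  proof (intro exI conjI ballI)
    let ?A = "range (\<lambda>n::nat. {- real n..real n} \<times> space Q)"
    show "?A \<subseteq> sets \<mu>" by auto
    have "\<exists>n. x \<in> {- real n..real n}" for x
      using real_arch_simple[of "\<bar>x\<bar>"] by (auto simp: abs_le_iff minus_le_iff)
    then show "\<Union> ?A = space \<mu>" by (auto simp: space_mu)
    show "emeasure \<mu> a \<noteq> \<infinity>" if "a \<in> ?A" for a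
      using that by (auto simp: emeasure_mu_strip ennreal_mult_eq_top_iff)
  qed auto
qed

sublocale prod: product_sigma_finite "\<lambda>_::nat. \<mu>" by standard

lemma point_count_measurable[measurable]:
  assumes [measurable]: "B \<in> sets \<mu>"
  shows "point_count X B \<in> borel_measurable M"
  unfolding point_count_def[abs_def] by measurable

text \<open>The Poisson weights sum to 1, which leaves no mass for an infinite count.\<close>

lemma point_count_law:
  assumes B[measurable]: "B \<in> sets \<mu>" and t: "emeasure \<mu> B = ennreal t" "t \<ge> 0"
  shows "AE \<omega> in M. \<exists>n. point_count X B \<omega> = of_nat n"
    and "prob {\<omega>\<in>space M. point_count X B \<omega> = of_nat n} = exp (- t) * t ^ n / fact n"
proof -
  show P: "prob {\<omega>\<in>space M. point_count X B \<omega> = of_nat n} = exp (- t) * t ^ n / fact n" for n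
    using poisson B t by (simp add: poisson_process_def \<mu>_def poisson_prob_def)
  let ?E = "\<lambda>n. {\<omega>\<in>space M. point_count X B \<omega> = of_nat n}"
  have E: "?E n \<in> events" for n by measurable
  have "(\<lambda>n. exp (- t) * (t ^ n /\<^sub>R fact n)) sums (exp (- t) * exp t)"
    by (intro sums_mult exp_converges)
  then have "(\<lambda>n. prob (?E n)) sums 1"
    unfolding P by (simp add: exp_minus_inverse mult.commute divide_inverse mult_ac scaleR_conv_of_real)
  moreover have "(\<lambda>n. prob (?E n)) sums prob (\<Union>n. ?E n)"
    using E by (intro finite_measure_UNION) (auto simp: disjoint_family_on_def)
  ultimately have "prob (\<Union>n. ?E n) = 1" by (rule sums_unique2[symmetric])
  then have "AE \<omega> in M. \<omega> \<in> (\<Union>n. ?E n)" using E by (intro AE_prob_1) auto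
  then show "AE \<omega> in M. \<exists>n. point_count X B \<omega> = of_nat n" by eventually_elim auto
qed

lemma nn_integral_point_count_fun:
  assumes B[measurable]: "B \<in> sets \<mu>" and t: "emeasure \<mu> B = ennreal t" "t \<ge> 0"
    and [measurable]: "f \<in> borel_measurable borel"
  shows "(\<integral>\<^sup>+\<omega>. f (point_count X B \<omega>) \<partial>M) = (\<Sum>n. f (of_nat n) * ennreal (exp (- t) * t ^ n / fact n))"
proof -
  let ?E = "\<lambda>n. {\<omega>\<in>space M. point_count X B \<omega> = of_nat n}"
  have E: "?E n \<in> events" for n by measurable
  have "(\<integral>\<^sup>+\<omega>. f (point_count X B \<omega>) \<partial>M) = (\<integral>\<^sup>+\<omega>. (\<Sum>n. f (of_nat n) * indicator (?E n) \<omega>) \<partial>M)"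
  proof (rule nn_integral_cong_AE)
    show "AE \<omega> in M. f (point_count X B \<omega>) = (\<Sum>n. f (of_nat n) * indicator (?E n) \<omega>)"
      using point_count_law(1)[OF B t] AE_space
    proof eventually_elim
      case (elim \<omega>)
      then obtain k where k: "point_count X B \<omega> = of_nat k" by auto
      have "f (of_nat n) * indicator (?E n) \<omega> = (if n = k then f (of_nat k) else 0)" for n
        using k elim by (auto simp: indicator_def)
      then have "(\<Sum>n. f (of_nat n) * indicator (?E n) \<omega>) = f (of_nat k)"
        by (subst suminf_finite[of "{k}"]) auto
      then show ?case using k by simp
    qed
  qed
  also have "\<dots> = (\<Sum>n. f (of_nat n) * emeasure M (?E n))"
    using E by (subst nn_integral_suminf) (auto simp: nn_integral_cmult)
  finally show ?thesis
    using point_count_law(2)[OF B t] by (simp add: emeasure_eq_measure)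
qed

text \<open>For finite intensity the mean is the exponential series with its index shifted by one.
  For infinite intensity every finite value has probability 0, so the count is almost surely
  infinite and so is its mean.\<close>

lemma nn_integral_point_count:
  assumes B[measurable]: "B \<in> sets \<mu>"
  shows "(\<integral>\<^sup>+\<omega>. point_count X B \<omega> \<partial>M) = emeasure \<mu> B"
proof (cases "emeasure \<mu> B")
  case (real t)
  have "(\<lambda>n. t * exp (- t) * (t ^ n /\<^sub>R fact n)) sums (t * exp (- t) * exp t)"
    by (intro sums_mult exp_converges)
  then have "(\<lambda>n. real (Suc n) * (exp (- t) * t ^ Suc n / fact (Suc n))) sums t"
    by (simp add: exp_minus_inverse mult.assoc divide_inverse mult_ac scaleR_conv_of_real del: of_nat_Suc)
      (simp add: mult_ac exp_minus_inverse)
  then have s: "(\<lambda>n. real n * (exp (- t) * t ^ n / fact n)) sums t"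
    by (subst (asm) sums_Suc_iff) simp
  have "(\<integral>\<^sup>+\<omega>. point_count X B \<omega> \<partial>M) = (\<Sum>n. of_nat n * ennreal (exp (- t) * t ^ n / fact n))"
    using nn_integral_point_count_fun[OF B real(2,1), of "\<lambda>x. x"] by simp
  also have "\<dots> = (\<Sum>n. ennreal (real n * (exp (- t) * t ^ n / fact n)))"
    using real by (intro suminf_cong) (simp only: ennreal_mult' of_nat_0_le_iff ennreal_of_nat_eq_real_of_nat)
  also have "\<dots> = ennreal t"
    using real s by (subst suminf_ennreal2) (auto simp: sums_iff)
  finally show ?thesis by (simp add: real)
next
  case top
  have "AE \<omega> in M. point_count X B \<omega> \<noteq> of_nat n" for n
  proof (rule AE_I)
    show "emeasure M {\<omega>\<in>space M. point_count X B \<omega> = of_nat n} = 0"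
      using poisson B top by (simp add: poisson_process_def \<mu>_def poisson_prob_def emeasure_eq_measure)
  qed auto
  then have "AE \<omega> in M. \<forall>n. point_count X B \<omega> \<noteq> of_nat n" by (simp add: AE_all_countable)
  then have "AE \<omega> in M. point_count X B \<omega> = \<infinity>"
  proof eventually_elim
    case (elim \<omega>)
    then show ?case using suminf_indicator_cases[of B "\<lambda>i. X i \<omega>"] by (auto simp: point_count_def)
  qed
  then have "(\<integral>\<^sup>+\<omega>. point_count X B \<omega> \<partial>M) = (\<integral>\<^sup>+\<omega>. \<infinity> \<partial>M)" by (intro nn_integral_cong_AE)
  then show ?thesis using top by (simp add: emeasure_space_1)
qed

text \<open>Remove the counts 0 and 1 and use \<open>exp (- t) \<ge> 1 - t\<close>. The bound is
  quadratic, so its sum over a number of cells proportional to \<open>1 / t\<close> still tends to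
  0.\<close>

lemma prob_point_count_ge_2:
  assumes B[measurable]: "B \<in> sets \<mu>" and t: "emeasure \<mu> B = ennreal t" "t \<ge> 0"
  shows "prob {\<omega>\<in>space M. point_count X B \<omega> \<ge> 2} \<le> t\<^sup>2"
proof -
  let ?E = "\<lambda>n. {\<omega>\<in>space M. point_count X B \<omega> = of_nat n}"
  have "prob {\<omega>\<in>space M. point_count X B \<omega> \<ge> 2} \<le> prob (space M - (?E 0 \<union> ?E 1))"
    by (rule finite_measure_mono) auto
  also have "\<dots> = 1 - prob (?E 0 \<union> ?E 1)" by (rule prob_compl) measurable
  also have "prob (?E 0 \<union> ?E 1) = prob (?E 0) + prob (?E 1)"
    by (rule finite_measure_Union) auto
  also have "\<dots> = exp (- t) * (1 + t)"
    unfolding point_count_law(2)[OF B t] by (simp add: algebra_simps)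
  also have "1 - exp (- t) * (1 + t) \<le> t\<^sup>2"
  proof -
    have "(1 - t) * (1 + t) \<le> exp (- t) * (1 + t)"
      using t exp_ge_add_one_self[of "- t"] by (intro mult_right_mono) auto
    then show ?thesis by (simp add: power2_eq_square algebra_simps)
  qed
  finally show ?thesis .
qed

text \<open>
  Two points with the same first coordinate in \<open>[-R, R)\<close> share one of \<open>2 R n\<close> cells of measure
  \<open>lam / n\<close>, which has probability at most \<open>2 R n (lam / n)\<^sup>2\<close>.
\<close>

lemma AE_fst_distinct: "AE \<omega> in M. inj (\<lambda>i. fst (X i \<omega>))"
proof -
  have [measurable]: "(\<lambda>\<omega>. fst (X i \<omega>)) \<in> borel_measurable M" for i
    by measurable
  have *: "AE \<omega> in M. \<not> (\<bar>fst (X i \<omega>)\<bar> < real R \<and> fst (X i \<omega>) = fst (X j \<omega>))" if "i \<noteq> j" for i j R :: nat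
  proof -
    let ?E = "{\<omega>\<in>space M. \<bar>fst (X i \<omega>)\<bar> < real R \<and> fst (X i \<omega>) = fst (X j \<omega>)}"
    have "prob ?E \<le> 2 * real R * lam\<^sup>2 / real (Suc n)" for n
    proof -
      define m where "m = Suc n"
      let ?c = "\<lambda>k::int. {x \<in> space \<mu>. \<lfloor>real m * fst x\<rfloor> = k}"
      let ?K = "{- int (R * m)..<int (R * m)}"
      have cell: "?c k = {real_of_int k / m ..< (real_of_int k + 1) / m} \<times> space Q" for k
        by (auto simp: space_mu floor_eq_iff m_def field_simps)
      have c[measurable]: "?c k \<in> sets \<mu>" for k by measurable
      have ec: "emeasure \<mu> (?c k) = ennreal (lam / m)" for k
        unfolding cell using lam_pos
        by (subst emeasure_mu_strip) (auto simp: ennreal_mult'[symmetric] diff_divide_distrib[symmetric] divide_right_mono)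
      have "?E \<subseteq> (\<Union>k\<in>?K. {\<omega>\<in>space M. point_count X (?c k) \<omega> \<ge> 2})"
      proof
        fix \<omega> assume w: "\<omega> \<in> ?E"
        define k where "k = \<lfloor>real m * fst (X i \<omega>)\<rfloor>"
        have X: "X l \<omega> \<in> space \<mu>" for l using w by (intro measurable_space[OF X_measurable]) auto
        have "\<bar>real m * fst (X i \<omega>)\<bar> < real m * real R"
        proof -
          have "\<bar>fst (X i \<omega>)\<bar> < real R" using w by blast
          then show ?thesis by (simp add: abs_mult m_def del: of_nat_Suc)
        qed
        then have "k \<in> ?K" unfolding k_def by (auto simp: abs_less_iff le_floor_iff floor_less_iff mult.commute)
        moreover have "point_count X (?c k) \<omega> \<ge> 2"
        proof -
          have "(2::ennreal) = (\<Sum>l\<in>{i, j}. indicator (?c k) (X l \<omega>))"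
            using that w X by (simp add: k_def)
          also have "\<dots> \<le> (\<Sum>l. indicator (?c k) (X l \<omega>))" by (rule sum_le_suminf) auto
          finally show ?thesis by (simp add: point_count_def)
        qed
        ultimately show "\<omega> \<in> (\<Union>k\<in>?K. {\<omega>\<in>space M. point_count X (?c k) \<omega> \<ge> 2})" using w by auto
      qed
      then have "prob ?E \<le> prob (\<Union>k\<in>?K. {\<omega>\<in>space M. point_count X (?c k) \<omega> \<ge> 2})"
        by (rule finite_measure_mono) measurable
      also have "\<dots> \<le> (\<Sum>k\<in>?K. prob {\<omega>\<in>space M. point_count X (?c k) \<omega> \<ge> 2})"
        by (rule finite_measure_subadditive_finite) auto
      also have "\<dots> \<le> (\<Sum>k\<in>?K. (lam / m)\<^sup>2)"
        using lam_pos by (intro sum_mono prob_point_count_ge_2[OF c ec]) auto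
      also have "\<dots> = 2 * real R * lam\<^sup>2 / m"
      proof -
        have "m > 0" by (simp add: m_def)
        moreover have "real (card ?K) = 2 * real R * real m" by (simp add: nat_mult_distrib)
        ultimately show ?thesis by (simp only: sum_constant) (simp add: power2_eq_square field_simps)
      qed
      finally show ?thesis by (simp add: m_def)
    qed
    moreover have "(\<lambda>n. 2 * real R * lam\<^sup>2 / real (Suc n)) \<longlonglongrightarrow> 0"
      by (intro LIMSEQ_Suc[OF lim_const_over_n])
    ultimately have "prob ?E \<le> 0" by (intro LIMSEQ_le_const) auto
    then have "prob ?E = 0" by (intro antisym) simp_all
    then have "emeasure M ?E = 0" by (simp add: emeasure_eq_measure)
    then show ?thesis by (intro AE_I[where N = ?E]) auto
  qed
  have "AE \<omega> in M. \<forall>i j R. i \<noteq> j \<longrightarrow> \<not> (\<bar>fst (X i \<omega>)\<bar> < real R \<and> fst (X i \<omega>) = fst (X j \<omega>))"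
    unfolding AE_all_countable using * by (intro allI) auto
  then show ?thesis
  proof eventually_elim
    case (elim \<omega>)
    show ?case
    proof (rule injI)
      fix i j assume "fst (X i \<omega>) = fst (X j \<omega>)"
      moreover obtain R :: nat where "\<bar>fst (X i \<omega>)\<bar> < real R" using reals_Archimedean2 by blast
      ultimately show "i = j" using elim by blast
    qed
  qed
qed

end

section \<open>Dyadic cells and the multivariate Campbell formula\<close>

lemma nn_integral_count_space_PiE_prod:
  fixes f :: "nat \<Rightarrow> nat \<Rightarrow> ennreal"
  shows "(\<integral>\<^sup>+\<iota>. (\<Prod>j<m. f j (\<iota> j)) \<partial>count_space ({..<m} \<rightarrow>\<^sub>E UNIV)) = (\<Prod>j<m. \<Sum>i. f j i)"
proof -
  interpret product_sigma_finite "\<lambda>_::nat. count_space (UNIV :: nat set)"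
    by (intro product_sigma_finite.intro sigma_finite_measure_count_space_countable) auto
  have "(\<integral>\<^sup>+\<iota>. (\<Prod>j<m. f j (\<iota> j)) \<partial>Pi\<^sub>M {..<m} (\<lambda>_::nat. count_space UNIV))
      = (\<Prod>j<m. \<integral>\<^sup>+i. f j i \<partial>count_space UNIV)"
    by (intro product_nn_integral_prod) auto
  then show ?thesis
    by (simp add: count_space_PiM_finite nn_integral_count_space_nat)
qed

lemma countable_inj_PiE: "countable {c \<in> {..<m::nat} \<rightarrow>\<^sub>E (UNIV :: 'i::countable set). inj_on c {..<m}}"
proof -
  have "countable ({..<m} \<rightarrow>\<^sub>E (UNIV :: 'i set))" by (rule countable_PiE) auto
  then show ?thesis by (rule countable_subset[rotated]) auto
qed

context marked_poisson
begin

text \<open>Dyadic partitions are nested (\<open>cell_Suc\<close>): points separated once remain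
  separated, which gives monotone convergence in \<open>n\<close>.\<close>

definition cell :: "nat \<Rightarrow> real \<times> 'c \<Rightarrow> int" where
  "cell n x = \<lfloor>2 ^ n * fst x\<rfloor>"

lemma cell_measurable[measurable]: "cell n \<in> \<mu> \<rightarrow>\<^sub>M count_space UNIV"
  unfolding cell_def[abs_def] by measurable

lemma cell_Suc: "cell (Suc n) x = cell (Suc n) y \<Longrightarrow> cell n x = cell n y"
proof -
  have "cell n z = cell (Suc n) z div 2" for z
    using floor_divide_real_eq_div[of 2 "2 ^ Suc n * fst z"] by (simp add: cell_def)
  then show "cell (Suc n) x = cell (Suc n) y \<Longrightarrow> cell n x = cell n y" by simp
qed

lemma cell_mono:
  assumes "cell k x = cell k y" "n \<le> k"
  shows "cell n x = cell n y"
  using assms(2,1) by (induction k rule: dec_induct) (auto dest: cell_Suc)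

lemma measurable_component_mu:
  assumes "g \<in> \<mu> \<rightarrow>\<^sub>M N" "i \<in> I"
  shows "(\<lambda>x. g (x i)) \<in> Pi\<^sub>M I (\<lambda>_. \<mu>) \<rightarrow>\<^sub>M N"
  using measurable_compose[OF measurable_component_singleton[OF assms(2), of "\<lambda>_. \<mu>"] assms(1)] .

lemma cell_eq_imp_fst_eq:
  assumes "\<And>n. cell n x = cell n y"
  shows "fst x = fst y"
proof (rule ccontr)
  assume "fst x \<noteq> fst y"
  then have "\<bar>fst x - fst y\<bar> > 0" by simp
  then obtain n where n: "1 / 2 ^ n < \<bar>fst x - fst y\<bar>"
    using real_arch_pow_inv[of "\<bar>fst x - fst y\<bar>" "1/2"] by (auto simp: power_one_over)
  have "\<bar>2 ^ n * fst x - 2 ^ n * fst y\<bar> < 1"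
    using assms[of n] unfolding cell_def by linarith
  then have "2 ^ n * \<bar>fst x - fst y\<bar> < 1" by (simp add: right_diff_distrib[symmetric] abs_mult)
  then show False using n by (simp add: field_simps)
qed

text \<open>
  The Campbell formula for pairwise distinct points is obtained by discretizing the first coordinate: for
  distinct cells the counts are independent, and as almost surely all first coordinates differ, every tuple
  of distinct points lies in distinct cells once these are small enough.
\<close>

definition in_cells :: "nat \<Rightarrow> nat \<Rightarrow> (nat \<Rightarrow> (real \<times> 'c) set) \<Rightarrow> (nat \<Rightarrow> real \<times> 'c) \<Rightarrow> ennreal" where
  "in_cells m n A x = (\<Prod>j<m. indicator (A j) (x j)) * of_bool (inj_on (\<lambda>j. cell n (x j)) {..<m})"

text \<open>Only one assignment \<open>c\<close>, that of the actual cells, can contribute. The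
  joint condition of distinct cells thus becomes a countable sum of products over fixed disjoint
  sets, where independence of the counts applies.\<close>

lemma in_cells_eq:
  "in_cells m n A x = (\<integral>\<^sup>+c. (\<Prod>j<m. indicator (A j \<inter> cell n -` {c j}) (x j))
     \<partial>count_space {c \<in> {..<m} \<rightarrow>\<^sub>E UNIV. inj_on c {..<m}})"
    (is "_ = (\<integral>\<^sup>+c. ?f c \<partial>count_space ?C)")
proof -
  define c0 where "c0 = (\<lambda>j\<in>{..<m}. cell n (x j))"
  have *: "?f c = (if c = c0 then \<Prod>j<m. indicator (A j) (x j) else 0)" if "c \<in> ?C" for c
  proof (cases "c = c0")
    case True
    have "?f c = (\<Prod>j<m. indicator (A j) (x j))"
      unfolding True by (rule prod.cong) (auto simp: c0_def indicator_def)
    with True show ?thesis by simp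
  next
    case False
    have "c = c0" if "\<forall>j<m. c j = cell n (x j)"
      by (rule PiE_ext[of _ "{..<m}" "\<lambda>_. UNIV"]) (use that \<open>c \<in> ?C\<close> in \<open>auto simp: c0_def\<close>)
    with False obtain j where "j < m" "c j \<noteq> cell n (x j)" by auto
    then have "?f c = 0" by (intro prod_zero) (auto intro!: bexI[of _ j])
    with False show ?thesis by simp
  qed
  have inj: "inj_on c0 {..<m} \<longleftrightarrow> inj_on (\<lambda>j. cell n (x j)) {..<m}"
    unfolding c0_def by (rule inj_on_cong) simp
  have "(\<integral>\<^sup>+c. ?f c \<partial>count_space ?C)
      = (\<integral>\<^sup>+c. (\<Prod>j<m. indicator (A j) (x j)) * indicator {c0} c \<partial>count_space ?C)"
    using * by (intro nn_integral_cong) (auto simp: indicator_def)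
  also have "\<dots> = (\<Prod>j<m. indicator (A j) (x j)) * emeasure (count_space ?C) ({c0} \<inter> ?C)"
    by (subst nn_integral_cmult_indicator[symmetric]) (auto intro!: nn_integral_cong simp: indicator_def)
  also have "emeasure (count_space ?C) ({c0} \<inter> ?C) = of_bool (inj_on (\<lambda>j. cell n (x j)) {..<m})"
  proof (cases "inj_on c0 {..<m}")
    case True
    then have "c0 \<in> ?C" by (auto simp: c0_def)
    then have "{c0} \<inter> ?C = {c0}" by auto
    with True \<open>c0 \<in> ?C\<close> inj show ?thesis by simp
  next
    case False
    then have "{c0} \<inter> ?C = {}" by auto
    with False inj show ?thesis by simp
  qed
  finally show ?thesis by (simp add: in_cells_def)
qed

lemma in_cells_measurable[measurable]:
  assumes A: "\<And>j. j < m \<Longrightarrow> A j \<in> sets \<mu>"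
  shows "in_cells m n A \<in> borel_measurable (Pi\<^sub>M {..<m} (\<lambda>_. \<mu>))"
proof -
  have 1: "(\<lambda>x. indicator (A j) (x j) :: ennreal) \<in> borel_measurable (Pi\<^sub>M {..<m} (\<lambda>_. \<mu>))" if "j < m" for j
    using that A by (intro measurable_component_mu borel_measurable_indicator) auto
  have 2: "(\<lambda>x. cell n (x j)) \<in> Pi\<^sub>M {..<m} (\<lambda>_. \<mu>) \<rightarrow>\<^sub>M count_space UNIV" if "j < m" for j
    using that by (intro measurable_component_mu[OF cell_measurable]) auto
  have 3: "Measurable.pred (Pi\<^sub>M {..<m} (\<lambda>_. \<mu>)) (\<lambda>x. inj_on (\<lambda>j. cell n (x j)) {..<m})"
    unfolding inj_on_def
  proof (intro pred_intros_finite pred_intros_logic)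
    fix i j assume "i \<in> {..<m}" "j \<in> {..<m}"
    then have [measurable]: "(\<lambda>x. cell n (x i)) \<in> Pi\<^sub>M {..<m} (\<lambda>_. \<mu>) \<rightarrow>\<^sub>M count_space UNIV"
      "(\<lambda>x. cell n (x j)) \<in> Pi\<^sub>M {..<m} (\<lambda>_. \<mu>) \<rightarrow>\<^sub>M count_space UNIV" by (auto intro: 2)
    show "Measurable.pred (Pi\<^sub>M {..<m} (\<lambda>_. \<mu>)) (\<lambda>x. cell n (x i) = cell n (x j))" by measurable
  qed auto
  show ?thesis
    unfolding in_cells_def[abs_def] of_bool_def using 1 3
    by (intro borel_measurable_times_ennreal borel_measurable_prod_ennreal measurable_If) auto
qed

text \<open>The right-hand side recurs in \<open>nn_integral_pick_in_cells\<close>; together the two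
  are the Campbell formula for boxes at a fixed level.\<close>

lemma nn_integral_in_cells:
  assumes A: "\<And>j. j < m \<Longrightarrow> A j \<in> sets \<mu>"
  shows "(\<integral>\<^sup>+x. in_cells m n A x \<partial>Pi\<^sub>M {..<m} (\<lambda>_. \<mu>)) =
    (\<integral>\<^sup>+c. (\<Prod>j<m. emeasure \<mu> (A j \<inter> (cell n -` {c j} \<inter> space \<mu>)))
     \<partial>count_space {c \<in> {..<m} \<rightarrow>\<^sub>E UNIV. inj_on c {..<m}})" (is "_ = (\<integral>\<^sup>+c. _ \<partial>count_space ?C)")
proof -
  have C: "countable ?C" by (rule countable_inj_PiE)
  have sets: "cell n -` {c} \<inter> space \<mu> \<in> sets \<mu>" for c by measurable
  have eq: "A j \<inter> cell n -` {c} = A j \<inter> (cell n -` {c} \<inter> space \<mu>)" if "j < m" for j c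
    using sets.sets_into_space[OF A[OF that]] by auto
  have B: "A j \<inter> cell n -` {c} \<in> sets \<mu>" if "j < m" for j c
    using that A sets by (simp add: eq)
  have "(\<integral>\<^sup>+x. in_cells m n A x \<partial>Pi\<^sub>M {..<m} (\<lambda>_. \<mu>))
      = (\<integral>\<^sup>+c. (\<integral>\<^sup>+x. (\<Prod>j<m. indicator (A j \<inter> cell n -` {c j}) (x j)) \<partial>Pi\<^sub>M {..<m} (\<lambda>_. \<mu>)) \<partial>count_space ?C)"
    unfolding in_cells_eq
  proof (rule nn_integral_count_space_nn_integral[OF C])
    fix c
    show "(\<lambda>x. \<Prod>j<m. indicator (A j \<inter> cell n -` {c j}) (x j) :: ennreal) \<in> borel_measurable (Pi\<^sub>M {..<m} (\<lambda>_. \<mu>))"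
      using B by (intro borel_measurable_prod_ennreal measurable_component_mu borel_measurable_indicator) auto
  qed
  also have "\<dots> = (\<integral>\<^sup>+c. (\<Prod>j<m. emeasure \<mu> (A j \<inter> cell n -` {c j})) \<partial>count_space ?C)"
    using B by (subst prod.product_nn_integral_prod) (auto intro!: nn_integral_cong prod.cong)
  also have "\<dots> = (\<integral>\<^sup>+c. (\<Prod>j<m. emeasure \<mu> (A j \<inter> (cell n -` {c j} \<inter> space \<mu>))) \<partial>count_space ?C)"
    by (intro nn_integral_cong prod.cong) (auto simp: eq)
  finally show ?thesis .
qed

definition inj_idx :: "nat \<Rightarrow> (nat \<Rightarrow> nat) set" where
  "inj_idx m = {\<iota> \<in> {..<m} \<rightarrow>\<^sub>E UNIV. inj_on \<iota> {..<m}}"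

lemma countable_inj_idx: "countable (inj_idx m)"
  unfolding inj_idx_def by (rule countable_inj_PiE)

definition pick :: "nat \<Rightarrow> (nat \<Rightarrow> nat) \<Rightarrow> 'w \<Rightarrow> nat \<Rightarrow> real \<times> 'c" where
  "pick m \<iota> \<omega> = (\<lambda>j\<in>{..<m}. X (\<iota> j) \<omega>)"

lemma pick_measurable[measurable]: "pick m \<iota> \<in> M \<rightarrow>\<^sub>M Pi\<^sub>M {..<m} (\<lambda>_. \<mu>)"
  unfolding pick_def[abs_def] by measurable

text \<open>A tuple with a repeated index has two entries in one cell and contributes 0, so the sum
  may be extended to all index tuples, where it factorizes into a product of counts. For injective
  \<open>c\<close> these counts belong to disjoint sets, so they are independent and the mean of the
  product is the product of the intensities.\<close>

lemma nn_integral_pick_in_cells: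
  assumes A: "\<And>j. j < m \<Longrightarrow> A j \<in> sets \<mu>"
  shows "(\<integral>\<^sup>+\<iota>. (\<integral>\<^sup>+\<omega>. in_cells m n A (pick m \<iota> \<omega>) \<partial>M) \<partial>count_space (inj_idx m)) =
    (\<integral>\<^sup>+c. (\<Prod>j<m. emeasure \<mu> (A j \<inter> (cell n -` {c j} \<inter> space \<mu>)))
     \<partial>count_space {c \<in> {..<m} \<rightarrow>\<^sub>E UNIV. inj_on c {..<m}})" (is "_ = (\<integral>\<^sup>+c. _ \<partial>count_space ?C)")
proof -
  let ?D = "{..<m} \<rightarrow>\<^sub>E (UNIV :: nat set)"
  let ?B = "\<lambda>c j. A j \<inter> (cell n -` {c j} \<inter> space \<mu>)"
  have C: "countable ?C" by (rule countable_inj_PiE)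
  have D: "countable ?D" by (rule countable_PiE) auto
  have B: "?B c j \<in> sets \<mu>" if "j < m" for j and c :: "nat \<Rightarrow> int"
    using A[OF that] by measurable
  have pick_in: "in_cells m n A (pick m \<iota> \<omega>) = (\<integral>\<^sup>+c. (\<Prod>j<m. indicator (?B c j) (X (\<iota> j) \<omega>)) \<partial>count_space ?C)"
    if "\<omega> \<in> space M" for \<iota> \<omega>
    unfolding in_cells_eq
    by (intro nn_integral_cong prod.cong)
      (use measurable_space[OF X_measurable that] in \<open>auto simp: pick_def indicator_def\<close>)
  have zero: "in_cells m n A (pick m \<iota> \<omega>) = 0" if "\<iota> \<in> ?D" "\<iota> \<notin> inj_idx m" for \<iota> \<omega>
  proof -
    from that obtain i j where "i < m" "j < m" "i \<noteq> j" "\<iota> i = \<iota> j" by (auto simp: inj_idx_def inj_on_def)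
    then have "\<not> inj_on (\<lambda>j. cell n (pick m \<iota> \<omega> j)) {..<m}"
      using inj_onD[of "\<lambda>j. cell n (pick m \<iota> \<omega> j)" "{..<m}" i j] by (auto simp: pick_def)
    then show ?thesis by (simp add: in_cells_def)
  qed
  note in_cells_measurable[OF A, measurable]
  have "(\<integral>\<^sup>+\<iota>. (\<integral>\<^sup>+\<omega>. in_cells m n A (pick m \<iota> \<omega>) \<partial>M) \<partial>count_space (inj_idx m))
      = (\<integral>\<^sup>+\<iota>. (\<integral>\<^sup>+\<omega>. in_cells m n A (pick m \<iota> \<omega>) \<partial>M) * indicator (inj_idx m) \<iota> \<partial>count_space UNIV)"
    by (rule nn_integral_count_space_indicator) simp
  also have "\<dots> = (\<integral>\<^sup>+\<iota>. (\<integral>\<^sup>+\<omega>. in_cells m n A (pick m \<iota> \<omega>) \<partial>M) * indicator ?D \<iota> \<partial>count_space UNIV)"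
  proof (rule nn_integral_cong)
    fix \<iota> :: "nat \<Rightarrow> nat"
    have "inj_idx m \<subseteq> ?D" by (auto simp: inj_idx_def)
    then show "(\<integral>\<^sup>+\<omega>. in_cells m n A (pick m \<iota> \<omega>) \<partial>M) * indicator (inj_idx m) \<iota> =
      (\<integral>\<^sup>+\<omega>. in_cells m n A (pick m \<iota> \<omega>) \<partial>M) * indicator ?D \<iota>"
      by (cases "\<iota> \<in> ?D"; cases "\<iota> \<in> inj_idx m") (auto simp: zero)
  qed
  also have "\<dots> = (\<integral>\<^sup>+\<iota>. (\<integral>\<^sup>+\<omega>. in_cells m n A (pick m \<iota> \<omega>) \<partial>M) \<partial>count_space ?D)"
    by (rule nn_integral_count_space_indicator[symmetric]) simp
  also have "\<dots> = (\<integral>\<^sup>+\<omega>. (\<integral>\<^sup>+\<iota>. in_cells m n A (pick m \<iota> \<omega>) \<partial>count_space ?D) \<partial>M)"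
    using D by (intro nn_integral_count_space_nn_integral[symmetric]) measurable
  also have "\<dots> = (\<integral>\<^sup>+\<omega>. (\<integral>\<^sup>+\<iota>. (\<integral>\<^sup>+c. (\<Prod>j<m. indicator (?B c j) (X (\<iota> j) \<omega>)) \<partial>count_space ?C) \<partial>count_space ?D) \<partial>M)"
    by (intro nn_integral_cong pick_in) auto
  also have "\<dots> = (\<integral>\<^sup>+\<omega>. (\<integral>\<^sup>+c. (\<integral>\<^sup>+\<iota>. (\<Prod>j<m. indicator (?B c j) (X (\<iota> j) \<omega>)) \<partial>count_space ?D) \<partial>count_space ?C) \<partial>M)"
    using C by (intro nn_integral_cong nn_integral_count_space_nn_integral) auto
  also have "\<dots> = (\<integral>\<^sup>+\<omega>. (\<integral>\<^sup>+c. (\<Prod>j<m. point_count X (?B c j) \<omega>) \<partial>count_space ?C) \<partial>M)"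
  proof (intro nn_integral_cong)
    fix \<omega> and c :: "nat \<Rightarrow> int"
    show "(\<integral>\<^sup>+\<iota>. (\<Prod>j<m. indicator (?B c j) (X (\<iota> j) \<omega>)) \<partial>count_space ?D) = (\<Prod>j<m. point_count X (?B c j) \<omega>)"
      using nn_integral_count_space_PiE_prod[of m "\<lambda>j i. indicator (?B c j) (X i \<omega>)"]
      by (simp only: point_count_def)
  qed
  also have "\<dots> = (\<integral>\<^sup>+c. (\<integral>\<^sup>+\<omega>. (\<Prod>j<m. point_count X (?B c j) \<omega>) \<partial>M) \<partial>count_space ?C)"
    using C B by (intro nn_integral_count_space_nn_integral borel_measurable_prod_ennreal point_count_measurable) auto
  also have "\<dots> = (\<integral>\<^sup>+c. (\<Prod>j<m. emeasure \<mu> (?B c j)) \<partial>count_space ?C)"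
  proof (rule nn_integral_cong)
    fix c assume "c \<in> space (count_space ?C)"
    then have c: "inj_on c {..<m}" by simp
    have disj: "disjoint_family_on (?B c) {..<m}"
      using c by (auto simp: disjoint_family_on_def inj_on_def)
    have "indep_vars (\<lambda>_. borel) (\<lambda>j. point_count X (?B c j)) {..<m}"
      using poisson B disj by (simp add: poisson_process_def \<mu>_def)
    then have "(\<integral>\<^sup>+\<omega>. (\<Prod>j<m. point_count X (?B c j) \<omega>) \<partial>M) = (\<Prod>j<m. \<integral>\<^sup>+\<omega>. point_count X (?B c j) \<omega> \<partial>M)"
      by (intro indep_vars_nn_integral) auto
    then show "(\<integral>\<^sup>+\<omega>. (\<Prod>j<m. point_count X (?B c j) \<omega>) \<partial>M) = (\<Prod>j<m. emeasure \<mu> (?B c j))"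
      using B by (simp add: nn_integral_point_count)
  qed
  finally show ?thesis .
qed

text \<open>Finitely many distinct real numbers lie in distinct dyadic cells from some level
  on.\<close>

lemma SUP_in_cells:
  "(SUP n. in_cells m n A x) = (\<Prod>j<m. indicator (A j) (x j)) * of_bool (inj_on (\<lambda>j. fst (x j)) {..<m})"
  and incseq_in_cells: "incseq (\<lambda>n. in_cells m n A x)"
proof -
  let ?p = "\<lambda>n. inj_on (\<lambda>j. cell n (x j)) {..<m}"
  have step: "?p n \<Longrightarrow> ?p (Suc n)" for n
    by (auto simp: inj_on_def dest: cell_Suc)
  have le: "(of_bool (?p n) :: ennreal) \<le> of_bool (?p (Suc n))" for n using step by auto
  then show inc: "incseq (\<lambda>n. in_cells m n A x)"
    unfolding in_cells_def by (intro incseq_SucI mult_left_mono) auto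
  have "\<exists>n. ?p n" if "inj_on (\<lambda>j. fst (x j)) {..<m}"
  proof -
    have "\<exists>n. i \<noteq> j \<longrightarrow> cell n (x i) \<noteq> cell n (x j)" if "i < m" "j < m" for i j
      using cell_eq_imp_fst_eq[of "x i" "x j"] \<open>inj_on _ _\<close> that by (auto simp: inj_on_def)
    then obtain n where n: "\<And>i j. i < m \<Longrightarrow> j < m \<Longrightarrow> i \<noteq> j \<Longrightarrow> cell (n i j) (x i) \<noteq> cell (n i j) (x j)" by metis
    \<comment> \<open>The largest of the separating levels of all pairs; the inserted 0 keeps
      \<open>Max\<close> meaningful when \<open>m = 0\<close>.\<close>
    define k where "k = Max (insert 0 ((\<lambda>(i, j). n i j) ` ({..<m} \<times> {..<m})))"
    have nk: "n i j \<le> k" if "i < m" "j < m" for i j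
      unfolding k_def using that by (intro Max_ge) auto
    have "?p k"
    proof (rule inj_onI, rule ccontr)
      fix i j assume ij: "i \<in> {..<m}" "j \<in> {..<m}" and "cell k (x i) = cell k (x j)" "i \<noteq> j"
      then have "cell (n i j) (x i) = cell (n i j) (x j)" using nk by (auto intro: cell_mono)
      then show False using n ij \<open>i \<noteq> j\<close> by auto
    qed
    then show ?thesis ..
  qed
  moreover have "inj_on (\<lambda>j. fst (x j)) {..<m}" if "?p n" for n
    using that by (auto simp: inj_on_def cell_def)
  ultimately have ex: "(\<exists>n. ?p n) \<longleftrightarrow> inj_on (\<lambda>j. fst (x j)) {..<m}" by blast
  have "(SUP n. in_cells m n A x) = (\<Prod>j<m. indicator (A j) (x j)) * (SUP n. of_bool (?p n))"
    unfolding in_cells_def by (rule SUP_mult_left_ennreal[symmetric])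
  also have "(SUP n. of_bool (?p n)) = (of_bool (\<exists>n. ?p n) :: ennreal)"
  proof (cases "\<exists>n. ?p n")
    case True
    then obtain n where "?p n" ..
    then have "(SUP n. of_bool (?p n)) = (1::ennreal)"
      by (intro antisym SUP_least SUP_upper2[of n]) auto
    with True show ?thesis by simp
  next
    case False
    then have "\<And>n. of_bool (?p n) = (0::ennreal)" by simp
    then show ?thesis using False by simp
  qed
  finally show "(SUP n. in_cells m n A x) = (\<Prod>j<m. indicator (A j) (x j)) * of_bool (inj_on (\<lambda>j. fst (x j)) {..<m})"
    by (simp add: ex)
qed

lemma emeasure_mu_fst_eq: "emeasure \<mu> {y \<in> space \<mu>. fst y = p} = 0"
proof -
  have "{y \<in> space \<mu>. fst y = p} = {p} \<times> space Q" by (auto simp: space_mu)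
  then show ?thesis by (simp add: emeasure_mu_strip)
qed

text \<open>With the other coordinates fixed, a coincidence confines one coordinate to a strip over
  a single point, which is null. Together with \<open>AE_fst_distinct\<close>, neither side of the
  Campbell formula charges coinciding first coordinates.\<close>

lemma AE_PiM_fst_distinct: "AE x in Pi\<^sub>M {..<m::nat} (\<lambda>_. \<mu>). inj_on (\<lambda>j. fst (x j)) {..<m}"
proof -
  have comp[measurable]: "(\<lambda>x. fst (x j)) \<in> borel_measurable (Pi\<^sub>M I (\<lambda>_. \<mu>))" if "j \<in> I" for j :: nat and I
    by (rule measurable_component_mu[OF fst_measurable_mu that])
  have "AE x in Pi\<^sub>M {..<m} (\<lambda>_. \<mu>). fst (x i) \<noteq> fst (x j)" if ij: "i < m" "j < m" "i \<noteq> j" for i j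
  proof -
    define I where "I = {..<m} - {i}"
    have I: "insert i I = {..<m}" "finite I" "i \<notin> I" "j \<in> I" using ij by (auto simp: I_def)
    have ij': "i \<in> insert i I" "j \<in> insert i I" using I by auto
    let ?g = "\<lambda>x. indicator {0} (fst (x i) - fst (x j)) :: ennreal"
    have m: "?g \<in> borel_measurable (Pi\<^sub>M (insert i I) (\<lambda>_. \<mu>))"
      by (intro measurable_compose[OF borel_measurable_diff[OF comp[OF ij'(1)] comp[OF ij'(2)]]]
        borel_measurable_indicator) simp
    have "(\<integral>\<^sup>+x. ?g x \<partial>Pi\<^sub>M (insert i I) (\<lambda>_. \<mu>))
       = (\<integral>\<^sup>+x. (\<integral>\<^sup>+y. ?g (x(i := y)) \<partial>\<mu>) \<partial>Pi\<^sub>M I (\<lambda>_. \<mu>))"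
      by (rule prod.product_nn_integral_insert[OF I(2,3) m])
    also have "\<dots> = (\<integral>\<^sup>+x. emeasure \<mu> {y \<in> space \<mu>. fst y = fst (x j)} \<partial>Pi\<^sub>M I (\<lambda>_. \<mu>))"
    proof (rule nn_integral_cong)
      fix x :: "nat \<Rightarrow> real \<times> 'c"
      have "(\<integral>\<^sup>+y. ?g (x(i := y)) \<partial>\<mu>) = (\<integral>\<^sup>+y. indicator {y \<in> space \<mu>. fst y = fst (x j)} y \<partial>\<mu>)"
        using ij by (intro nn_integral_cong) (auto simp: indicator_def)
      then show "(\<integral>\<^sup>+y. ?g (x(i := y)) \<partial>\<mu>) = emeasure \<mu> {y \<in> space \<mu>. fst y = fst (x j)}" by simp
    qed
    also have "\<dots> = 0" by (simp add: emeasure_mu_fst_eq)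
    finally have "AE x in Pi\<^sub>M (insert i I) (\<lambda>_. \<mu>). ?g x = 0"
      using m by (subst (asm) nn_integral_0_iff_AE) auto
    then show ?thesis unfolding I(1) by eventually_elim (simp add: indicator_def split: if_splits)
  qed
  then have "AE x in Pi\<^sub>M {..<m} (\<lambda>_. \<mu>). i < m \<longrightarrow> j < m \<longrightarrow> i \<noteq> j \<longrightarrow> fst (x i) \<noteq> fst (x j)" for i j
    by (cases "i < m \<and> j < m \<and> i \<noteq> j") auto
  then have "AE x in Pi\<^sub>M {..<m} (\<lambda>_. \<mu>). \<forall>i j. i < m \<longrightarrow> j < m \<longrightarrow> i \<noteq> j \<longrightarrow> fst (x i) \<noteq> fst (x j)"
    by (simp add: AE_all_countable)
  then show ?thesis by eventually_elim (auto simp: inj_on_def)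
qed

text \<open>Both sides are integrals with respect to measures on \<open>m\<close>-tuples, and the
  product measure is determined by its values on boxes. On a box both measures are monotone limits
  of the integrals of \<open>in_cells\<close>, which agree at each level; the tuples lost in the
  limit are null for both.\<close>

theorem campbell_inj:
  assumes F: "F \<in> borel_measurable (Pi\<^sub>M {..<m} (\<lambda>_. \<mu>))"
  shows "(\<integral>\<^sup>+\<iota>. (\<integral>\<^sup>+\<omega>. F (pick m \<iota> \<omega>) \<partial>M) \<partial>count_space (inj_idx m)) = (\<integral>\<^sup>+x. F x \<partial>Pi\<^sub>M {..<m} (\<lambda>_. \<mu>))"
proof -
  let ?P = "Pi\<^sub>M {..<m} (\<lambda>_. \<mu>)" and ?C = "count_space (inj_idx m)"
  interpret C: sigma_finite_measure ?C by (rule sigma_finite_measure_count_space_countable[OF countable_inj_idx])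
  define \<nu> where "\<nu> = distr (?C \<Otimes>\<^sub>M M) ?P (\<lambda>(\<iota>, \<omega>). pick m \<iota> \<omega>)"
  have pm: "(\<lambda>(\<iota>, \<omega>). pick m \<iota> \<omega>) \<in> ?C \<Otimes>\<^sub>M M \<rightarrow>\<^sub>M ?P"
    by (intro measurable_pair_measure_countable1 countable_inj_idx) simp
  have nu: "(\<integral>\<^sup>+x. f x \<partial>\<nu>) = (\<integral>\<^sup>+\<iota>. (\<integral>\<^sup>+\<omega>. f (pick m \<iota> \<omega>) \<partial>M) \<partial>?C)"
    if f: "f \<in> borel_measurable ?P" for f
  proof -
    have "(\<integral>\<^sup>+x. f x \<partial>\<nu>) = (\<integral>\<^sup>+z. f ((\<lambda>(\<iota>, \<omega>). pick m \<iota> \<omega>) z) \<partial>(?C \<Otimes>\<^sub>M M))"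
      unfolding \<nu>_def using f by (subst nn_integral_distr[OF pm]) simp_all
    also have "\<dots> = (\<integral>\<^sup>+\<iota>. (\<integral>\<^sup>+\<omega>. f ((\<lambda>(\<iota>, \<omega>). pick m \<iota> \<omega>) (\<iota>, \<omega>)) \<partial>M) \<partial>?C)"
      by (rule nn_integral_fst[symmetric]) (rule measurable_compose[OF pm f])
    finally show ?thesis by simp
  qed
  have sets_nu: "sets \<nu> = sets ?P" by (simp add: \<nu>_def)
  have "\<nu> = ?P"
  proof (rule prod.PiM_eqI)
    fix A :: "nat \<Rightarrow> (real \<times> 'c) set" assume "\<And>i. i \<in> {..<m} \<Longrightarrow> A i \<in> sets \<mu>"
    then have A: "\<And>i. i < m \<Longrightarrow> A i \<in> sets \<mu>" by simp
    let ?f = "\<lambda>x. (\<Prod>j<m. indicator (A j) (x j)) :: ennreal"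
    have box: "Pi\<^sub>E {..<m} A \<in> sets ?P" using A by (intro sets_PiM_I_finite) auto
    have ind: "indicator (Pi\<^sub>E {..<m} A) x = ?f x" if x: "x \<in> space ?P" for x
    proof (cases "x \<in> Pi\<^sub>E {..<m} A")
      case False
      then obtain j where "j < m" "x j \<notin> A j" using x by (auto simp: space_PiM PiE_def)
      then have "?f x = 0" by (intro prod_zero) (auto intro!: bexI[of _ j])
      then show ?thesis using False by simp
    next
      case True
      then have "?f x = 1" by (intro prod.neutral) (auto simp: indicator_def)
      then show ?thesis using True by simp
    qed
    note m = in_cells_measurable[of m A, OF A]
    have level: "(\<integral>\<^sup>+x. in_cells m n A x \<partial>\<nu>) = (\<integral>\<^sup>+x. in_cells m n A x \<partial>?P)" for n
    proof -
      have "(\<integral>\<^sup>+x. in_cells m n A x \<partial>\<nu>) = (\<integral>\<^sup>+\<iota>. (\<integral>\<^sup>+\<omega>. in_cells m n A (pick m \<iota> \<omega>) \<partial>M) \<partial>?C)"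
        by (rule nu) (rule m)
      also note nn_integral_pick_in_cells[OF A]
      also note nn_integral_in_cells[OF A, symmetric]
      finally show ?thesis .
    qed
    have sup: "(\<integral>\<^sup>+x. ?f x * of_bool (inj_on (\<lambda>j. fst (x j)) {..<m}) \<partial>N) = (SUP n. (\<integral>\<^sup>+x. in_cells m n A x \<partial>N))"
      if N: "sets N = sets ?P" for N
      unfolding SUP_in_cells[symmetric]
    proof (rule nn_integral_monotone_convergence_SUP)
      show "incseq (\<lambda>n. in_cells m n A)" using incseq_in_cells by (auto simp: incseq_def le_fun_def)
      show "in_cells m n A \<in> borel_measurable N" for n
        using m[of n] by (simp only: measurable_cong_sets[OF N refl])
    qed
    have "emeasure \<nu> (Pi\<^sub>E {..<m} A) = (\<integral>\<^sup>+x. indicator (Pi\<^sub>E {..<m} A) x \<partial>\<nu>)"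
      using box by (simp add: sets_nu)
    also have "\<dots> = (\<integral>\<^sup>+x. ?f x \<partial>\<nu>)"
      by (intro nn_integral_cong ind) (simp add: sets_eq_imp_space_eq[OF sets_nu])
    also have "\<dots> = (\<integral>\<^sup>+x. ?f x * of_bool (inj_on (\<lambda>j. fst (x j)) {..<m}) \<partial>\<nu>)"
    proof -
      have fm: "?f \<in> borel_measurable ?P"
        using A by (intro borel_measurable_prod_ennreal measurable_component_mu borel_measurable_indicator) auto
      have fm': "(\<lambda>x. ?f x * of_bool (inj_on (\<lambda>j. fst (x j)) {..<m})) \<in> borel_measurable ?P"
        unfolding SUP_in_cells[symmetric] using m by (intro borel_measurable_SUP) auto
      show ?thesis unfolding nu[OF fm] nu[OF fm']
      proof (rule nn_integral_cong, rule nn_integral_cong_AE)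
        fix \<iota> assume "\<iota> \<in> space ?C"
        then have "inj_on \<iota> {..<m}" by (simp add: inj_idx_def)
        then have inj: "inj_on (\<lambda>j. fst (pick m \<iota> \<omega> j)) {..<m}" if "inj (\<lambda>i. fst (X i \<omega>))" for \<omega>
          using that by (auto simp: inj_on_def pick_def)
        show "AE \<omega> in M. ?f (pick m \<iota> \<omega>) = ?f (pick m \<iota> \<omega>) * of_bool (inj_on (\<lambda>j. fst (pick m \<iota> \<omega> j)) {..<m})"
          using AE_fst_distinct by eventually_elim (simp add: inj)
      qed
    qed
    also have "\<dots> = (SUP n. (\<integral>\<^sup>+x. in_cells m n A x \<partial>?P))"
      using sup[OF sets_nu] by (simp add: level)
    also have "\<dots> = (\<integral>\<^sup>+x. ?f x * of_bool (inj_on (\<lambda>j. fst (x j)) {..<m}) \<partial>?P)"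
      using sup[of ?P] by simp
    also have "\<dots> = (\<integral>\<^sup>+x. ?f x \<partial>?P)"
    proof (rule nn_integral_cong_AE)
      show "AE x in ?P. ?f x * of_bool (inj_on (\<lambda>j. fst (x j)) {..<m}) = ?f x"
        using AE_PiM_fst_distinct by eventually_elim simp
    qed
    also have "\<dots> = (\<Prod>j<m. emeasure \<mu> (A j))"
      using A by (subst prod.product_nn_integral_prod) auto
    finally show "emeasure \<nu> (Pi\<^sub>E {..<m} A) = (\<Prod>i<m. emeasure \<mu> (A i))" .
  qed (simp_all add: sets_nu)
  then show ?thesis using nu[OF F] by simp
qed

end

section \<open>U-statistics of a Poisson process\<close>

lemma nn_integral_count_space_Times:
  assumes A: "countable A" and B: "countable B"
  shows "(\<integral>\<^sup>+x. (\<integral>\<^sup>+y. f x y \<partial>count_space B) \<partial>count_space A) = (\<integral>\<^sup>+z. f (fst z) (snd z) \<partial>count_space (A \<times> B))"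
proof -
  interpret B: sigma_finite_measure "count_space B" using B by (rule sigma_finite_measure_count_space_countable)
  have "(\<integral>\<^sup>+x. (\<integral>\<^sup>+y. f x y \<partial>count_space B) \<partial>count_space A)
      = (\<integral>\<^sup>+x. (\<integral>\<^sup>+y. (\<lambda>z. f (fst z) (snd z)) (x, y) \<partial>count_space B) \<partial>count_space A)" by simp
  also have "\<dots> = (\<integral>\<^sup>+z. f (fst z) (snd z) \<partial>(count_space A \<Otimes>\<^sub>M count_space B))"
    by (rule B.nn_integral_fst) (simp add: pair_measure_countable[OF A B])
  finally show ?thesis by (simp add: pair_measure_countable[OF A B])
qed

lemma nn_integral_count_space_subset:
  assumes "B \<subseteq> A"
  shows "(\<integral>\<^sup>+x. f x * indicator B x \<partial>count_space A) = (\<integral>\<^sup>+x. f x \<partial>count_space B)"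
proof -
  have "count_space B = restrict_space (count_space A) B"
    using assms by (simp add: restrict_count_space Int_absorb2)
  then show ?thesis using assms by (simp add: nn_integral_restrict_space Int_absorb2)
qed

text \<open>Double counting along the fibres of \<open>h\<close>. The fibres will be the orderings
  of index sets, so \<open>c\<close> will be a factorial or a product of two.\<close>

lemma nn_integral_count_space_fibre:
  fixes h :: "'a \<Rightarrow> 'b"
  assumes B: "countable B" and h: "\<And>x. x \<in> A \<Longrightarrow> h x \<in> B"
    and c: "\<And>y. y \<in> B \<Longrightarrow> finite {x \<in> A. h x = y} \<and> card {x \<in> A. h x = y} = c"
  shows "(\<integral>\<^sup>+x. G (h x) \<partial>count_space A) = of_nat c * (\<integral>\<^sup>+y. G y \<partial>count_space B)"
proof -
  have "(\<integral>\<^sup>+x. G (h x) \<partial>count_space A) = (\<integral>\<^sup>+x. (\<integral>\<^sup>+y. G y * indicator {h x} y \<partial>count_space B) \<partial>count_space A)"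
  proof (rule nn_integral_cong)
    fix x assume "x \<in> space (count_space A)"
    then have "{h x} \<subseteq> B" using h by auto
    from nn_integral_count_space_subset[OF this, of G]
    show "G (h x) = (\<integral>\<^sup>+y. G y * indicator {h x} y \<partial>count_space B)"
      by (simp add: nn_integral_count_space_finite)
  qed
  also have "\<dots> = (\<integral>\<^sup>+y. (\<integral>\<^sup>+x. G y * indicator {h x} y \<partial>count_space A) \<partial>count_space B)"
    using B by (intro nn_integral_count_space_nn_integral) auto
  also have "\<dots> = (\<integral>\<^sup>+y. of_nat c * G y \<partial>count_space B)"
  proof (rule nn_integral_cong)
    fix y assume "y \<in> space (count_space B)"
    then have y: "y \<in> B" by simp
    have "(\<integral>\<^sup>+x. G y * indicator {h x} y \<partial>count_space A) = (\<integral>\<^sup>+x. G y * indicator {x \<in> A. h x = y} x \<partial>count_space A)"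
      by (intro nn_integral_cong) (auto simp: indicator_def)
    also have "\<dots> = G y * emeasure (count_space A) {x \<in> A. h x = y}"
      by (subst nn_integral_cmult_indicator) auto
    also have "emeasure (count_space A) {x \<in> A. h x = y} = of_nat c"
      using c[OF y] by (subst emeasure_count_space_finite) auto
    finally show "(\<integral>\<^sup>+x. G y * indicator {h x} y \<partial>count_space A) = of_nat c * G y"
      by (simp add: mult.commute)
  qed
  finally show ?thesis by (simp add: nn_integral_cmult)
qed

section \<open>Lists of distinct indices and index sets\<close>

definition dlists :: "nat \<Rightarrow> nat list set" where
  "dlists n = {is. length is = n \<and> distinct is}"

text \<open>Sets of indices absorb the factor 1 / n! of the sum over ordered tuples, and the common
  points of two tuples become an intersection.\<close>

definition idx :: "nat \<Rightarrow> nat set set" where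
  "idx n = {S. finite S \<and> card S = n}"

lemma countable_idx: "countable (idx n)"
  using countable_Collect_finite by (rule countable_subset[rotated]) (auto simp: idx_def)

lemma nn_integral_dlists:
  "(\<integral>\<^sup>+is. G (set is) \<partial>count_space (dlists n)) = fact n * (\<integral>\<^sup>+S. G S \<partial>count_space (idx n))"
proof -
  have "(\<integral>\<^sup>+is. G (set is) \<partial>count_space (dlists n)) = of_nat (fact n) * (\<integral>\<^sup>+S. G S \<partial>count_space (idx n))"
  proof (rule nn_integral_count_space_fibre[OF countable_idx])
    fix S assume S: "S \<in> idx n"
    have "{is \<in> dlists n. set is = S} = permutations_of_set S"
      using S by (auto simp: dlists_def idx_def permutations_of_set_def distinct_card)
    then show "finite {is \<in> dlists n. set is = S} \<and> card {is \<in> dlists n. set is = S} = fact n"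
      using S by (simp add: idx_def)
  qed (auto simp: dlists_def idx_def distinct_card)
  then show ?thesis by simp
qed

text \<open>Cutting a distinct list after \<open>a\<close> entries gives two disjoint sets, and each
  disjoint pair arises from all orderings of both parts.\<close>

lemma nn_integral_dlists_disjoint:
  "(\<integral>\<^sup>+is. G (set (take a is)) (set (drop a is)) \<partial>count_space (dlists (a + b))) =
    fact a * fact b * (\<integral>\<^sup>+z. G (fst z) (snd z) \<partial>count_space {z \<in> idx a \<times> idx b. card (fst z \<inter> snd z) = 0})"
    (is "_ = _ * integral\<^sup>N (count_space ?D) _")
proof -
  have "(\<integral>\<^sup>+is. (\<lambda>z. G (fst z) (snd z)) (set (take a is), set (drop a is)) \<partial>count_space (dlists (a + b)))
      = of_nat (fact a * fact b) * (\<integral>\<^sup>+z. G (fst z) (snd z) \<partial>count_space ?D)"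
  proof (rule nn_integral_count_space_fibre)
    show "countable ?D"
      by (rule countable_subset[OF _ countable_SIGMA[OF countable_idx countable_idx]]) auto
    show "(set (take a is), set (drop a is)) \<in> ?D" if "is \<in> dlists (a + b)" for "is"
      using that set_take_disj_set_drop_if_distinct[of "is" a a] by (auto simp: dlists_def idx_def distinct_card)
  next
    fix z assume "z \<in> ?D"
    then obtain S S' where z: "z = (S, S')" "finite S" "finite S'" "card S = a" "card S' = b" "S \<inter> S' = {}"
      by (cases z) (auto simp: idx_def)
    let ?f = "\<lambda>(xs, ys). xs @ ys" and ?P = "permutations_of_set S \<times> permutations_of_set S'"
    have eq: "{is \<in> dlists (a + b). (set (take a is), set (drop a is)) = z} = ?f ` ?P"
    proof (intro equalityI subsetI)
      fix "is" assume "is \<in> {is \<in> dlists (a + b). (set (take a is), set (drop a is)) = z}"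
      then have "(take a is, drop a is) \<in> ?P" by (auto simp: z dlists_def permutations_of_set_def)
      then have "?f (take a is, drop a is) \<in> ?f ` ?P" by (rule imageI)
      then show "is \<in> ?f ` ?P" by simp
    next
      fix "is" assume "is \<in> ?f ` ?P"
      then obtain xs ys where "is = xs @ ys" "xs \<in> permutations_of_set S" "ys \<in> permutations_of_set S'" by auto
      then show "is \<in> {is \<in> dlists (a + b). (set (take a is), set (drop a is)) = z}"
        using z by (auto simp: permutations_of_set_def dlists_def distinct_card[symmetric])
    qed
    have "inj_on ?f ?P"
    proof (rule inj_onI, clarify)
      fix xs ys xs' ys' assume *: "xs \<in> permutations_of_set S" "xs' \<in> permutations_of_set S" "xs @ ys = xs' @ ys'"
      then have "length xs = length xs'" by (metis length_finite_permutations_of_set)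
      then show "xs = xs' \<and> ys = ys'" using *(3) by simp
    qed
    then show "finite {is \<in> dlists (a + b). (set (take a is), set (drop a is)) = z} \<and>
        card {is \<in> dlists (a + b). (set (take a is), set (drop a is)) = z} = fact a * fact b"
      unfolding eq using z by (simp add: card_image card_cartesian_product)
  qed
  then show ?thesis by simp
qed

text \<open>The common index is stored in the last position \<open>a + b\<close>, so that its point
  becomes the outermost variable when the product integral is split.\<close>

lemma nn_integral_dlists_common:
  "(\<integral>\<^sup>+is. G (insert (is ! (a + b)) (set (take a is))) (insert (is ! (a + b)) (set (take b (drop a is))))
      \<partial>count_space (dlists (Suc (a + b)))) =
    fact a * fact b * (\<integral>\<^sup>+z. G (fst z) (snd z) \<partial>count_space {z \<in> idx (Suc a) \<times> idx (Suc b). card (fst z \<inter> snd z) = 1})"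
    (is "_ = _ * integral\<^sup>N (count_space ?D) _")
proof -
  let ?h = "\<lambda>is. (insert (is ! (a + b)) (set (take a is)), insert (is ! (a + b)) (set (take b (drop a is))))"
  have decomp: "\<exists>xs ys i. is = xs @ ys @ [i] \<and> length xs = a \<and> length ys = b \<and> distinct (xs @ ys @ [i])"
    if "is \<in> dlists (Suc (a + b))" for "is"
  proof (intro exI conjI)
    have l: "length is = Suc (a + b)" using that by (simp add: dlists_def)
    show eq: "is = take a is @ take b (drop a is) @ [is ! (a + b)]"
      using l by (metis add.commute append_assoc lessI take_Suc_conv_app_nth take_add take_all_iff order_refl)
    show "distinct (take a is @ take b (drop a is) @ [is ! (a + b)])"
      using that unfolding eq[symmetric] by (simp add: dlists_def)
  qed (use that in \<open>auto simp: dlists_def\<close>)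
  have h: "?h (xs @ ys @ [i]) = (insert i (set xs), insert i (set ys))" if "length xs = a" "length ys = b" for xs ys i
    using that by (simp add: nth_append)
  have "(\<integral>\<^sup>+is. (\<lambda>z. G (fst z) (snd z)) (?h is) \<partial>count_space (dlists (Suc (a + b))))
      = of_nat (fact a * fact b) * (\<integral>\<^sup>+z. G (fst z) (snd z) \<partial>count_space ?D)"
  proof (rule nn_integral_count_space_fibre)
    show "countable ?D"
      by (rule countable_subset[OF _ countable_SIGMA[OF countable_idx countable_idx]]) auto
    show "?h is \<in> ?D" if isD: "is \<in> dlists (Suc (a + b))" for "is"
    proof -
      obtain xs ys i where dec: "is = xs @ ys @ [i]" "length xs = a" "length ys = b" "distinct (xs @ ys @ [i])"
        using decomp[OF isD] by blast
      then have "insert i (set xs) \<inter> insert i (set ys) = {i}" by auto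
      then show ?thesis using dec h[OF dec(2,3)] by (auto simp: idx_def distinct_card)
    qed
  next
    fix z assume "z \<in> ?D"
    then obtain S S' where z: "z = (S, S')" "finite S" "finite S'" "card S = Suc a" "card S' = Suc b" "card (S \<inter> S') = 1"
      by (cases z) (auto simp: idx_def)
    then obtain i where i: "S \<inter> S' = {i}" by (auto simp: card_1_singleton_iff)
    then have iS: "i \<in> S" "i \<in> S'" by auto
    let ?f = "\<lambda>(xs, ys). xs @ ys @ [i]" and ?P = "permutations_of_set (S - {i}) \<times> permutations_of_set (S' - {i})"
    have eq: "{is \<in> dlists (Suc (a + b)). ?h is = z} = ?f ` ?P"
    proof (intro equalityI subsetI)
      fix "is" assume *: "is \<in> {is \<in> dlists (Suc (a + b)). ?h is = z}"
      then obtain xs ys j where dec: "is = xs @ ys @ [j]" "length xs = a" "length ys = b" "distinct (xs @ ys @ [j])"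
        using decomp by blast
      then have "insert j (set xs) = S" "insert j (set ys) = S'" using * h[OF dec(2,3)] z by auto
      moreover from this have "j = i" using i by blast
      ultimately have "set xs = S - {i}" "set ys = S' - {i}" using dec(4) by auto
      then have "(xs, ys) \<in> ?P" using dec(4) by (auto simp: permutations_of_set_def)
      then have "?f (xs, ys) \<in> ?f ` ?P" by (rule imageI)
      then show "is \<in> ?f ` ?P" using dec \<open>j = i\<close> by simp
    next
      fix "is" assume "is \<in> ?f ` ?P"
      then obtain xs ys where dec: "is = xs @ ys @ [i]" "xs \<in> permutations_of_set (S - {i})" "ys \<in> permutations_of_set (S' - {i})" by auto
      then have xy: "set xs = S - {i}" "set ys = S' - {i}" "distinct xs" "distinct ys"
        by (auto simp: permutations_of_set_def)
      then have len: "length xs = a" "length ys = b"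
        using z iS distinct_card[OF xy(3)] distinct_card[OF xy(4)] by auto
      have "set xs \<inter> set ys = {}" using xy i by auto
      then have "is \<in> dlists (Suc (a + b))" using xy len dec(1) by (auto simp: dlists_def)
      moreover have "?h is = z" unfolding dec(1) h[OF len] using xy z iS by auto
      ultimately show "is \<in> {is \<in> dlists (Suc (a + b)). ?h is = z}" by simp
    qed
    have "inj_on ?f ?P"
    proof (rule inj_onI, clarify)
      fix xs ys xs' ys' assume *: "xs \<in> permutations_of_set (S - {i})" "xs' \<in> permutations_of_set (S - {i})" "xs @ ys @ [i] = xs' @ ys' @ [i]"
      then have "length xs = length xs'" by (metis length_finite_permutations_of_set)
      then show "xs = xs' \<and> ys = ys'" using *(3) by simp
    qed
    then show "finite {is \<in> dlists (Suc (a + b)). ?h is = z} \<and> card {is \<in> dlists (Suc (a + b)). ?h is = z} = fact a * fact b"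
      unfolding eq using z iS by (simp add: card_image card_cartesian_product)
  qed
  then show ?thesis by simp
qed

text \<open>The union of an admissible pair has at most \<open>2 * n - 2\<close> elements. A word of
  that length listing the union, together with two sets of positions, determines the pair; there are
  \<open>card K ^ q\<close> words and \<open>2 ^ q\<close> choices for each set of
  positions.\<close>

lemma card_overlapping_pairs_le:
  fixes K :: "'a set"
  assumes K: "finite K"
  shows "finite {(S, S'). S \<subseteq> K \<and> S' \<subseteq> K \<and> card S = n \<and> card S' = n \<and> 2 \<le> card (S \<inter> S')}" (is "finite ?A")
    and "card {(S, S'). S \<subseteq> K \<and> S' \<subseteq> K \<and> card S = n \<and> card S' = n \<and> 2 \<le> card (S \<inter> S')} \<le> 4 ^ (2 * n - 2) * card K ^ (2 * n - 2)"
proof -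
  define q where "q = 2 * n - 2"
  let ?L = "{xs. set xs \<subseteq> K \<and> length xs = q}"
  let ?B = "?L \<times> (Pow {..<q} \<times> Pow {..<q})"
  let ?f = "\<lambda>(xs, I, J). ((!) xs ` I, (!) xs ` J)"
  have finB: "finite ?B" using K by (simp add: finite_lists_length_eq)
  have sub: "?A \<subseteq> ?f ` ?B"
  proof clarify
    fix S S' assume S: "S \<subseteq> K" "S' \<subseteq> K" "card S' = card S" "n = card S" "2 \<le> card (S \<inter> S')"
    let ?U = "S \<union> S'"
    have fin: "finite S" "finite S'" using S(1,2) K finite_subset by auto
    have U: "card ?U \<le> q" using card_Un_Int[OF fin] S by (simp add: q_def)
    have "?U \<noteq> {}" using S(5) by auto
    then obtain u where u: "u \<in> ?U" by blast
    obtain ys where ys: "set ys = ?U" "distinct ys" using finite_distinct_list[of ?U] fin by auto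
    \<comment> \<open>The word is padded to the exact length \<open>q\<close> with an element that
      already occurs.\<close>
    define xs where "xs = ys @ replicate (q - card ?U) u"
    have len: "length xs = q" using U ys distinct_card[OF ys(2)] by (simp add: xs_def)
    have set: "set xs = ?U" using ys u by (auto simp: xs_def set_replicate_conv_if)
    have im: "(!) xs ` {i\<in>{..<q}. xs ! i \<in> T} = T" if "T \<subseteq> ?U" for T
    proof (intro equalityI subsetI)
      fix x assume "x \<in> T"
      then have "x \<in> set xs" using that set by auto
      then obtain i where "i < q" "x = xs ! i" using len by (auto simp: in_set_conv_nth)
      then show "x \<in> (!) xs ` {i\<in>{..<q}. xs ! i \<in> T}" using \<open>x \<in> T\<close> by auto
    qed auto
    have "(xs, {i\<in>{..<q}. xs ! i \<in> S}, {i\<in>{..<q}. xs ! i \<in> S'}) \<in> ?B"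
      using len set S by auto
    moreover have "?f (xs, {i\<in>{..<q}. xs ! i \<in> S}, {i\<in>{..<q}. xs ! i \<in> S'}) = (S, S')"
      using im[of S] im[of S'] by (simp only: prod.case Un_upper1 Un_upper2)
    ultimately show "(S, S') \<in> ?f ` ?B" by (metis (no_types, lifting) imageI)
  qed
  then show "finite ?A" using finB by (rule finite_subset[OF _ finite_imageI])
  have "card ?A \<le> card (?f ` ?B)" using finB by (intro card_mono[OF finite_imageI sub])
  also have "\<dots> \<le> card ?B" using finB by (rule card_image_le)
  also have "\<dots> = card K ^ q * (2 ^ q * 2 ^ q)"
    using K by (simp add: card_cartesian_product card_lists_length_eq card_Pow)
  also have "(2::nat) ^ q * 2 ^ q = 4 ^ q" by (simp add: power_mult_distrib[symmetric])
  finally show "card ?A \<le> 4 ^ (2 * n - 2) * card K ^ (2 * n - 2)" by (simp add: q_def mult.commute)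
qed

lemma borel_measurable_nn_integral_count_space:
  fixes f :: "'i \<Rightarrow> 'a \<Rightarrow> ennreal"
  assumes I: "countable I" and f[measurable]: "\<And>i. i \<in> I \<Longrightarrow> f i \<in> borel_measurable M"
  shows "(\<lambda>x. \<integral>\<^sup>+i. f i x \<partial>count_space I) \<in> borel_measurable M"
proof (cases "finite I")
  case True
  then show ?thesis by (simp add: nn_integral_count_space_finite)
next
  case False
  have "(\<integral>\<^sup>+i. f i x \<partial>count_space I) = (\<Sum>n. f (from_nat_into I n) x)" for x
    using nn_integral_bij_count_space[OF bij_betw_from_nat_into[OF I False], of "\<lambda>i. f i x"]
    by (simp add: nn_integral_count_space_nat)
  moreover have "f (from_nat_into I n) \<in> borel_measurable M" for n
    using False by (intro f from_nat_into) auto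
  ultimately show ?thesis by simp
qed

section \<open>U-statistics and the mean of a product of two of them\<close>

context marked_poisson
begin

text \<open>A kernel acts on the set of points, so it is symmetric by construction. Measurability is
  required of its pullback to finite tuples, since the sets themselves carry no
  sigma-algebra.\<close>

definition kernel :: "((real \<times> 'c) set \<Rightarrow> ennreal) \<Rightarrow> bool" where
  "kernel F \<longleftrightarrow> (\<forall>I::nat set. finite I \<longrightarrow> (\<lambda>x. F (x ` I)) \<in> borel_measurable (Pi\<^sub>M I (\<lambda>_. \<mu>)))"

definition pts :: "'w \<Rightarrow> nat set \<Rightarrow> (real \<times> 'c) set" where
  "pts \<omega> S = (\<lambda>i. X i \<omega>) ` S"

definition ustat :: "nat \<Rightarrow> ((real \<times> 'c) set \<Rightarrow> ennreal) \<Rightarrow> 'w \<Rightarrow> ennreal" where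
  "ustat n F \<omega> = (\<integral>\<^sup>+S. F (pts \<omega> S) \<partial>count_space (idx n))"

text \<open>The part of a product of two U-statistics that is estimated rather than computed: index
  sets with at most one common element give explicit terms.\<close>

definition overlap :: "nat \<Rightarrow> nat \<Rightarrow> ((real \<times> 'c) set \<Rightarrow> ennreal) \<Rightarrow> ((real \<times> 'c) set \<Rightarrow> ennreal) \<Rightarrow> 'w \<Rightarrow> ennreal" where
  "overlap a b F F' \<omega> = (\<integral>\<^sup>+z. F (pts \<omega> (fst z)) * F' (pts \<omega> (snd z))
     \<partial>count_space {z \<in> idx a \<times> idx b. 2 \<le> card (fst z \<inter> snd z)})"

lemma kernelD: "kernel F \<Longrightarrow> finite (I :: nat set) \<Longrightarrow> (\<lambda>x. F (x ` I)) \<in> borel_measurable (Pi\<^sub>M I (\<lambda>_. \<mu>))"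
  by (simp add: kernel_def)

lemma kernel_measurable_subset:
  assumes F: "kernel F" and I: "finite (I :: nat set)" "I \<subseteq> J"
  shows "(\<lambda>x. F (x ` I)) \<in> borel_measurable (Pi\<^sub>M J (\<lambda>_. \<mu>))"
proof -
  have "(\<lambda>x. F (restrict x I ` I)) \<in> borel_measurable (Pi\<^sub>M J (\<lambda>_. \<mu>))"
    by (rule measurable_compose[OF measurable_restrict_subset[OF I(2)] kernelD[OF F I(1)]])
  then show ?thesis by simp
qed

lemma kernel_measurable_insert:
  assumes F: "kernel F" and I: "finite (I :: nat set)" and y: "y \<in> space \<mu>"
  shows "(\<lambda>x. F (insert y (x ` I))) \<in> borel_measurable (Pi\<^sub>M I (\<lambda>_. \<mu>))"
proof -
  \<comment> \<open>A fresh index serves as the coordinate that carries the fixed point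
    \<open>y\<close>.\<close>
  obtain n where n: "n \<notin> I" using ex_new_if_finite[OF infinite_UNIV_nat I] by blast
  have "(\<lambda>x. x(n := y)) \<in> Pi\<^sub>M I (\<lambda>_. \<mu>) \<rightarrow>\<^sub>M Pi\<^sub>M (insert n I) (\<lambda>_. \<mu>)"
    by (rule measurable_fun_upd[where J = I]) (use y in auto)
  from measurable_compose[OF this kernelD[OF F]]
  have "(\<lambda>x. F ((x(n := y)) ` insert n I)) \<in> borel_measurable (Pi\<^sub>M I (\<lambda>_. \<mu>))" using I by simp
  moreover have "(x(n := y)) ` insert n I = insert y (x ` I)" for x :: "nat \<Rightarrow> real \<times> 'c"
    using n by (auto simp: image_iff)
  ultimately show ?thesis by simp
qed

lemma pts_set: "length is = n \<Longrightarrow> I \<subseteq> {..<n} \<Longrightarrow> (\<lambda>j\<in>{..<n}. X (is ! j) \<omega>) ` I = pts \<omega> ((!) is ` I)"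
  unfolding pts_def image_image by (rule image_cong) auto

lemma set_take_nth: "n \<le> length is \<Longrightarrow> set (take n is) = (!) is ` {..<n}"
  by (simp add: nth_image[symmetric] atLeast0LessThan)

lemma set_take_drop_nth: "a + b \<le> length is \<Longrightarrow> set (take b (drop a is)) = (!) is ` {a..<a + b}"
proof -
  assume *: "a + b \<le> length is"
  have "{a..<a + b} = (+) a ` {..<b}" by (auto simp: image_iff Bex_def) presburger
  then have "(!) is ` {a..<a + b} = (\<lambda>i. is ! (a + i)) ` {..<b}" by (simp add: image_image)
  also have "\<dots> = (\<lambda>i. drop a is ! i) ` {..<b}" using * by (intro image_cong) auto
  finally show ?thesis using * by (simp add: set_take_nth)
qed

lemma kernel_pts_measurable:
  assumes F: "kernel F" and S: "finite S"
  shows "(\<lambda>\<omega>. F (pts \<omega> S)) \<in> borel_measurable M"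
proof -
  have "(\<lambda>\<omega>. \<lambda>i\<in>S. X i \<omega>) \<in> M \<rightarrow>\<^sub>M Pi\<^sub>M S (\<lambda>_. \<mu>)" by measurable
  from measurable_compose[OF this kernelD[OF F S]] show ?thesis
    by (simp add: pts_def)
qed

lemma campbell:
  assumes H: "H \<in> borel_measurable (Pi\<^sub>M {..<n} (\<lambda>_. \<mu>))"
  shows "(\<integral>\<^sup>+is. (\<integral>\<^sup>+\<omega>. H (\<lambda>j\<in>{..<n}. X (is ! j) \<omega>) \<partial>M) \<partial>count_space (dlists n)) = (\<integral>\<^sup>+x. H x \<partial>Pi\<^sub>M {..<n} (\<lambda>_. \<mu>))"
proof -
  let ?g = "\<lambda>is. \<lambda>j\<in>{..<n}. is ! j"
  have bij: "bij_betw ?g (dlists n) (inj_idx n)"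
    unfolding bij_betw_def
  proof
    show "inj_on ?g (dlists n)"
    proof (rule inj_onI)
      fix xs ys :: "nat list" assume *: "xs \<in> dlists n" "ys \<in> dlists n" "?g xs = ?g ys"
      have "xs ! j = ys ! j" if "j < n" for j using fun_cong[OF *(3), of j] that by simp
      then show "xs = ys" using *(1,2) by (auto intro!: nth_equalityI simp: dlists_def)
    qed
    show "?g ` dlists n = inj_idx n"
    proof (intro equalityI subsetI)
      fix \<iota> assume "\<iota> \<in> ?g ` dlists n"
      then show "\<iota> \<in> inj_idx n" by (auto simp: dlists_def inj_idx_def inj_on_def nth_eq_iff_index_eq split: if_splits)
    next
      fix \<iota> assume \<iota>: "\<iota> \<in> inj_idx n"
      have "map \<iota> [0..<n] \<in> dlists n"
        using \<iota> by (simp add: dlists_def inj_idx_def distinct_map atLeast0LessThan)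
      moreover have "?g (map \<iota> [0..<n]) = \<iota>"
        using \<iota> by (auto simp: inj_idx_def PiE_def extensional_def fun_eq_iff)
      ultimately show "\<iota> \<in> ?g ` dlists n" by (metis imageI)
    qed
  qed
  have pick: "(\<lambda>j\<in>{..<n}. X (is ! j) \<omega>) = pick n (?g is) \<omega>" for "is" \<omega>
    by (auto simp: pick_def)
  have "(\<integral>\<^sup>+is. (\<integral>\<^sup>+\<omega>. H (pick n (?g is) \<omega>) \<partial>M) \<partial>count_space (dlists n)) = (\<integral>\<^sup>+x. H x \<partial>Pi\<^sub>M {..<n} (\<lambda>_. \<mu>))"
    using nn_integral_bij_count_space[OF bij, of "\<lambda>\<iota>. \<integral>\<^sup>+\<omega>. H (pick n \<iota> \<omega>) \<partial>M"] campbell_inj[OF H] by simp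
  then show ?thesis unfolding pick .
qed

lemma countable_idx_pairs: "countable {z \<in> idx a \<times> idx b. P z}"
  by (rule countable_subset[OF _ countable_SIGMA[OF countable_idx countable_idx]]) auto

lemma ustat_measurable[measurable]: "kernel F \<Longrightarrow> ustat n F \<in> borel_measurable M"
  unfolding ustat_def[abs_def]
  by (rule borel_measurable_nn_integral_count_space[OF countable_idx]) (simp add: kernel_pts_measurable idx_def)

lemma nn_integral_ustat:
  assumes F: "kernel F"
  shows "fact n * (\<integral>\<^sup>+\<omega>. ustat n F \<omega> \<partial>M) = (\<integral>\<^sup>+x. F (x ` {..<n}) \<partial>Pi\<^sub>M {..<n} (\<lambda>_. \<mu>))"
proof -
  have "(\<integral>\<^sup>+\<omega>. ustat n F \<omega> \<partial>M) = (\<integral>\<^sup>+S. (\<integral>\<^sup>+\<omega>. F (pts \<omega> S) \<partial>M) \<partial>count_space (idx n))"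
    unfolding ustat_def
    by (rule nn_integral_count_space_nn_integral[OF countable_idx]) (simp add: kernel_pts_measurable F idx_def)
  then have "fact n * (\<integral>\<^sup>+\<omega>. ustat n F \<omega> \<partial>M)
      = (\<integral>\<^sup>+is. (\<integral>\<^sup>+\<omega>. F (pts \<omega> (set is)) \<partial>M) \<partial>count_space (dlists n))"
    by (simp add: nn_integral_dlists[where G = "\<lambda>S. \<integral>\<^sup>+\<omega>. F (pts \<omega> S) \<partial>M"])
  also have "\<dots> = (\<integral>\<^sup>+is. (\<integral>\<^sup>+\<omega>. F ((\<lambda>j\<in>{..<n}. X (is ! j) \<omega>) ` {..<n}) \<partial>M) \<partial>count_space (dlists n))"
  proof (intro nn_integral_cong arg_cong[where f = F])
    fix "is" \<omega> assume "is \<in> space (count_space (dlists n))"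
    then have "length is = n" by (simp add: dlists_def)
    then show "pts \<omega> (set is) = (\<lambda>j\<in>{..<n}. X (is ! j) \<omega>) ` {..<n}"
      using set_take_nth[of n "is"] by (simp only: pts_set order_refl) simp
  qed
  also have "\<dots> = (\<integral>\<^sup>+x. F (x ` {..<n}) \<partial>Pi\<^sub>M {..<n} (\<lambda>_. \<mu>))"
    by (rule campbell) (rule kernelD[OF F], simp)
  finally show ?thesis .
qed

text \<open>Disjoint index sets occupy disjoint blocks of coordinates, so the Campbell formula
  yields a product of two integrals.\<close>

lemma nn_integral_disjoint_pairs:
  assumes F: "kernel F" "kernel F'"
    and m: "\<And>I::nat set. finite I \<Longrightarrow> card I = a \<Longrightarrow> (\<integral>\<^sup>+x. F (x ` I) \<partial>Pi\<^sub>M I (\<lambda>_. \<mu>)) = m"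
    and m': "\<And>I::nat set. finite I \<Longrightarrow> card I = b \<Longrightarrow> (\<integral>\<^sup>+x. F' (x ` I) \<partial>Pi\<^sub>M I (\<lambda>_. \<mu>)) = m'"
  shows "fact a * fact b * (\<integral>\<^sup>+\<omega>. (\<integral>\<^sup>+z. F (pts \<omega> (fst z)) * F' (pts \<omega> (snd z))
     \<partial>count_space {z \<in> idx a \<times> idx b. card (fst z \<inter> snd z) = 0}) \<partial>M) = m * m'"
proof -
  let ?D = "{z \<in> idx a \<times> idx b. card (fst z \<inter> snd z) = 0}"
  let ?I = "{..<a}" and ?J = "{a..<a + b}"
  have IJ: "{..<a + b} = ?I \<union> ?J" "?I \<inter> ?J = {}" by auto
  have "(\<integral>\<^sup>+\<omega>. (\<integral>\<^sup>+z. F (pts \<omega> (fst z)) * F' (pts \<omega> (snd z)) \<partial>count_space ?D) \<partial>M)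
     = (\<integral>\<^sup>+z. (\<integral>\<^sup>+\<omega>. F (pts \<omega> (fst z)) * F' (pts \<omega> (snd z)) \<partial>M) \<partial>count_space ?D)"
    by (intro nn_integral_count_space_nn_integral countable_idx_pairs borel_measurable_times_ennreal kernel_pts_measurable F)
      (auto simp: idx_def)
  then have "fact a * fact b * (\<integral>\<^sup>+\<omega>. (\<integral>\<^sup>+z. F (pts \<omega> (fst z)) * F' (pts \<omega> (snd z)) \<partial>count_space ?D) \<partial>M)
     = (\<integral>\<^sup>+is. (\<integral>\<^sup>+\<omega>. F (pts \<omega> (set (take a is))) * F' (pts \<omega> (set (drop a is))) \<partial>M) \<partial>count_space (dlists (a + b)))"
    using nn_integral_dlists_disjoint[where a = a and b = b and G = "\<lambda>S S'. \<integral>\<^sup>+\<omega>. F (pts \<omega> S) * F' (pts \<omega> S') \<partial>M"] by simp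
  also have "\<dots> = (\<integral>\<^sup>+is. (\<integral>\<^sup>+\<omega>. (\<lambda>x. F (x ` ?I) * F' (x ` ?J)) (\<lambda>j\<in>{..<a + b}. X (is ! j) \<omega>) \<partial>M) \<partial>count_space (dlists (a + b)))"
  proof (intro nn_integral_cong)
    fix "is" \<omega> assume "is \<in> space (count_space (dlists (a + b)))"
    then have l: "length is = a + b" by (simp add: dlists_def)
    have "set (take a is) = (!) is ` ?I" "set (drop a is) = (!) is ` ?J"
      using set_take_nth[of a "is"] set_take_drop_nth[of a b "is"] l by simp_all
    moreover have "(\<lambda>j\<in>{..<a + b}. X (is ! j) \<omega>) ` ?I = pts \<omega> ((!) is ` ?I)"
      "(\<lambda>j\<in>{..<a + b}. X (is ! j) \<omega>) ` ?J = pts \<omega> ((!) is ` ?J)"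
      by (rule pts_set[OF l]; force)+
    ultimately show "F (pts \<omega> (set (take a is))) * F' (pts \<omega> (set (drop a is))) =
      (\<lambda>x. F (x ` ?I) * F' (x ` ?J)) (\<lambda>j\<in>{..<a + b}. X (is ! j) \<omega>)" by simp
  qed
  also have "\<dots> = (\<integral>\<^sup>+x. F (x ` ?I) * F' (x ` ?J) \<partial>Pi\<^sub>M {..<a + b} (\<lambda>_. \<mu>))"
    by (rule campbell) (intro borel_measurable_times_ennreal kernel_measurable_subset F, auto)
  also have "\<dots> = (\<integral>\<^sup>+x. (\<integral>\<^sup>+y. F (merge ?I ?J (x, y) ` ?I) * F' (merge ?I ?J (x, y) ` ?J) \<partial>Pi\<^sub>M ?J (\<lambda>_. \<mu>)) \<partial>Pi\<^sub>M ?I (\<lambda>_. \<mu>))"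
    unfolding IJ(1)
    by (rule prod.product_nn_integral_fold[OF IJ(2)])
      (simp, simp, intro borel_measurable_times_ennreal kernel_measurable_subset F, auto)
  also have "\<dots> = (\<integral>\<^sup>+x. (\<integral>\<^sup>+y. F (x ` ?I) * F' (y ` ?J) \<partial>Pi\<^sub>M ?J (\<lambda>_. \<mu>)) \<partial>Pi\<^sub>M ?I (\<lambda>_. \<mu>))"
  proof (intro nn_integral_cong)
    fix x y :: "nat \<Rightarrow> real \<times> 'c"
    have "merge ?I ?J (x, y) ` ?I = x ` ?I" "merge ?I ?J (x, y) ` ?J = y ` ?J"
      by (rule image_cong; auto simp: merge_def)+
    then show "F (merge ?I ?J (x, y) ` ?I) * F' (merge ?I ?J (x, y) ` ?J) = F (x ` ?I) * F' (y ` ?J)" by simp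
  qed
  also have "\<dots> = m * m'"
    using kernelD[OF F(1), of ?I] kernelD[OF F(2), of ?J] m[of ?I] m'[of ?J]
    by (simp add: nn_integral_cmult nn_integral_multc)
  finally show ?thesis .
qed

text \<open>With the common point \<open>y\<close> fixed, the remaining coordinates form two
  disjoint blocks whose integrals are conditional means; \<open>y\<close> is integrated
  outermost.\<close>

lemma nn_integral_common_pairs:
  assumes F: "kernel F" "kernel F'"
    and g: "\<And>(I::nat set) y. finite I \<Longrightarrow> card I = a \<Longrightarrow> y \<in> space \<mu> \<Longrightarrow> (\<integral>\<^sup>+x. F (insert y (x ` I)) \<partial>Pi\<^sub>M I (\<lambda>_. \<mu>)) = g y"
    and g': "\<And>(I::nat set) y. finite I \<Longrightarrow> card I = b \<Longrightarrow> y \<in> space \<mu> \<Longrightarrow> (\<integral>\<^sup>+x. F' (insert y (x ` I)) \<partial>Pi\<^sub>M I (\<lambda>_. \<mu>)) = g' y"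
  shows "fact a * fact b * (\<integral>\<^sup>+\<omega>. (\<integral>\<^sup>+z. F (pts \<omega> (fst z)) * F' (pts \<omega> (snd z))
     \<partial>count_space {z \<in> idx (Suc a) \<times> idx (Suc b). card (fst z \<inter> snd z) = 1}) \<partial>M) = (\<integral>\<^sup>+y. g y * g' y \<partial>\<mu>)"
proof -
  let ?n = "a + b"
  let ?D = "{z \<in> idx (Suc a) \<times> idx (Suc b). card (fst z \<inter> snd z) = 1}"
  let ?I = "{..<a}" and ?J = "{a..<a + b}"
  have IJ: "{..<?n} = ?I \<union> ?J" "?I \<inter> ?J = {}" by auto
  let ?H = "\<lambda>x. F (x ` insert ?n ?I) * F' (x ` insert ?n ?J)"
  have Hm: "?H \<in> borel_measurable (Pi\<^sub>M (insert ?n {..<?n}) (\<lambda>_. \<mu>))"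
    by (intro borel_measurable_times_ennreal kernel_measurable_subset F) auto
  have "(\<integral>\<^sup>+\<omega>. (\<integral>\<^sup>+z. F (pts \<omega> (fst z)) * F' (pts \<omega> (snd z)) \<partial>count_space ?D) \<partial>M)
     = (\<integral>\<^sup>+z. (\<integral>\<^sup>+\<omega>. F (pts \<omega> (fst z)) * F' (pts \<omega> (snd z)) \<partial>M) \<partial>count_space ?D)"
    by (intro nn_integral_count_space_nn_integral countable_idx_pairs borel_measurable_times_ennreal kernel_pts_measurable F)
      (auto simp: idx_def)
  then have "fact a * fact b * (\<integral>\<^sup>+\<omega>. (\<integral>\<^sup>+z. F (pts \<omega> (fst z)) * F' (pts \<omega> (snd z)) \<partial>count_space ?D) \<partial>M)
     = (\<integral>\<^sup>+is. (\<integral>\<^sup>+\<omega>. F (pts \<omega> (insert (is ! ?n) (set (take a is)))) * F' (pts \<omega> (insert (is ! ?n) (set (take b (drop a is))))) \<partial>M)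
        \<partial>count_space (dlists (Suc ?n)))"
    using nn_integral_dlists_common[where a = a and b = b and G = "\<lambda>S S'. \<integral>\<^sup>+\<omega>. F (pts \<omega> S) * F' (pts \<omega> S') \<partial>M"] by simp
  also have "\<dots> = (\<integral>\<^sup>+is. (\<integral>\<^sup>+\<omega>. ?H (\<lambda>j\<in>{..<Suc ?n}. X (is ! j) \<omega>) \<partial>M) \<partial>count_space (dlists (Suc ?n)))"
  proof (intro nn_integral_cong)
    fix "is" \<omega> assume "is \<in> space (count_space (dlists (Suc ?n)))"
    then have l: "length is = Suc ?n" by (simp add: dlists_def)
    have "insert (is ! ?n) (set (take a is)) = (!) is ` insert ?n ?I"
      "insert (is ! ?n) (set (take b (drop a is))) = (!) is ` insert ?n ?J"
      using set_take_nth[of a "is"] set_take_drop_nth[of a b "is"] l by simp_all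
    moreover have "(\<lambda>j\<in>{..<Suc ?n}. X (is ! j) \<omega>) ` insert ?n ?I = pts \<omega> ((!) is ` insert ?n ?I)"
      "(\<lambda>j\<in>{..<Suc ?n}. X (is ! j) \<omega>) ` insert ?n ?J = pts \<omega> ((!) is ` insert ?n ?J)"
      by (rule pts_set[OF l]; force)+
    ultimately show "F (pts \<omega> (insert (is ! ?n) (set (take a is)))) * F' (pts \<omega> (insert (is ! ?n) (set (take b (drop a is))))) =
      ?H (\<lambda>j\<in>{..<Suc ?n}. X (is ! j) \<omega>)" by metis
  qed
  also have "\<dots> = (\<integral>\<^sup>+x. ?H x \<partial>Pi\<^sub>M {..<Suc ?n} (\<lambda>_. \<mu>))"
    using Hm by (intro campbell) (simp add: lessThan_Suc)
  also have "\<dots> = (\<integral>\<^sup>+y. (\<integral>\<^sup>+x. ?H (x(?n := y)) \<partial>Pi\<^sub>M {..<?n} (\<lambda>_. \<mu>)) \<partial>\<mu>)"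
    unfolding lessThan_Suc by (rule prod.product_nn_integral_insert_rev) (use Hm in auto)
  also have "\<dots> = (\<integral>\<^sup>+y. g y * g' y \<partial>\<mu>)"
  proof (rule nn_integral_cong)
    fix y assume y: "y \<in> space \<mu>"
    let ?G = "\<lambda>x. F (insert y (x ` ?I)) * F' (insert y (x ` ?J))"
    have Fm: "(\<lambda>x. F (insert y (x ` ?I))) \<in> borel_measurable (Pi\<^sub>M ?I (\<lambda>_. \<mu>))"
      "(\<lambda>x. F' (insert y (x ` ?J))) \<in> borel_measurable (Pi\<^sub>M ?J (\<lambda>_. \<mu>))"
      by (rule kernel_measurable_insert[OF _ _ y]; simp add: F)+
    have "(\<lambda>x. F (insert y (restrict x ?I ` ?I))) \<in> borel_measurable (Pi\<^sub>M (?I \<union> ?J) (\<lambda>_. \<mu>))"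
      "(\<lambda>x. F' (insert y (restrict x ?J ` ?J))) \<in> borel_measurable (Pi\<^sub>M (?I \<union> ?J) (\<lambda>_. \<mu>))"
      by (rule measurable_compose[OF measurable_restrict_subset Fm(1)], simp)
        (rule measurable_compose[OF measurable_restrict_subset Fm(2)], simp)
    then have Gm: "?G \<in> borel_measurable (Pi\<^sub>M (?I \<union> ?J) (\<lambda>_. \<mu>))" by simp
    have "(\<integral>\<^sup>+x. ?H (x(?n := y)) \<partial>Pi\<^sub>M {..<?n} (\<lambda>_. \<mu>)) = (\<integral>\<^sup>+x. ?G x \<partial>Pi\<^sub>M (?I \<union> ?J) (\<lambda>_. \<mu>))"
      unfolding IJ(1)
    proof (rule nn_integral_cong)
      fix x :: "nat \<Rightarrow> real \<times> 'c"
      have "(x(?n := y)) ` insert ?n ?I = insert y (x ` ?I)" "(x(?n := y)) ` insert ?n ?J = insert y (x ` ?J)"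
        by (auto simp: image_iff)
      then show "?H (x(?n := y)) = ?G x" by metis
    qed
    also have "\<dots> = (\<integral>\<^sup>+x. (\<integral>\<^sup>+z. ?G (merge ?I ?J (x, z)) \<partial>Pi\<^sub>M ?J (\<lambda>_. \<mu>)) \<partial>Pi\<^sub>M ?I (\<lambda>_. \<mu>))"
      by (rule prod.product_nn_integral_fold[OF IJ(2) _ _ Gm]) auto
    also have "\<dots> = (\<integral>\<^sup>+x. (\<integral>\<^sup>+z. F (insert y (x ` ?I)) * F' (insert y (z ` ?J)) \<partial>Pi\<^sub>M ?J (\<lambda>_. \<mu>)) \<partial>Pi\<^sub>M ?I (\<lambda>_. \<mu>))"
    proof (intro nn_integral_cong)
      fix x z :: "nat \<Rightarrow> real \<times> 'c"
      have "merge ?I ?J (x, z) ` ?I = x ` ?I" "merge ?I ?J (x, z) ` ?J = z ` ?J"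
        by (rule image_cong; auto simp: merge_def)+
      then show "?G (merge ?I ?J (x, z)) = F (insert y (x ` ?I)) * F' (insert y (z ` ?J))" by simp
    qed
    also have "\<dots> = g y * g' y"
      using Fm g[of ?I y] g'[of ?J y] y by (simp add: nn_integral_cmult nn_integral_multc)
    finally show "(\<integral>\<^sup>+x. ?H (x(?n := y)) \<partial>Pi\<^sub>M {..<?n} (\<lambda>_. \<mu>)) = g y * g' y" .
  qed
  finally show ?thesis .
qed

lemma ustat_mult:
  "ustat a F \<omega> * ustat b F' \<omega> =
    (\<integral>\<^sup>+z. F (pts \<omega> (fst z)) * F' (pts \<omega> (snd z)) \<partial>count_space {z \<in> idx a \<times> idx b. card (fst z \<inter> snd z) = 0}) +
    (\<integral>\<^sup>+z. F (pts \<omega> (fst z)) * F' (pts \<omega> (snd z)) \<partial>count_space {z \<in> idx a \<times> idx b. card (fst z \<inter> snd z) = 1}) +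
    overlap a b F F' \<omega>"
proof -
  let ?f = "\<lambda>z. F (pts \<omega> (fst z)) * F' (pts \<omega> (snd z))" and ?P = "idx a \<times> idx b"
  let ?D = "\<lambda>c. {z \<in> ?P. card (fst z \<inter> snd z) = c}" and ?E = "{z \<in> ?P. 2 \<le> card (fst z \<inter> snd z)}"
  have "ustat a F \<omega> * ustat b F' \<omega> = (\<integral>\<^sup>+S. (\<integral>\<^sup>+S'. F (pts \<omega> S) * F' (pts \<omega> S') \<partial>count_space (idx b)) \<partial>count_space (idx a))"
    by (simp add: ustat_def nn_integral_cmult nn_integral_multc)
  also have "\<dots> = (\<integral>\<^sup>+z. ?f z \<partial>count_space ?P)"
    by (rule nn_integral_count_space_Times[OF countable_idx countable_idx])
  also have "\<dots> = (\<integral>\<^sup>+z. ?f z * indicator (?D 0) z + ?f z * indicator (?D 1) z + ?f z * indicator ?E z \<partial>count_space ?P)"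
    by (intro nn_integral_cong) (auto simp: indicator_def)
  also have "\<dots> = (\<integral>\<^sup>+z. ?f z * indicator (?D 0) z \<partial>count_space ?P) + (\<integral>\<^sup>+z. ?f z * indicator (?D 1) z \<partial>count_space ?P)
      + (\<integral>\<^sup>+z. ?f z * indicator ?E z \<partial>count_space ?P)"
    by (simp add: nn_integral_add)
  also have "(\<integral>\<^sup>+z. ?f z * indicator (?D 0) z \<partial>count_space ?P) = (\<integral>\<^sup>+z. ?f z \<partial>count_space (?D 0))"
    by (rule nn_integral_count_space_subset) auto
  also have "(\<integral>\<^sup>+z. ?f z * indicator (?D 1) z \<partial>count_space ?P) = (\<integral>\<^sup>+z. ?f z \<partial>count_space (?D 1))"
    by (rule nn_integral_count_space_subset) auto
  also have "(\<integral>\<^sup>+z. ?f z * indicator ?E z \<partial>count_space ?P) = overlap a b F F' \<omega>"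
    unfolding overlap_def by (rule nn_integral_count_space_subset) auto
  finally show ?thesis .
qed

lemma overlap_measurable:
  assumes "kernel F" "kernel F'"
  shows "overlap a b F F' \<in> borel_measurable M"
  unfolding overlap_def[abs_def]
  by (rule borel_measurable_nn_integral_count_space[OF countable_idx_pairs])
    (auto intro!: borel_measurable_times_ennreal kernel_pts_measurable assms simp: idx_def)

text \<open>Pairs of index sets are sorted by the number of common elements: none gives the product
  of the means, one the inner product of the conditional means, more than one the overlap. The
  factorials in the hypotheses count the orderings of the points.\<close>

lemma nn_integral_ustat_mult:
  assumes F: "kernel F" "kernel F'"
    and m: "\<And>I::nat set. finite I \<Longrightarrow> card I = Suc a \<Longrightarrow> (\<integral>\<^sup>+x. F (x ` I) \<partial>Pi\<^sub>M I (\<lambda>_. \<mu>)) = fact (Suc a) * m"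
    and m': "\<And>I::nat set. finite I \<Longrightarrow> card I = Suc b \<Longrightarrow> (\<integral>\<^sup>+x. F' (x ` I) \<partial>Pi\<^sub>M I (\<lambda>_. \<mu>)) = fact (Suc b) * m'"
    and g: "\<And>(I::nat set) y. finite I \<Longrightarrow> card I = a \<Longrightarrow> y \<in> space \<mu> \<Longrightarrow> (\<integral>\<^sup>+x. F (insert y (x ` I)) \<partial>Pi\<^sub>M I (\<lambda>_. \<mu>)) = fact a * g y"
    and g': "\<And>(I::nat set) y. finite I \<Longrightarrow> card I = b \<Longrightarrow> y \<in> space \<mu> \<Longrightarrow> (\<integral>\<^sup>+x. F' (insert y (x ` I)) \<partial>Pi\<^sub>M I (\<lambda>_. \<mu>)) = fact b * g' y"
    and gm: "(\<lambda>y. g y * g' y) \<in> borel_measurable \<mu>"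
  shows "(\<integral>\<^sup>+\<omega>. ustat (Suc a) F \<omega> * ustat (Suc b) F' \<omega> \<partial>M) =
    m * m' + (\<integral>\<^sup>+y. g y * g' y \<partial>\<mu>) + (\<integral>\<^sup>+\<omega>. overlap (Suc a) (Suc b) F F' \<omega> \<partial>M)"
proof -
  let ?T = "\<lambda>c \<omega>. \<integral>\<^sup>+z. F (pts \<omega> (fst z)) * F' (pts \<omega> (snd z))
     \<partial>count_space {z \<in> idx (Suc a) \<times> idx (Suc b). card (fst z \<inter> snd z) = c}"
  have T_m: "?T c \<in> borel_measurable M" for c
    by (rule borel_measurable_nn_integral_count_space[OF countable_idx_pairs])
      (auto intro!: borel_measurable_times_ennreal kernel_pts_measurable F simp: idx_def)
  have "(fact n :: ennreal) = ennreal (fact n)" for n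
    by (metis ennreal_of_nat_eq_real_of_nat of_nat_fact)
  then have fact_pos: "(fact n :: ennreal) \<noteq> 0" "(fact n :: ennreal) \<noteq> top" for n
    by simp_all
  have "(\<integral>\<^sup>+\<omega>. ustat (Suc a) F \<omega> * ustat (Suc b) F' \<omega> \<partial>M)
     = (\<integral>\<^sup>+\<omega>. (?T 0 \<omega> + ?T 1 \<omega>) + overlap (Suc a) (Suc b) F F' \<omega> \<partial>M)"
    by (simp only: ustat_mult)
  also have "\<dots> = (\<integral>\<^sup>+\<omega>. ?T 0 \<omega> + ?T 1 \<omega> \<partial>M) + (\<integral>\<^sup>+\<omega>. overlap (Suc a) (Suc b) F F' \<omega> \<partial>M)"
    by (rule nn_integral_add) (intro borel_measurable_add T_m, rule overlap_measurable[OF F])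
  also have "(\<integral>\<^sup>+\<omega>. ?T 0 \<omega> + ?T 1 \<omega> \<partial>M) = (\<integral>\<^sup>+\<omega>. ?T 0 \<omega> \<partial>M) + (\<integral>\<^sup>+\<omega>. ?T 1 \<omega> \<partial>M)"
    by (rule nn_integral_add) (rule T_m)+
  finally have "(\<integral>\<^sup>+\<omega>. ustat (Suc a) F \<omega> * ustat (Suc b) F' \<omega> \<partial>M)
     = (\<integral>\<^sup>+\<omega>. ?T 0 \<omega> \<partial>M) + (\<integral>\<^sup>+\<omega>. ?T 1 \<omega> \<partial>M) + (\<integral>\<^sup>+\<omega>. overlap (Suc a) (Suc b) F F' \<omega> \<partial>M)" .
  moreover have "(\<integral>\<^sup>+\<omega>. ?T 0 \<omega> \<partial>M) = m * m'"
  proof -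
    have "(fact (Suc a) * fact (Suc b)) * (\<integral>\<^sup>+\<omega>. ?T 0 \<omega> \<partial>M) = (fact (Suc a) * fact (Suc b)) * (m * m')"
      using nn_integral_disjoint_pairs[OF F m m'] by (simp only: mult_ac)
    then show ?thesis using fact_pos
      by (subst (asm) ennreal_mult_cancel_left) (auto simp: ennreal_mult_eq_top_iff simp del: fact_Suc)
  qed
  moreover have "(\<integral>\<^sup>+\<omega>. ?T 1 \<omega> \<partial>M) = (\<integral>\<^sup>+y. g y * g' y \<partial>\<mu>)"
  proof -
    have "(fact a * fact b) * (\<integral>\<^sup>+\<omega>. ?T 1 \<omega> \<partial>M) = (\<integral>\<^sup>+y. (fact a * g y) * (fact b * g' y) \<partial>\<mu>)"
      by (rule nn_integral_common_pairs[OF F g g'])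
    also have "\<dots> = (\<integral>\<^sup>+y. (fact a * fact b) * (g y * g' y) \<partial>\<mu>)" by (simp only: mult_ac)
    also have "\<dots> = (fact a * fact b) * (\<integral>\<^sup>+y. g y * g' y \<partial>\<mu>)" by (rule nn_integral_cmult[OF gm])
    finally show ?thesis using fact_pos
      by (subst (asm) ennreal_mult_cancel_left) (auto simp: ennreal_mult_eq_top_iff)
  qed
  ultimately show ?thesis by simp
qed

end

section \<open>Moment bound for pairs with several common points\<close>

lemma power_le_fact_exp:
  fixes x :: real
  assumes "x \<ge> 0"
  shows "x ^ q \<le> fact q * exp x"
proof -
  have "(\<Sum>n\<in>{q}. x ^ n /\<^sub>R fact n) \<le> (\<Sum>n. x ^ n /\<^sub>R fact n)"
    using assms by (intro sum_le_suminf summable_exp_generic) auto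
  then have "x ^ q /\<^sub>R fact q \<le> exp x" by (simp add: exp_def)
  then show ?thesis by (simp add: field_simps)
qed

lemma norm_iexp_diff: "cmod (iexp x - iexp y) \<le> \<bar>x - y\<bar>"
proof -
  have "iexp x - iexp y = iexp y * (iexp (x - y) - 1)"
    by (simp add: right_diff_distrib mult_exp_exp)
  then have "cmod (iexp x - iexp y) = cmod (iexp (x - y) - 1)"
    by (simp add: norm_mult)
  also have "\<dots> \<le> \<bar>x - y\<bar>"
    using iexp_approx1[of "x - y" 0] by simp
  finally show ?thesis .
qed

context marked_poisson
begin

lemma finite_window:
  assumes "point_count X W \<omega> = of_nat k"
  shows "finite {i. X i \<omega> \<in> W}" "card {i. X i \<omega> \<in> W} = k"
proof -
  have "point_count X W \<omega> = (\<integral>\<^sup>+i. indicator {i. X i \<omega> \<in> W} i \<partial>count_space UNIV)"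
    by (simp add: point_count_def nn_integral_count_space_nat indicator_def)
  also have "\<dots> = emeasure (count_space UNIV) {i. X i \<omega> \<in> W}" by simp
  finally have *: "emeasure (count_space UNIV) {i. X i \<omega> \<in> W} = of_nat k" using assms by simp
  then show fin: "finite {i. X i \<omega> \<in> W}" by (cases "finite {i. X i \<omega> \<in> W}") auto
  have "of_nat (card {i. X i \<omega> \<in> W}) = (of_nat k :: ennreal)"
    using * fin by (simp add: emeasure_count_space_finite)
  then show "card {i. X i \<omega> \<in> W} = k" by simp
qed

text \<open>The kernel vanishes unless all points lie in \<open>W\<close>, so only index sets among
  the finitely many points of the window matter, and each pair contributes at most 1.\<close>

lemma overlap_le:
  assumes F1: "\<And>Y. F Y \<le> 1" and F0: "\<And>Y. Y \<subseteq> space \<mu> \<Longrightarrow> \<not> Y \<subseteq> W \<Longrightarrow> F Y = 0"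
    and \<omega>: "\<omega> \<in> space M" and k: "point_count X W \<omega> = of_nat k"
  shows "overlap n n F F \<omega> \<le> of_nat (4 ^ (2 * n - 2) * k ^ (2 * n - 2))"
proof -
  let ?K = "{i. X i \<omega> \<in> W}"
  note K = finite_window[OF k]
  let ?A = "{(S, S'). S \<subseteq> ?K \<and> S' \<subseteq> ?K \<and> card S = n \<and> card S' = n \<and> 2 \<le> card (S \<inter> S')}"
  let ?E = "{z \<in> idx n \<times> idx n. 2 \<le> card (fst z \<inter> snd z)}"
  have AE: "?A \<subseteq> ?E" using K(1) by (auto simp: idx_def intro: finite_subset)
  have X: "X i \<omega> \<in> space \<mu>" for i using measurable_space[OF X_measurable \<omega>] .
  have zero: "F (pts \<omega> S) = 0" if "\<not> S \<subseteq> ?K" for S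
    using that X by (intro F0) (auto simp: pts_def)
  have "overlap n n F F \<omega> \<le> (\<integral>\<^sup>+z. indicator ?A z \<partial>count_space ?E)"
    unfolding overlap_def
  proof (rule nn_integral_mono)
    fix z assume "z \<in> space (count_space ?E)"
    then have z: "z \<in> ?E" by simp
    show "F (pts \<omega> (fst z)) * F (pts \<omega> (snd z)) \<le> indicator ?A z"
    proof (cases "z \<in> ?A")
      case True
      then have ind: "indicator ?A z = (1::ennreal)" by (rule indicator_simps(1))
      have "F (pts \<omega> (fst z)) * F (pts \<omega> (snd z)) \<le> 1 * 1" by (intro mult_mono F1) auto
      then show ?thesis unfolding ind by simp
    next
      case False
      then have "\<not> fst z \<subseteq> ?K \<or> \<not> snd z \<subseteq> ?K" using z by (auto simp: idx_def)
      then have "F (pts \<omega> (fst z)) * F (pts \<omega> (snd z)) = 0" using zero by auto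
      then show ?thesis by (simp only: zero_le)
    qed
  qed
  also have "\<dots> = of_nat (card ?A)"
    using AE card_overlapping_pairs_le(1)[OF K(1), of n]
    by (simp add: nn_integral_indicator emeasure_count_space_finite)
  also have "\<dots> \<le> of_nat (4 ^ (2 * n - 2) * k ^ (2 * n - 2))"
    using card_overlapping_pairs_le(2)[OF K(1), of n] unfolding K(2) by (rule of_nat_mono)
  finally show ?thesis .
qed

text \<open>A Poisson variable \<open>N\<close> with mean \<open>T \<ge> 1\<close> has a moment of
  order \<open>q\<close> bounded by a multiple of \<open>T ^ q\<close>: indeed
  \<open>N ^ q \<le> T ^ q * fact q * exp (N / T)\<close>, and the mean of
  \<open>exp (N / T)\<close> is \<open>exp (T * exp (1 / T) - T)\<close>, which is at most
  \<open>exp 2\<close> because \<open>1 / T \<le> 1\<close>.\<close>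

lemma nn_integral_overlap_le:
  assumes W: "W \<in> sets \<mu>" "emeasure \<mu> W = ennreal T" "T \<ge> 1"
    and F1: "\<And>Y. F Y \<le> 1" and F0: "\<And>Y. Y \<subseteq> space \<mu> \<Longrightarrow> \<not> Y \<subseteq> W \<Longrightarrow> F Y = 0"
  shows "(\<integral>\<^sup>+\<omega>. overlap n n F F \<omega> \<partial>M) \<le> ennreal (4 ^ (2 * n - 2) * fact (2 * n - 2) * exp 2 * T ^ (2 * n - 2))"
proof -
  define q where "q = 2 * n - 2"
  have T0: "T \<ge> 0" "T > 0" using W(3) by auto
  define f where "f x = 4 ^ q * ennreal (enn2real x ^ q)" for x
  have fm: "f \<in> borel_measurable borel" unfolding f_def by measurable
  have f: "f (of_nat k) = ennreal (4 ^ q * real k ^ q)" for k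
  proof -
    have "(4::ennreal) ^ q = ennreal (4 ^ q)" by (simp add: ennreal_power[symmetric])
    then show ?thesis by (simp add: f_def ennreal_mult' enn2real_of_nat)
  qed
  have "(\<integral>\<^sup>+\<omega>. overlap n n F F \<omega> \<partial>M) \<le> (\<integral>\<^sup>+\<omega>. f (point_count X W \<omega>) \<partial>M)"
  proof (rule nn_integral_mono_AE)
    show "AE \<omega> in M. overlap n n F F \<omega> \<le> f (point_count X W \<omega>)"
      using point_count_law(1)[OF W(1,2) T0(1)] AE_space
    proof eventually_elim
      case (elim \<omega>)
      then obtain k where k: "point_count X W \<omega> = of_nat k" by blast
      have "overlap n n F F \<omega> \<le> of_nat (4 ^ q * k ^ q)"
        unfolding q_def by (rule overlap_le[OF F1 F0 elim(2) k])
      also have "\<dots> = f (of_nat k)" by (subst f) (simp add: ennreal_of_nat_eq_real_of_nat)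
      finally show ?case using k by simp
    qed
  qed
  also have "\<dots> = (\<Sum>k. f (of_nat k) * ennreal (exp (- T) * T ^ k / fact k))"
    by (rule nn_integral_point_count_fun[OF W(1,2) T0(1) fm])
  also have "\<dots> \<le> (\<Sum>k. ennreal (4 ^ q * fact q * T ^ q * exp (- T) * ((T * exp (1 / T)) ^ k /\<^sub>R fact k)))"
  proof (intro suminf_le summableI)
    fix k
    have "real k ^ q = T ^ q * (real k / T) ^ q" using T0 by (simp add: power_divide)
    also have "\<dots> \<le> T ^ q * (fact q * exp (real k / T))"
      using T0 by (intro mult_left_mono power_le_fact_exp) auto
    also have "exp (real k / T) = exp (1 / T) ^ k" by (simp add: exp_of_nat_mult[symmetric])
    finally have "(4 ^ q * real k ^ q) * (exp (- T) * T ^ k / fact k)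
        \<le> (4 ^ q * (T ^ q * (fact q * exp (1 / T) ^ k))) * (exp (- T) * T ^ k / fact k)"
      using T0 by (intro mult_right_mono mult_left_mono) auto
    also have "\<dots> = 4 ^ q * fact q * T ^ q * exp (- T) * ((T * exp (1 / T)) ^ k /\<^sub>R fact k)"
      by (simp add: power_mult_distrib field_simps)
    finally show "f (of_nat k) * ennreal (exp (- T) * T ^ k / fact k)
        \<le> ennreal (4 ^ q * fact q * T ^ q * exp (- T) * ((T * exp (1 / T)) ^ k /\<^sub>R fact k))"
      unfolding f using T0 by (subst ennreal_mult[symmetric]) (auto intro!: ennreal_leI)
  qed
  also have "\<dots> = ennreal (4 ^ q * fact q * T ^ q * exp (- T) * exp (T * exp (1 / T)))"
  proof -
    have s: "(\<lambda>k. 4 ^ q * fact q * T ^ q * exp (- T) * ((T * exp (1 / T)) ^ k /\<^sub>R fact k)) sums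
      (4 ^ q * fact q * T ^ q * exp (- T) * exp (T * exp (1 / T)))"
      by (intro sums_mult exp_converges)
    then show ?thesis using T0 by (subst suminf_ennreal2) (auto simp: sums_iff)
  qed
  also have "\<dots> \<le> ennreal (4 ^ q * fact q * exp 2 * T ^ q)"
  proof (rule ennreal_leI)
    have "T * exp (1 / T) \<le> T * (1 + 1 / T + (1 / T)\<^sup>2)"
      using T0 W(3) by (intro mult_left_mono exp_bound) auto
    also have "\<dots> = T + 1 + 1 / T" using T0 by (simp add: field_simps power2_eq_square)
    also have "\<dots> \<le> T + 2" using W(3) by simp
    finally have "exp (- T) * exp (T * exp (1 / T)) \<le> exp 2" by (simp add: exp_add[symmetric])
    then have "(4 ^ q * fact q * T ^ q) * (exp (- T) * exp (T * exp (1 / T))) \<le> (4 ^ q * fact q * T ^ q) * exp 2"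
      using T0 by (intro mult_left_mono) auto
    then show "4 ^ q * fact q * T ^ q * exp (- T) * exp (T * exp (1 / T)) \<le> 4 ^ q * fact q * exp 2 * T ^ q"
      by (simp add: mult_ac)
  qed
  finally show ?thesis by (simp add: q_def)
qed

section \<open>Linear statistics and their characteristic function\<close>

definition lin :: "(real \<times> 'c \<Rightarrow> real) \<Rightarrow> 'w \<Rightarrow> ennreal" where
  "lin g \<omega> = (\<Sum>i. ennreal (g (X i \<omega>)))"

lemma lin_measurable[measurable]:
  assumes "g \<in> borel_measurable \<mu>"
  shows "lin g \<in> borel_measurable M"
proof -
  have [measurable]: "(\<lambda>\<omega>. g (X i \<omega>)) \<in> borel_measurable M" for i
    by (rule measurable_compose[OF X_measurable assms])
  show ?thesis unfolding lin_def[abs_def] by measurable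
qed

lemma lin_eq_sum:
  assumes g0: "\<And>x. g x \<ge> 0" "\<And>x. x \<in> space \<mu> \<Longrightarrow> x \<notin> W \<Longrightarrow> g x = 0"
    and \<omega>: "\<omega> \<in> space M" and k: "point_count X W \<omega> = of_nat k"
  shows "lin g \<omega> = ennreal (\<Sum>i\<in>{i. X i \<omega> \<in> W}. g (X i \<omega>))"
proof -
  have X: "X i \<omega> \<in> space \<mu>" for i using measurable_space[OF X_measurable \<omega>] .
  have "lin g \<omega> = (\<Sum>i\<in>{i. X i \<omega> \<in> W}. ennreal (g (X i \<omega>)))"
    unfolding lin_def using X g0 by (intro suminf_finite finite_window(1)[OF k]) auto
  then show ?thesis using g0 by (simp add: sum_ennreal)
qed

definition cnt :: "(real \<times> 'c) set \<Rightarrow> 'w \<Rightarrow> real" where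
  "cnt B \<omega> = enn2real (point_count X B \<omega>)"

lemma cnt_measurable[measurable]: "B \<in> sets \<mu> \<Longrightarrow> cnt B \<in> borel_measurable M"
  unfolding cnt_def[abs_def] by (rule measurable_compose[OF point_count_measurable]) auto

lemma char_cnt:
  assumes B[measurable]: "B \<in> sets \<mu>" and t: "emeasure \<mu> B = ennreal t" "t \<ge> 0"
  shows "(CLINT \<omega>|M. iexp (u * cnt B \<omega>)) = exp (complex_of_real t * (iexp u - 1))"
proof -
  define p where "p n = exp (- t) * t ^ n / fact n" for n
  define nc where "nc \<omega> = nat \<lfloor>cnt B \<omega>\<rfloor>" for \<omega>
  have nc[measurable]: "nc \<in> M \<rightarrow>\<^sub>M count_space UNIV" unfolding nc_def by measurable
  have AEn: "AE \<omega> in M. cnt B \<omega> = real (nc \<omega>) \<and> point_count X B \<omega> = of_nat (nc \<omega>)"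
    using point_count_law(1)[OF B t] by eventually_elim (auto simp: cnt_def nc_def enn2real_of_nat)
  define D where "D = distr M (count_space UNIV) nc"
  have D: "D = density (count_space UNIV) (\<lambda>n. ennreal (p n))"
  proof (rule measure_eqI_countable)
    fix n :: nat assume "n \<in> UNIV"
    have "emeasure D {n} = emeasure M {\<omega>\<in>space M. nc \<omega> = n}"
      unfolding D_def by (subst emeasure_distr) (auto intro!: arg_cong2[where f = emeasure])
    also have "\<dots> = emeasure M {\<omega>\<in>space M. point_count X B \<omega> = of_nat n}"
      by (rule emeasure_eq_AE) (use AEn in \<open>eventually_elim, auto\<close>)
    also have "\<dots> = ennreal (p n)" using point_count_law(2)[OF B t, of n] by (simp add: emeasure_eq_measure p_def)
    also have "\<dots> = emeasure (density (count_space UNIV) (\<lambda>n. ennreal (p n))) {n}"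
      using nn_integral_count_space_subset[of "{n}" UNIV "\<lambda>n. ennreal (p n)"]
      by (simp add: emeasure_density nn_integral_count_space_finite)
    finally show "emeasure D {n} = emeasure (density (count_space UNIV) (\<lambda>n. ennreal (p n))) {n}" .
  qed (auto simp: D_def)
  have p0: "p n \<ge> 0" for n using t by (simp add: p_def)
  have h: "p n *\<^sub>R iexp (u * real n) = complex_of_real (exp (- t)) * ((complex_of_real t * iexp u) ^ n /\<^sub>R fact n)" for n
    by (simp add: p_def scaleR_conv_of_real power_mult_distrib exp_of_nat_mult[symmetric] field_simps)
  have s: "(\<lambda>n. p n *\<^sub>R iexp (u * real n)) sums (complex_of_real (exp (- t)) * exp (complex_of_real t * iexp u))"
    unfolding h by (intro sums_mult exp_converges)
  have "(\<lambda>n. exp (- t) * (t ^ n /\<^sub>R fact n)) sums (exp (- t) * exp t)"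
    by (intro sums_mult exp_converges)
  then have "summable p" unfolding p_def by (simp add: sums_iff divide_inverse mult_ac)
  then have int: "integrable (count_space UNIV) (\<lambda>n. p n *\<^sub>R iexp (u * real n))"
    using p0 by (subst integrable_count_space_nat_iff) simp
  have "(CLINT \<omega>|M. iexp (u * cnt B \<omega>)) = (CLINT \<omega>|M. iexp (u * real (nc \<omega>)))"
    by (rule integral_cong_AE) (use AEn in \<open>measurable, eventually_elim, simp\<close>)
  also have "\<dots> = (CLINT n|D. iexp (u * real n))"
    unfolding D_def by (rule integral_distr[symmetric]) auto
  also have "\<dots> = (CLINT n|count_space UNIV. p n *\<^sub>R iexp (u * real n))"
    unfolding D by (rule integral_density) (auto simp: p0)
  also have "\<dots> = complex_of_real (exp (- t)) * exp (complex_of_real t * iexp u)"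
    using s integral_count_space_nat[OF int] by (simp add: sums_iff)
  also have "\<dots> = exp (complex_of_real t * (iexp u - 1))"
  proof -
    have "complex_of_real (exp (- t)) = exp (- complex_of_real t)" by (simp add: exp_of_real[symmetric])
    then show ?thesis by (simp only: mult_exp_exp) (simp add: right_diff_distrib)
  qed
  finally show ?thesis .
qed

lemma indep_cnt:
  assumes "\<And>j. j < m \<Longrightarrow> B j \<in> sets \<mu>" "disjoint_family_on B {..<m}"
  shows "indep_vars (\<lambda>_. borel) (\<lambda>j \<omega>. c j * cnt (B j) \<omega>) {..<m::nat}"
proof -
  have "indep_vars (\<lambda>_. borel) (\<lambda>j. point_count X (B j)) {..<m}"
    using poisson assms by (simp add: poisson_process_def \<mu>_def)
  then show ?thesis
    unfolding cnt_def by (rule indep_vars_compose2[where Y = "\<lambda>j x. c j * enn2real x"]) auto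
qed

text \<open>The linear statistic of a step function is a weighted sum of counts of disjoint sets: by
  independence the Poisson characteristic functions multiply, so the exponents add.\<close>

lemma char_step:
  assumes B: "\<And>j. j < m \<Longrightarrow> B j \<in> sets \<mu>" "disjoint_family_on B {..<m::nat}"
    and t: "\<And>j. j < m \<Longrightarrow> emeasure \<mu> (B j) = ennreal (t j)" "\<And>j. t j \<ge> 0"
  shows "(CLINT \<omega>|M. iexp (u * (\<Sum>j<m. c j * cnt (B j) \<omega>))) = exp (\<Sum>j<m. complex_of_real (t j) * (iexp (u * c j) - 1))"
proof -
  have [measurable]: "(\<lambda>\<omega>. c j * cnt (B j) \<omega>) \<in> borel_measurable M" if "j < m" for j
    using B(1)[OF that] by measurable
  have Sm[measurable]: "(\<lambda>\<omega>. \<Sum>j<m. c j * cnt (B j) \<omega>) \<in> borel_measurable M"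
    by (intro borel_measurable_sum) auto
  have ch: "char (distr M borel Y) u = (CLINT \<omega>|M. iexp (u * Y \<omega>))" if "Y \<in> borel_measurable M" for Y :: "'w \<Rightarrow> real"
    unfolding char_def using that by (subst integral_distr) auto
  have "(CLINT \<omega>|M. iexp (u * (\<Sum>j<m. c j * cnt (B j) \<omega>))) = char (distr M borel (\<lambda>\<omega>. \<Sum>j<m. c j * cnt (B j) \<omega>)) u"
    by (rule ch[symmetric]) measurable
  also have "\<dots> = (\<Prod>j<m. char (distr M borel (\<lambda>\<omega>. c j * cnt (B j) \<omega>)) u)"
    by (rule char_distr_sum[OF indep_cnt[OF B]])
  also have "\<dots> = (\<Prod>j<m. exp (complex_of_real (t j) * (iexp (u * c j) - 1)))"
  proof (rule prod.cong)
    fix j assume "j \<in> {..<m}"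
    then have j: "j < m" by simp
    show "char (distr M borel (\<lambda>\<omega>. c j * cnt (B j) \<omega>)) u = exp (complex_of_real (t j) * (iexp (u * c j) - 1))"
    proof -
      have "char (distr M borel (\<lambda>\<omega>. c j * cnt (B j) \<omega>)) u = (CLINT \<omega>|M. iexp (u * (c j * cnt (B j) \<omega>)))"
        using j by (intro ch) measurable
      also have "\<dots> = (CLINT \<omega>|M. iexp ((u * c j) * cnt (B j) \<omega>))" by (simp only: mult.assoc)
      also note char_cnt[OF B(1)[OF j] t(1)[OF j] t(2), of "u * c j"]
      finally show ?thesis .
    qed
  qed simp
  also have "\<dots> = exp (\<Sum>j<m. complex_of_real (t j) * (iexp (u * c j) - 1))"
    by (rule exp_sum[symmetric]) simp
  finally show ?thesis .
qed

end

lemma integral_norm_le_AE: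
  fixes f :: "'a \<Rightarrow> 'b::{banach, second_countable_topology}"
  assumes "integrable M f" "integrable M g" "AE x in M. norm (f x) \<le> g x"
  shows "norm (\<integral>x. f x \<partial>M) \<le> (\<integral>x. g x \<partial>M)"
  by (rule order_trans[OF integral_norm_bound integral_mono_AE]) (use assms in auto)

lemma square_expansion:
  fixes U L m g :: real
  shows "((U - m) - (L - g))\<^sup>2 = U * U + L * L + (g - m)\<^sup>2 - 2 * (U * L) + 2 * (g - m) * U - 2 * (g - m) * L"
  by (simp add: power2_eq_square algebra_simps)

text \<open>\<open>m\<close> and \<open>g\<close> are the means of the U-statistic and of the linear
  statistic, \<open>v\<close> is the variance of the latter and also the covariance of the two,
  \<open>q\<close> is the mean overlap.\<close>

lemma second_moment_cancel:
  fixes m g v q :: real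
  shows "(m * m + v + q) + (g * g + v) + (g - m)\<^sup>2 - 2 * (m * g + v) + 2 * (g - m) * m - 2 * (g - m) * g = q"
  by (simp add: power2_eq_square algebra_simps)

context marked_poisson
begin

text \<open>\<open>g\<close> is rounded down to multiples of \<open>1 / K\<close>. The formula is
  known for the resulting step function, and on both sides rounding costs at most
  \<open>\<bar>u\<bar> * T / K\<close>: on the left because the window contains \<open>T\<close>
  points on average, on the right because it has measure \<open>T\<close>.\<close>

lemma char_lin:
  assumes g: "g \<in> borel_measurable \<mu>" "\<And>x. 0 \<le> g x" "\<And>x. g x \<le> C"
    and g0: "\<And>x. x \<in> space \<mu> \<Longrightarrow> x \<notin> W \<Longrightarrow> g x = 0"
    and W: "W \<in> sets \<mu>" "emeasure \<mu> W = ennreal T" "T \<ge> 0"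
  shows "(CLINT \<omega>|M. iexp (u * enn2real (lin g \<omega>))) = exp (CLINT x|\<mu>. iexp (u * g x) - 1)"
    (is "?A = exp ?a")
proof -
  note g(1)[measurable] W(1)[measurable]
  have L_m[measurable]: "(\<lambda>\<omega>. enn2real (lin g \<omega>)) \<in> borel_measurable M" by measurable
  have int_ind: "integrable \<mu> (\<lambda>x. c * indicator W x)" for c :: real
    using W by (intro integrable_mult_right integrable_real_indicator) auto
  have int_bd: "integrable \<mu> h" if "h \<in> borel_measurable \<mu>" "\<And>x. x \<in> space \<mu> \<Longrightarrow> cmod (h x) \<le> c * indicator W x" for h :: "real \<times> 'c \<Rightarrow> complex" and c
    by (rule Bochner_Integration.integrable_bound[OF int_ind[of c]]) (use that in \<open>auto intro!: AE_I2 order_trans[OF _ abs_ge_self]\<close>)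
  have cntW: "integrable M (cnt W)" "(\<integral>\<omega>. cnt W \<omega> \<partial>M) = T"
  proof -
    have "(\<integral>\<^sup>+\<omega>. ennreal (cnt W \<omega>) \<partial>M) = (\<integral>\<^sup>+\<omega>. point_count X W \<omega> \<partial>M)"
      by (rule nn_integral_cong_AE, use point_count_law(1)[OF W] in eventually_elim)
        (auto simp: cnt_def enn2real_of_nat ennreal_of_nat_eq_real_of_nat)
    then have *: "(\<integral>\<^sup>+\<omega>. ennreal (cnt W \<omega>) \<partial>M) = ennreal T" by (simp add: nn_integral_point_count W)
    have c0: "cnt W \<omega> \<ge> 0" for \<omega> by (simp add: cnt_def)
    show "integrable M (cnt W)" using * c0 by (intro integrableI_nn_integral_finite[where x = T]) auto
    show "(\<integral>\<omega>. cnt W \<omega> \<partial>M) = T" using * c0 W by (subst integral_eq_nn_integral) auto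
  qed
  \<comment> \<open>The exponent of the step approximation with \<open>K = Suc k\<close>; only the
    two estimates matter later, so it is chosen abstractly.\<close>
  define A where "A k = (SOME a. cmod (?A - exp a) \<le> \<bar>u\<bar> * T / real (Suc k) \<and> cmod (?a - a) \<le> \<bar>u\<bar> * T / real (Suc k))" for k
  have ex: "\<exists>a. cmod (?A - exp a) \<le> \<bar>u\<bar> * T / real (Suc k) \<and> cmod (?a - a) \<le> \<bar>u\<bar> * T / real (Suc k)" for k
  proof -
    define K where "K = real (Suc k)"
    have K: "K > 0" by (simp add: K_def)
    \<comment> \<open>Enough levels: \<open>g x \<le> C\<close> bounds
      \<open>\<lfloor>K * g x\<rfloor>\<close> by \<open>\<lceil>C * K\<rceil>\<close>.\<close>
    define m where "m = nat \<lceil>C * K\<rceil> + 1"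
    define B where "B j = {x \<in> space \<mu>. x \<in> W \<and> \<lfloor>K * g x\<rfloor> = int j}" for j
    define c where "c j = real j / K" for j
    define t where "t j = enn2real (emeasure \<mu> (B j))" for j
    define s where "s x = (\<Sum>j<m. c j * indicator (B j) x)" for x
    have B[measurable]: "B j \<in> sets \<mu>" for j unfolding B_def by measurable
    have BW: "B j \<subseteq> W" for j by (auto simp: B_def)
    have disj: "disjoint_family_on B {..<m}" by (auto simp: disjoint_family_on_def B_def)
    have t: "emeasure \<mu> (B j) = ennreal (t j)" "t j \<ge> 0" for j
    proof -
      have "emeasure \<mu> (B j) \<le> ennreal T" using emeasure_mono[OF BW W(1), of j] W by simp
      then have "emeasure \<mu> (B j) < top" by (rule order_le_less_trans) simp
      then show "emeasure \<mu> (B j) = ennreal (t j)" by (simp add: t_def)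
    qed (simp add: t_def)
    \<comment> \<open>Each point of the window lies in exactly one level set, so the sum selects one
      value; both \<open>s x\<close> and \<open>iexp (u * s x) - 1\<close> are read off in this
      way.\<close>
    have sel: "(\<Sum>j<m. h j * indicator (B j) x) = h (nat \<lfloor>K * g x\<rfloor>)" if "x \<in> space \<mu>" "x \<in> W" for x and h :: "nat \<Rightarrow> 'z::real_normed_field"
    proof -
      define j0 where "j0 = nat \<lfloor>K * g x\<rfloor>"
      have nn: "0 \<le> \<lfloor>K * g x\<rfloor>" using K g(2)[of x] by simp
      have "K * g x \<le> C * K" using g(3)[of x] K by (simp add: mult.commute)
      then have "\<lfloor>K * g x\<rfloor> \<le> \<lceil>C * K\<rceil>" by linarith
      then have "j0 < m" using nn by (simp add: m_def j0_def)
      have "h j * indicator (B j) x = (if j = j0 then h j0 else 0)" for j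
        using that nn by (auto simp: B_def j0_def indicator_def)
      then show ?thesis using \<open>j0 < m\<close> by (simp add: j0_def sum.delta)
    qed
    have s_out: "indicator (B j) x = (0::'z::real_normed_field)" if "x \<notin> W" for x j using that BW by (auto simp: indicator_def)
    have s0: "s x = 0" if "x \<notin> W" for x using that by (simp add: s_def s_out)
    have sW: "\<bar>g x - s x\<bar> \<le> 1 / K" if "x \<in> space \<mu>" "x \<in> W" for x
    proof -
      have "s x = real_of_int \<lfloor>K * g x\<rfloor> / K" unfolding s_def using sel[OF that, of c] K g(2)[of x] by (simp add: c_def)
      moreover have "\<bar>K * g x - real_of_int \<lfloor>K * g x\<rfloor>\<bar> \<le> 1" by linarith
      moreover have "g x - real_of_int \<lfloor>K * g x\<rfloor> / K = (K * g x - real_of_int \<lfloor>K * g x\<rfloor>) / K" using K by (simp add: field_simps)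
      ultimately show ?thesis using K by (simp add: divide_right_mono)
    qed
    have gs: "\<bar>g x - s x\<bar> \<le> 1 / K * indicator W x" if "x \<in> space \<mu>" for x
      using sW[OF that] g0[OF that] s0[of x] by (cases "x \<in> W") auto
    have s_m[measurable]: "s \<in> borel_measurable \<mu>" unfolding s_def[abs_def] by measurable
    define S where "S \<omega> = (\<Sum>j<m. c j * cnt (B j) \<omega>)" for \<omega>
    have S_m[measurable]: "S \<in> borel_measurable M" unfolding S_def[abs_def] by measurable
    \<comment> \<open>Each point of the window contributes a rounding error of at most
      \<open>1 / K\<close>.\<close>
    have diff: "AE \<omega> in M. \<bar>enn2real (lin g \<omega>) - S \<omega>\<bar> \<le> cnt W \<omega> / K"
      using point_count_law(1)[OF W] AE_space
    proof eventually_elim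
      case (elim \<omega>)
      then obtain n where n: "point_count X W \<omega> = of_nat n" by blast
      let ?I = "{i. X i \<omega> \<in> W}"
      note I = finite_window[OF n]
      have X: "X i \<omega> \<in> space \<mu>" for i using measurable_space[OF X_measurable elim(2)] .
      have L: "enn2real (lin g \<omega>) = (\<Sum>i\<in>?I. g (X i \<omega>))"
        using lin_eq_sum[of g W \<omega> n] g g0 elim(2) n by (simp add: sum_nonneg)
      have "cnt (B j) \<omega> = (\<Sum>i\<in>?I. indicator (B j) (X i \<omega>))" for j
      proof -
        have "point_count X (B j) \<omega> = (\<Sum>i\<in>?I. indicator (B j) (X i \<omega>))"
          unfolding point_count_def using BW by (intro suminf_finite I) (auto simp: indicator_def)
        also have "\<dots> = ennreal (\<Sum>i\<in>?I. indicator (B j) (X i \<omega>))"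
          by (subst sum_ennreal[symmetric]) (auto simp: ennreal_indicator)
        finally show ?thesis by (simp add: cnt_def sum_nonneg)
      qed
      then have "S \<omega> = (\<Sum>j<m. \<Sum>i\<in>?I. c j * indicator (B j) (X i \<omega>))" by (simp add: S_def sum_distrib_left)
      also have "\<dots> = (\<Sum>i\<in>?I. s (X i \<omega>))" unfolding s_def by (rule sum.swap)
      finally have "enn2real (lin g \<omega>) - S \<omega> = (\<Sum>i\<in>?I. g (X i \<omega>) - s (X i \<omega>))" by (simp add: L sum_subtractf)
      also have "\<bar>\<dots>\<bar> \<le> (\<Sum>i\<in>?I. \<bar>g (X i \<omega>) - s (X i \<omega>)\<bar>)" by (rule sum_abs)
      also have "\<dots> \<le> (\<Sum>i\<in>?I. 1 / K)" using sW X by (intro sum_mono) auto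
      also have "\<dots> = cnt W \<omega> / K" using I n by (simp add: cnt_def enn2real_of_nat)
      finally show ?case .
    qed
    let ?b = "\<Sum>j<m. complex_of_real (t j) * (iexp (u * c j) - 1)"
    have 1: "cmod (?A - exp ?b) \<le> \<bar>u\<bar> * T / K"
    proof -
      have "exp ?b = (CLINT \<omega>|M. iexp (u * S \<omega>))"
        unfolding S_def by (rule char_step[symmetric]) (use B disj t in auto)
      then have "?A - exp ?b = (CLINT \<omega>|M. iexp (u * enn2real (lin g \<omega>)) - iexp (u * S \<omega>))"
        by (subst Bochner_Integration.integral_diff) (auto intro!: integrable_iexp)
      also have "cmod \<dots> \<le> (\<integral>\<omega>. \<bar>u\<bar> * (cnt W \<omega> / K) \<partial>M)"
      proof (rule integral_norm_le_AE)
        show "integrable M (\<lambda>\<omega>. \<bar>u\<bar> * (cnt W \<omega> / K))" using cntW by simp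
        show "integrable M (\<lambda>\<omega>. iexp (u * enn2real (lin g \<omega>)) - iexp (u * S \<omega>))"
          by (auto intro!: integrable_iexp Bochner_Integration.integrable_diff)
        show "AE \<omega> in M. cmod (iexp (u * enn2real (lin g \<omega>)) - iexp (u * S \<omega>)) \<le> \<bar>u\<bar> * (cnt W \<omega> / K)"
          using diff
        proof eventually_elim
          case (elim \<omega>)
          have "cmod (iexp (u * enn2real (lin g \<omega>)) - iexp (u * S \<omega>)) \<le> \<bar>u\<bar> * \<bar>enn2real (lin g \<omega>) - S \<omega>\<bar>"
            using norm_iexp_diff[of "u * enn2real (lin g \<omega>)" "u * S \<omega>"] by (simp add: right_diff_distrib[symmetric] abs_mult)
          also have "\<dots> \<le> \<bar>u\<bar> * (cnt W \<omega> / K)" using elim by (intro mult_left_mono) auto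
          finally show ?case .
        qed
      qed
      also have "\<dots> = \<bar>u\<bar> * T / K" using cntW by simp
      finally show ?thesis .
    qed
    have 2: "cmod (?a - ?b) \<le> \<bar>u\<bar> * T / K"
    proof -
      have int1: "integrable \<mu> (\<lambda>x. iexp (u * g x) - 1)"
      proof (rule int_bd[of _ "\<bar>u\<bar> * C"])
        fix x assume x: "x \<in> space \<mu>"
        have "cmod (iexp (u * g x) - 1) \<le> \<bar>u\<bar> * g x"
          using norm_iexp_diff[of "u * g x" 0] g(2)[of x] by (simp add: abs_mult)
        also have "\<dots> \<le> \<bar>u\<bar> * C * indicator W x"
          using g(3)[of x] g0[OF x] by (cases "x \<in> W") (auto intro!: mult_left_mono)
        finally show "cmod (iexp (u * g x) - 1) \<le> \<bar>u\<bar> * C * indicator W x" .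
      qed measurable
      have ieq: "iexp (u * s x) - 1 = (\<Sum>j<m. (iexp (u * c j) - 1) * indicator (B j) x)" if "x \<in> space \<mu>" for x
      proof (cases "x \<in> W")
        case True
        show ?thesis using sel[OF that True, of "\<lambda>j. iexp (u * c j) - 1"] sel[OF that True, of c]
          by (simp add: s_def)
      qed (simp add: s0 s_out)
      have int2: "integrable \<mu> (\<lambda>x. iexp (u * s x) - 1)"
      proof (rule int_bd[of _ 2])
        fix x assume x: "x \<in> space \<mu>"
        have "cmod (iexp (u * s x) - 1) \<le> 2" using norm_triangle_ineq4[of "iexp (u * s x)" 1] by simp
        then show "cmod (iexp (u * s x) - 1) \<le> 2 * indicator W x" using s0[of x] by (cases "x \<in> W") auto
      qed measurable
      have int_indB: "integrable \<mu> (\<lambda>x. indicator (B j) x :: complex)" for j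
        by (rule int_bd[of _ 1]) (use BW[of j] in \<open>auto simp: indicator_def\<close>)
      have "(CLINT x|\<mu>. iexp (u * s x) - 1) = (CLINT x|\<mu>. (\<Sum>j<m. (iexp (u * c j) - 1) * indicator (B j) x))"
        by (rule Bochner_Integration.integral_cong[OF refl ieq])
      also have "\<dots> = (\<Sum>j<m. (CLINT x|\<mu>. (iexp (u * c j) - 1) * indicator (B j) x))"
        by (rule Bochner_Integration.integral_sum) (intro integrable_mult_right int_indB)
      also have "\<dots> = ?b"
      proof (rule sum.cong)
        fix j
        have "(CLINT x|\<mu>. indicator (B j) x) = complex_of_real (t j)"
        proof -
          have "(CLINT x|\<mu>. indicator (B j) x) = (CLINT x|\<mu>. complex_of_real (indicator (B j) x))"
            by (intro Bochner_Integration.integral_cong) (auto simp: indicator_def)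
          also have "\<dots> = complex_of_real (\<integral>x. indicator (B j) x \<partial>\<mu>)"
            by (rule integral_complex_of_real)
          also have "(\<integral>x. indicator (B j) x \<partial>\<mu>) = t j"
            using t[of j] sets.sets_into_space[OF B[of j]] by (simp add: measure_def Int_absorb2)
          finally show ?thesis .
        qed
        then show "(CLINT x|\<mu>. (iexp (u * c j) - 1) * indicator (B j) x) = complex_of_real (t j) * (iexp (u * c j) - 1)"
          by (simp add: mult.commute)
      qed simp
      finally have "?a - ?b = (CLINT x|\<mu>. (iexp (u * g x) - 1) - (iexp (u * s x) - 1))"
        using int1 int2 by (subst Bochner_Integration.integral_diff) auto
      also have "cmod \<dots> \<le> (\<integral>x. \<bar>u\<bar> * (1 / K) * indicator W x \<partial>\<mu>)"
      proof (rule integral_norm_le_AE)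
        show "AE x in \<mu>. cmod ((iexp (u * g x) - 1) - (iexp (u * s x) - 1)) \<le> \<bar>u\<bar> * (1 / K) * indicator W x"
        proof (rule AE_I2)
          fix x assume x: "x \<in> space \<mu>"
          have "cmod ((iexp (u * g x) - 1) - (iexp (u * s x) - 1)) \<le> \<bar>u\<bar> * \<bar>g x - s x\<bar>"
            using norm_iexp_diff[of "u * g x" "u * s x"] by (simp add: right_diff_distrib[symmetric] abs_mult)
          also have "\<dots> \<le> \<bar>u\<bar> * (1 / K * indicator W x)" using gs[OF x] by (intro mult_left_mono) auto
          finally show "cmod ((iexp (u * g x) - 1) - (iexp (u * s x) - 1)) \<le> \<bar>u\<bar> * (1 / K) * indicator W x" by simp
        qed
      qed (rule Bochner_Integration.integrable_diff[OF int1 int2], rule int_ind)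
      also have "\<dots> = \<bar>u\<bar> * T / K"
        using W sets.sets_into_space[OF W(1)] by (simp add: measure_def Int_absorb2)
      finally show ?thesis .
    qed
    from 1 2 show ?thesis unfolding K_def by blast
  qed
  have A: "cmod (?A - exp (A k)) \<le> \<bar>u\<bar> * T / real (Suc k)" "cmod (?a - A k) \<le> \<bar>u\<bar> * T / real (Suc k)" for k
    using someI_ex[OF ex[of k]] unfolding A_def by blast+
  have lim: "(\<lambda>k. \<bar>u\<bar> * T / real (Suc k)) \<longlonglongrightarrow> 0" by (intro LIMSEQ_Suc[OF lim_const_over_n])
  have "(\<lambda>k. exp (A k) - ?A) \<longlonglongrightarrow> 0"
    by (rule Lim_null_comparison[OF _ lim]) (use A(1) in \<open>auto simp: norm_minus_commute\<close>)
  then have 1: "(\<lambda>k. exp (A k)) \<longlonglongrightarrow> ?A" by (simp add: LIM_zero_iff)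
  have "(\<lambda>k. A k - ?a) \<longlonglongrightarrow> 0"
    by (rule Lim_null_comparison[OF _ lim]) (use A(2) in \<open>auto simp: norm_minus_commute\<close>)
  then have "A \<longlonglongrightarrow> ?a" by (simp add: LIM_zero_iff)
  then have "(\<lambda>k. exp (A k)) \<longlonglongrightarrow> exp ?a" by (rule tendsto_exp)
  with 1 show ?thesis by (rule LIMSEQ_unique)
qed

section \<open>Second moment of the difference to the linear statistic\<close>

definition lin_kernel :: "(real \<times> 'c \<Rightarrow> real) \<Rightarrow> (real \<times> 'c) set \<Rightarrow> ennreal" where
  "lin_kernel g Y = (SUP y\<in>Y. ennreal (g y))"

lemma kernel_lin_kernel:
  assumes g: "g \<in> borel_measurable \<mu>"
  shows "kernel (lin_kernel g)"
  unfolding kernel_def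
proof (intro allI impI)
  fix I :: "nat set" assume I: "finite I"
  have "(\<lambda>x. ennreal (g (x i))) \<in> borel_measurable (Pi\<^sub>M I (\<lambda>_. \<mu>))" if "i \<in> I" for i
    by (rule measurable_compose[OF measurable_component_mu[OF g that] measurable_ennreal])
  then have "(\<lambda>x. SUP i\<in>I. ennreal (g (x i))) \<in> borel_measurable (Pi\<^sub>M I (\<lambda>_. \<mu>))"
    by (rule borel_measurable_SUP[OF countable_finite[OF I]])
  then show "(\<lambda>x. lin_kernel g (x ` I)) \<in> borel_measurable (Pi\<^sub>M I (\<lambda>_. \<mu>))"
    by (simp add: lin_kernel_def image_image)
qed

text \<open>The supremum in \<open>lin_kernel\<close> turns \<open>g\<close> into a function of
  sets; on singletons it returns \<open>g\<close>. As a U-statistic of order one, the linear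
  statistic falls under the product formula.\<close>

lemma lin_eq_ustat: "lin g \<omega> = ustat (Suc 0) (lin_kernel g) \<omega>"
proof -
  have "bij_betw (\<lambda>i. {i}) UNIV (idx (Suc 0))"
    by (auto simp: bij_betw_def inj_on_def idx_def card_Suc_eq image_iff)
  from nn_integral_bij_count_space[OF this, of "\<lambda>S. lin_kernel g (pts \<omega> S)"]
  show ?thesis by (simp add: ustat_def lin_def pts_def lin_kernel_def nn_integral_count_space_nat)
qed

text \<open>A singleton shares at most one element with another set; hence products with the linear
  statistic leave no remainder.\<close>

lemma overlap_one: "overlap n (Suc 0) F F' \<omega> = 0"
proof -
  have "{z \<in> idx n \<times> idx (Suc 0). 2 \<le> card (fst z \<inter> snd z)} = {}"
  proof -
    have "card (S \<inter> S') \<le> 1" if "finite S'" "card S' = Suc 0" for S S' :: "nat set"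
      using card_mono[OF that(1), of "S \<inter> S'"] that by simp
    then have "\<not> 2 \<le> card (fst z \<inter> snd z)" if "snd z \<in> idx (Suc 0)" for z :: "nat set \<times> nat set"
      using that by (simp add: idx_def not_le less_Suc_eq_le numeral_2_eq_2)
    then show ?thesis by auto
  qed
  then show ?thesis unfolding overlap_def by (simp add: nn_integral_empty)
qed

lemma enn2real_moment:
  assumes "Z \<in> borel_measurable M" "(\<integral>\<^sup>+\<omega>. Z \<omega> \<partial>M) = ennreal c" "c \<ge> 0"
  shows "integrable M (\<lambda>\<omega>. enn2real (Z \<omega>))" "(\<integral>\<omega>. enn2real (Z \<omega>) \<partial>M) = c"
proof -
  have "AE \<omega> in M. Z \<omega> \<noteq> \<infinity>" using assms by (intro nn_integral_PInf_AE) auto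
  then have "(\<integral>\<^sup>+\<omega>. ennreal (enn2real (Z \<omega>)) \<partial>M) = (\<integral>\<^sup>+\<omega>. Z \<omega> \<partial>M)"
    by (intro nn_integral_cong_AE) (auto elim!: eventually_mono simp: less_top)
  then have *: "(\<integral>\<^sup>+\<omega>. ennreal (enn2real (Z \<omega>)) \<partial>M) = ennreal c" using assms by simp
  then show "integrable M (\<lambda>\<omega>. enn2real (Z \<omega>))"
    using assms by (intro integrableI_nn_integral_finite[where x = c]) auto
  show "(\<integral>\<omega>. enn2real (Z \<omega>) \<partial>M) = c"
    using * assms by (subst integral_eq_nn_integral) auto
qed

text \<open>
  The covariances of the U-statistic and of the linear statistic agree except for the contribution of the
  pairs of tuples with at least two common points, which \<open>overlap\<close> collects.
\<close>

lemma ustat_lin_L2: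
  assumes F: "kernel F" and g: "g \<in> borel_measurable \<mu>" "\<And>y. g y \<ge> 0"
    and m: "\<And>I::nat set. finite I \<Longrightarrow> card I = Suc a \<Longrightarrow> (\<integral>\<^sup>+x. F (x ` I) \<partial>Pi\<^sub>M I (\<lambda>_. \<mu>)) = fact (Suc a) * ennreal m" "m \<ge> 0"
    and Fg: "\<And>(I::nat set) y. finite I \<Longrightarrow> card I = a \<Longrightarrow> y \<in> space \<mu> \<Longrightarrow>
      (\<integral>\<^sup>+x. F (insert y (x ` I)) \<partial>Pi\<^sub>M I (\<lambda>_. \<mu>)) = fact a * ennreal (g y)"
    and \<gamma>: "(\<integral>\<^sup>+y. ennreal (g y) \<partial>\<mu>) = ennreal \<gamma>" "\<gamma> \<ge> 0"
    and v: "(\<integral>\<^sup>+y. ennreal (g y) * ennreal (g y) \<partial>\<mu>) = ennreal v" "v \<ge> 0"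
    and ov: "(\<integral>\<^sup>+\<omega>. overlap (Suc a) (Suc a) F F \<omega> \<partial>M) \<le> ennreal qq" "qq \<ge> 0"
  defines "D \<equiv> \<lambda>\<omega>. (enn2real (ustat (Suc a) F \<omega>) - m) - (enn2real (lin g \<omega>) - \<gamma>)"
  shows "integrable M (\<lambda>\<omega>. (D \<omega>)\<^sup>2)" "(\<integral>\<omega>. (D \<omega>)\<^sup>2 \<partial>M) \<le> qq"
    and "integrable M (\<lambda>\<omega>. enn2real (ustat (Suc a) F \<omega>))" "(\<integral>\<omega>. enn2real (ustat (Suc a) F \<omega>) \<partial>M) = m"
proof -
  let ?G = "lin_kernel g"
  have G: "kernel ?G" using g(1) by (rule kernel_lin_kernel)
  note g(1)[measurable]
  have gg: "(\<lambda>y. ennreal (g y) * ennreal (g y)) \<in> borel_measurable \<mu>" by measurable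
  have mG: "(\<integral>\<^sup>+x. ?G (x ` I) \<partial>Pi\<^sub>M I (\<lambda>_. \<mu>)) = fact (Suc 0) * ennreal \<gamma>" if "finite I" "card I = Suc 0" for I :: "nat set"
  proof -
    obtain j where "I = {j}" using \<open>card I = Suc 0\<close> by (auto simp: card_Suc_eq)
    then show ?thesis using prod.product_nn_integral_singleton[of "\<lambda>y. ennreal (g y)" j] \<gamma>
      by (simp add: lin_kernel_def)
  qed
  have gG: "(\<integral>\<^sup>+x. ?G (insert y (x ` I)) \<partial>Pi\<^sub>M I (\<lambda>_. \<mu>)) = fact 0 * ennreal (g y)" if "finite I" "card I = 0" for I :: "nat set" and y
    using that prod.nn_integral_empty[of "\<lambda>_. ennreal (g y)"] by (simp add: lin_kernel_def)
  have fact1: "fact n \<noteq> (0::ennreal)" "fact n \<noteq> (top::ennreal)" for n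
  proof -
    have "(fact n :: ennreal) = ennreal (fact n)" by (metis ennreal_of_nat_eq_real_of_nat of_nat_fact)
    then show "fact n \<noteq> (0::ennreal)" "fact n \<noteq> (top::ennreal)" by simp_all
  qed
  define U where "U \<omega> = enn2real (ustat (Suc a) F \<omega>)" for \<omega>
  define L where "L \<omega> = enn2real (lin g \<omega>)" for \<omega>
  have um: "ustat n F \<in> borel_measurable M" "ustat n ?G \<in> borel_measurable M" for n
    using F G by (auto intro: ustat_measurable)
  have EU: "(\<integral>\<^sup>+\<omega>. ustat (Suc a) F \<omega> \<partial>M) = ennreal m"
  proof -
    have "fact (Suc a) * (\<integral>\<^sup>+\<omega>. ustat (Suc a) F \<omega> \<partial>M) = fact (Suc a) * ennreal m"
      using nn_integral_ustat[OF F, of "Suc a"] m(1)[of "{..<Suc a}"] by simp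
    then show ?thesis using fact1 by (simp add: ennreal_mult_cancel_left del: fact_Suc)
  qed
  have EL: "(\<integral>\<^sup>+\<omega>. ustat (Suc 0) ?G \<omega> \<partial>M) = ennreal \<gamma>"
    using nn_integral_ustat[OF G, of "Suc 0"] mG[of "{..<Suc 0}"] by simp
  define q' where "q' = enn2real (\<integral>\<^sup>+\<omega>. overlap (Suc a) (Suc a) F F \<omega> \<partial>M)"
  have "(\<integral>\<^sup>+\<omega>. overlap (Suc a) (Suc a) F F \<omega> \<partial>M) < top"
    using ov(1) by (rule order_le_less_trans) simp
  then have q': "(\<integral>\<^sup>+\<omega>. overlap (Suc a) (Suc a) F F \<omega> \<partial>M) = ennreal q'" "0 \<le> q'" "q' \<le> qq"
    using ov by (simp_all only: q'_def ennreal_enn2real enn2real_nonneg enn2real_leI)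
  have EUU: "(\<integral>\<^sup>+\<omega>. ustat (Suc a) F \<omega> * ustat (Suc a) F \<omega> \<partial>M) = ennreal (m * m + v + q')"
  proof -
    have "(\<integral>\<^sup>+\<omega>. ustat (Suc a) F \<omega> * ustat (Suc a) F \<omega> \<partial>M) = ennreal m * ennreal m +
        (\<integral>\<^sup>+y. ennreal (g y) * ennreal (g y) \<partial>\<mu>) + (\<integral>\<^sup>+\<omega>. overlap (Suc a) (Suc a) F F \<omega> \<partial>M)"
      by (rule nn_integral_ustat_mult[OF F F m(1) m(1) Fg Fg gg])
    also note v(1)
    also note q'(1)
    finally have "(\<integral>\<^sup>+\<omega>. ustat (Suc a) F \<omega> * ustat (Suc a) F \<omega> \<partial>M) = ennreal m * ennreal m + ennreal v + ennreal q'" .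
    then show ?thesis using m(2) v(2) q'(2) by (simp add: ennreal_mult)
  qed
  have EUL: "(\<integral>\<^sup>+\<omega>. ustat (Suc a) F \<omega> * ustat (Suc 0) ?G \<omega> \<partial>M) = ennreal (m * \<gamma> + v)"
  proof -
    have "(\<integral>\<^sup>+\<omega>. ustat (Suc a) F \<omega> * ustat (Suc 0) ?G \<omega> \<partial>M) = ennreal m * ennreal \<gamma> +
        (\<integral>\<^sup>+y. ennreal (g y) * ennreal (g y) \<partial>\<mu>) + (\<integral>\<^sup>+\<omega>. overlap (Suc a) (Suc 0) F ?G \<omega> \<partial>M)"
      by (rule nn_integral_ustat_mult[OF F G m(1) mG Fg gG gg])
    also note v(1)
    also have "(\<integral>\<^sup>+\<omega>. overlap (Suc a) (Suc 0) F ?G \<omega> \<partial>M) = (\<integral>\<^sup>+\<omega>. 0 \<partial>M)"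
      by (intro nn_integral_cong overlap_one)
    finally have "(\<integral>\<^sup>+\<omega>. ustat (Suc a) F \<omega> * ustat (Suc 0) ?G \<omega> \<partial>M) = ennreal m * ennreal \<gamma> + ennreal v + (\<integral>\<^sup>+\<omega>. 0 \<partial>M)" .
    then show ?thesis using m(2) v(2) \<gamma>(2) by (simp add: ennreal_mult)
  qed
  have ELL: "(\<integral>\<^sup>+\<omega>. ustat (Suc 0) ?G \<omega> * ustat (Suc 0) ?G \<omega> \<partial>M) = ennreal (\<gamma> * \<gamma> + v)"
  proof -
    have "(\<integral>\<^sup>+\<omega>. ustat (Suc 0) ?G \<omega> * ustat (Suc 0) ?G \<omega> \<partial>M) = ennreal \<gamma> * ennreal \<gamma> +
        (\<integral>\<^sup>+y. ennreal (g y) * ennreal (g y) \<partial>\<mu>) + (\<integral>\<^sup>+\<omega>. overlap (Suc 0) (Suc 0) ?G ?G \<omega> \<partial>M)"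
      by (rule nn_integral_ustat_mult[OF G G mG mG gG gG gg])
    also note v(1)
    also have "(\<integral>\<^sup>+\<omega>. overlap (Suc 0) (Suc 0) ?G ?G \<omega> \<partial>M) = (\<integral>\<^sup>+\<omega>. 0 \<partial>M)"
      by (intro nn_integral_cong overlap_one)
    finally have "(\<integral>\<^sup>+\<omega>. ustat (Suc 0) ?G \<omega> * ustat (Suc 0) ?G \<omega> \<partial>M) = ennreal \<gamma> * ennreal \<gamma> + ennreal v + (\<integral>\<^sup>+\<omega>. 0 \<partial>M)" .
    then show ?thesis using v(2) \<gamma>(2) by (simp add: ennreal_mult)
  qed
  note mult_m = borel_measurable_times_ennreal
  have nn: "m * m + v + q' \<ge> 0" "m * \<gamma> + v \<ge> 0" "\<gamma> * \<gamma> + v \<ge> 0"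
    using m(2) \<gamma>(2) v(2) q'(2) by auto
  have U: "U = (\<lambda>\<omega>. enn2real (ustat (Suc a) F \<omega>))" by (simp add: U_def[abs_def])
  have L: "L = (\<lambda>\<omega>. enn2real (ustat (Suc 0) ?G \<omega>))" by (simp add: L_def[abs_def] lin_eq_ustat)
  note I = enn2real_moment(1)[OF um(1) EU m(2), folded U] enn2real_moment(1)[OF um(2) EL \<gamma>(2), folded L]
    enn2real_moment(1)[OF mult_m[OF um(1) um(1)] EUU nn(1), unfolded enn2real_mult, folded U_def]
    enn2real_moment(1)[OF mult_m[OF um(1) um(2)] EUL nn(2), unfolded enn2real_mult, folded U_def lin_eq_ustat, folded L_def]
    enn2real_moment(1)[OF mult_m[OF um(2) um(2)] ELL nn(3), unfolded enn2real_mult, folded lin_eq_ustat, folded L_def]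
  note E = enn2real_moment(2)[OF um(1) EU m(2), folded U] enn2real_moment(2)[OF um(2) EL \<gamma>(2), folded L]
    enn2real_moment(2)[OF mult_m[OF um(1) um(1)] EUU nn(1), unfolded enn2real_mult, folded U_def]
    enn2real_moment(2)[OF mult_m[OF um(1) um(2)] EUL nn(2), unfolded enn2real_mult, folded U_def lin_eq_ustat, folded L_def]
    enn2real_moment(2)[OF mult_m[OF um(2) um(2)] ELL nn(3), unfolded enn2real_mult, folded lin_eq_ustat, folded L_def]
  show "integrable M (\<lambda>\<omega>. enn2real (ustat (Suc a) F \<omega>))" "(\<integral>\<omega>. enn2real (ustat (Suc a) F \<omega>) \<partial>M) = m"
    using I(1) E(1) unfolding U .
  have D: "(D \<omega>)\<^sup>2 = U \<omega> * U \<omega> + L \<omega> * L \<omega> + (\<gamma> - m)\<^sup>2 - 2 * (U \<omega> * L \<omega>) + 2 * (\<gamma> - m) * U \<omega> - 2 * (\<gamma> - m) * L \<omega>" for \<omega>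
    unfolding D_def U_def L_def by (rule square_expansion)
  have const: "has_bochner_integral M (\<lambda>_. c) c" for c :: real
    by (simp add: has_bochner_integral_iff prob_space)
  have H: "has_bochner_integral M (\<lambda>\<omega>. (D \<omega>)\<^sup>2)
      ((m * m + v + q') + (\<gamma> * \<gamma> + v) + (\<gamma> - m)\<^sup>2 - 2 * (m * \<gamma> + v) + 2 * (\<gamma> - m) * m - 2 * (\<gamma> - m) * \<gamma>)"
    unfolding D
    by (intro has_bochner_integral_add has_bochner_integral_diff has_bochner_integral_mult_right const)
      (intro has_bochner_integral_iff[THEN iffD2] conjI I E)+
  also have "(m * m + v + q') + (\<gamma> * \<gamma> + v) + (\<gamma> - m)\<^sup>2 - 2 * (m * \<gamma> + v) + 2 * (\<gamma> - m) * m - 2 * (\<gamma> - m) * \<gamma> = q'"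
    by (rule second_moment_cancel)
  finally have H: "has_bochner_integral M (\<lambda>\<omega>. (D \<omega>)\<^sup>2) q'" .
  then show "integrable M (\<lambda>\<omega>. (D \<omega>)\<^sup>2)" by (simp only: has_bochner_integral_iff)
  from H have "(\<integral>\<omega>. (D \<omega>)\<^sup>2 \<partial>M) = q'" by (simp only: has_bochner_integral_iff)
  then show "(\<integral>\<omega>. (D \<omega>)\<^sup>2 \<partial>M) \<le> qq" using q'(3) by (simp only:)
qed

end

section \<open>Flats hitting a ball\<close>

text \<open>The power with exponent \<open>m / 2\<close> on the nonnegative half line. The case
  distinction matters for \<open>m = 0\<close>, where the value is the indicator of
  \<open>0 \<le> s\<close>, that is, of a flat that hits the ball.\<close>

definition gfun :: "nat \<Rightarrow> real \<Rightarrow> real" where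
  "gfun m s = (if s < 0 then 0 else sqrt s ^ m)"

lemma gfun_nonneg: "gfun m s \<ge> 0"
  by (simp add: gfun_def)

lemma gfun_measurable[measurable]: "gfun m \<in> borel_measurable borel"
  unfolding gfun_def[abs_def] by measurable

lemma gfun_square: "gfun m s * gfun m s = gfun (2 * m) s"
  by (simp add: gfun_def mult_2 power_add)

lemma gfun_scale: "c > 0 \<Longrightarrow> gfun m (c\<^sup>2 * s) = c ^ m * gfun m s"
proof (cases "s < 0")
  case True
  assume "c > 0"
  with True have "c\<^sup>2 * s < 0" by (intro mult_pos_neg) auto
  with True show ?thesis by (simp add: gfun_def)
next
  case False
  assume c: "c > 0"
  with False have "\<not> c\<^sup>2 * s < 0" by (simp add: not_less)
  moreover have "sqrt (c\<^sup>2 * s) = c * sqrt s" using c by (simp add: real_sqrt_mult)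
  ultimately show ?thesis using False by (simp only: gfun_def power_mult_distrib if_False)
qed

text \<open>The integral of \<open>(1 - t\<^sup>2) ^ (m / 2)\<close> over \<open>[-1, 1]\<close>.\<close>

definition kratio :: "nat \<Rightarrow> real" where
  "kratio m = unit_ball_vol (real (Suc m)) / unit_ball_vol (real m)"

lemma kratio_pos: "kratio m > 0"
  by (simp add: kratio_def)

lemma kratio_eq_Beta: "kratio m = Beta (1 / 2) (real m / 2 + 1)"
proof -
  have "unit_ball_vol (real m) * Beta (1/2) (real m / 2 + 1) = unit_ball_vol (Suc m)"
    by (auto simp: unit_ball_vol_def Beta_def Gamma_eq_zero_iff field_simps
          Gamma_one_half_real powr_half_sqrt [symmetric] powr_add [symmetric])
  moreover have "unit_ball_vol (real m) \<noteq> 0" using unit_ball_vol_pos[of "real m"] by linarith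
  ultimately show ?thesis unfolding kratio_def by (metis nonzero_mult_div_cancel_left)
qed

text \<open>Scaling by \<open>sqrt s\<close> reduces the integral to the interval from -1 to 1,
  where it is a Beta integral, and raises the exponent by one. For \<open>s \<le> 0\<close> the
  integrand vanishes except possibly at \<open>t = 0\<close>.\<close>

lemma nn_integral_gfun: "(\<integral>\<^sup>+t. ennreal (gfun m (s - t\<^sup>2)) \<partial>lborel) = ennreal (kratio m * gfun (Suc m) s)"
proof (cases "s > 0")
  case True
  define c where "c = sqrt s"
  have c: "c > 0" "c\<^sup>2 = s" using True by (simp_all add: c_def)
  have "(\<integral>\<^sup>+t. ennreal (gfun m (s - t\<^sup>2)) \<partial>lborel) = ennreal \<bar>c\<bar> * (\<integral>\<^sup>+t. ennreal (gfun m (s - (0 + c * t)\<^sup>2)) \<partial>lborel)"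
    using c by (intro nn_integral_real_affine) auto
  also have "\<dots> = ennreal c * (\<integral>\<^sup>+t. ennreal (c ^ m) * ennreal (indicator {-1..1} t * sqrt (1 - t\<^sup>2) ^ m) \<partial>lborel)"
  proof -
    have "ennreal (gfun m (s - (0 + c * t)\<^sup>2)) = ennreal (c ^ m) * ennreal (indicator {-1..1} t * sqrt (1 - t\<^sup>2) ^ m)" for t
    proof -
      have "s - (0 + c * t)\<^sup>2 = c\<^sup>2 * (1 - t\<^sup>2)" using c(2) by (simp add: power_mult_distrib algebra_simps)
      then have "gfun m (s - (0 + c * t)\<^sup>2) = c ^ m * gfun m (1 - t\<^sup>2)" using gfun_scale[OF c(1)] by simp
      moreover have "gfun m (1 - t\<^sup>2) = indicator {-1..1} t * sqrt (1 - t\<^sup>2) ^ m"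
        using abs_square_le_1[of t] by (auto simp: gfun_def indicator_def abs_le_iff)
      ultimately show ?thesis using c by (simp add: ennreal_mult')
    qed
    then show ?thesis using c by simp
  qed
  also have "\<dots> = ennreal c * (ennreal (c ^ m) * ennreal (kratio m))"
    by (simp add: nn_integral_cmult emeasure_cball_aux_integral kratio_eq_Beta)
  also have "\<dots> = ennreal (c * (c ^ m * kratio m))"
    using c(1) kratio_pos[of m] by (simp only: ennreal_mult' zero_le_power less_imp_le)
  also have "c * (c ^ m * kratio m) = kratio m * gfun (Suc m) s"
    using True by (simp add: gfun_def c_def)
  finally show ?thesis .
next
  case False
  have "(\<integral>\<^sup>+t. ennreal (gfun m (s - t\<^sup>2)) \<partial>lborel) = (\<integral>\<^sup>+t. 0 \<partial>(lborel :: real measure))"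
  proof (rule nn_integral_cong_AE)
    show "AE t in lborel. ennreal (gfun m (s - t\<^sup>2)) = 0"
      using AE_lborel_singleton[of "0::real"]
    proof eventually_elim
      case (elim t)
      then have "t\<^sup>2 > 0" by simp
      then have "s - t\<^sup>2 < 0" using False by linarith
      then show ?case by (simp add: gfun_def)
    qed
  qed
  then show ?thesis using False by (simp add: gfun_def)
qed

lemma nn_integral_gfun_affine:
  assumes "w > 0"
  shows "(\<integral>\<^sup>+p. ennreal (gfun m (s - (p - c)\<^sup>2 / w\<^sup>2)) \<partial>lborel) = ennreal (w * (kratio m * gfun (Suc m) s))"
proof -
  have "(\<integral>\<^sup>+p. ennreal (gfun m (s - (p - c)\<^sup>2 / w\<^sup>2)) \<partial>lborel)
      = ennreal \<bar>w\<bar> * (\<integral>\<^sup>+t. ennreal (gfun m (s - ((c + w * t) - c)\<^sup>2 / w\<^sup>2)) \<partial>lborel)"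
    using assms by (intro nn_integral_real_affine) auto
  also have "\<dots> = ennreal w * (\<integral>\<^sup>+t. ennreal (gfun m (s - t\<^sup>2)) \<partial>lborel)"
    using assms by (simp add: power_mult_distrib)
  finally show ?thesis
    using assms by (simp add: nn_integral_gfun ennreal_mult'[symmetric])
qed

section \<open>Sections of flats by hyperplanes\<close>

lemma proj_eq:
  fixes B :: "'a::euclidean_space set"
  assumes B: "orthonormal B"
  defines "w v \<equiv> \<Sum>b\<in>B. (v \<bullet> b) *\<^sub>R b"
  shows "w v \<in> span B" "norm (w v) = proj_norm B v" "\<And>u. u \<in> span B \<Longrightarrow> u \<bullet> v = u \<bullet> w v"
proof -
  have fin: "finite B" using B by (rule orthonormal_finite)
  show "w v \<in> span B" unfolding w_def by (intro span_sum span_scale span_base)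
  have wb: "b \<bullet> w v = v \<bullet> b" if "b \<in> B" for b
  proof -
    have "b \<bullet> w v = (\<Sum>c\<in>B. (v \<bullet> c) * (b \<bullet> c))" by (simp add: w_def inner_sum_right)
    also have "\<dots> = (\<Sum>c\<in>B. if c = b then v \<bullet> c else 0)"
      using orthonormal_inner[OF B that] by (intro sum.cong) auto
    finally show ?thesis using fin that by (simp add: sum.delta)
  qed
  have "(norm (w v))\<^sup>2 = (\<Sum>b\<in>B. (v \<bullet> b)\<^sup>2)"
    unfolding power2_norm_eq_inner by (subst w_def) (simp add: inner_sum_left wb power2_eq_square)
  then show "norm (w v) = proj_norm B v" unfolding proj_norm_def by (metis norm_ge_zero real_sqrt_abs abs_of_nonneg)
  show "u \<bullet> v = u \<bullet> w v" if "u \<in> span B" for u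
    using that
  proof (induction rule: span_induct_alt)
    case (step c b u)
    then show ?case using wb[of b] by (simp add: inner_add_left inner_commute[of b v])
  qed simp
qed

lemma flat_section_empty:
  assumes B: "orthonormal B" and 0: "proj_norm B v = 0" and p: "p \<noteq> z \<bullet> v"
  shows "{x. x - z \<in> span B} \<inter> hyperplane p v = {}"
proof -
  let ?w = "\<Sum>b\<in>B. (v \<bullet> b) *\<^sub>R b"
  have "?w = 0" using proj_eq(2)[OF B, of v] 0 by simp
  have "x \<bullet> v = z \<bullet> v" if "x - z \<in> span B" for x
    using proj_eq(3)[OF B that, of v] \<open>?w = 0\<close> by (simp add: inner_diff_left)
  then show ?thesis using p by (auto simp: hyperplane_def)
qed

text \<open>The foot point moves from \<open>z\<close> along the projection \<open>w\<close> of
  \<open>v\<close> to the span until it reaches the hyperplane; this step is orthogonal to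
  \<open>z\<close>, so Pythagoras gives the new distance. The new directions are those vectors of
  the span that are orthogonal to \<open>w\<close>.\<close>

lemma flat_section:
  fixes z :: "'a::euclidean_space"
  assumes B: "orthonormal B" and z: "\<And>u. u \<in> span B \<Longrightarrow> z \<bullet> u = 0" and pos: "proj_norm B v \<noteq> 0"
  shows "\<exists>U' z'. subspace U' \<and> (\<forall>u\<in>U'. z' \<bullet> u = 0) \<and> dim U' = card B - 1 \<and>
    {x. x - z \<in> span B} \<inter> hyperplane p v = {x. x - z' \<in> U'} \<and>
    (norm z')\<^sup>2 = (norm z)\<^sup>2 + (p - z \<bullet> v)\<^sup>2 / (proj_norm B v)\<^sup>2"
proof -
  define w where "w = (\<Sum>b\<in>B. (v \<bullet> b) *\<^sub>R b)"
  note w = proj_eq[OF B, where v = v, folded w_def]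
  have fin: "finite B" using B by (rule orthonormal_finite)
  define q where "q = p - z \<bullet> v"
  define N where "N = (norm w)\<^sup>2"
  have N: "N > 0" "w \<bullet> w = N" "N = (proj_norm B v)\<^sup>2"
    using pos w(2) by (auto simp: N_def) (simp only: power2_norm_eq_inner[symmetric] w(2))
  define z' where "z' = z + (q / N) *\<^sub>R w"
  define U' where "U' = {u \<in> span B. u \<bullet> w = 0}"
  have zw: "z \<bullet> w = 0" using z w(1) by simp
  have 1: "subspace U'" unfolding U'_def subspace_def
    by (auto simp: inner_add_left span_zero span_add span_scale)
  have 2: "z' \<bullet> u = 0" if "u \<in> U'" for u
    using that z by (auto simp: z'_def U'_def inner_add_left inner_commute[of w])
  have 3: "dim U' = card B - 1"
  proof -
    have "span {w} \<subseteq> span B" using w(1) by (simp add: span_minimal)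
    then have "dim {y \<in> span B. \<forall>x\<in>span {w}. orthogonal x y} + dim (span {w}) = dim (span B)"
      by (intro dim_subspace_orthogonal_to_vectors) auto
    moreover have "{y \<in> span B. \<forall>x\<in>span {w}. orthogonal x y} = U'"
      by (auto simp: U'_def orthogonal_def span_singleton inner_commute)
    moreover have "w \<noteq> 0" using N by auto
    then have "dim (span {w}) = 1" by (simp add: dim_singleton)
    moreover have "independent B"
      using B by (intro pairwise_orthogonal_independent) (auto simp: orthonormal_def)
    then have "dim (span B) = card B" by (simp add: dim_eq_card_independent)
    ultimately show ?thesis by simp
  qed
  have 4: "{x. x - z \<in> span B} \<inter> hyperplane p v = {x. x - z' \<in> U'}"
  proof (rule set_eqI)
    fix x
    have mem: "x - z' \<in> span B \<longleftrightarrow> x - z \<in> span B"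
    proof -
      have e: "x - z' = (x - z) - (q / N) *\<^sub>R w" "x - z = (x - z') + (q / N) *\<^sub>R w" by (simp_all add: z'_def)
      have s: "(q / N) *\<^sub>R w \<in> span B" using w(1) by (rule span_scale)
      show ?thesis using span_diff[OF _ s, of "x - z"] span_add[OF _ s, of "x - z'"] e by metis
    qed
    have "(x - z') \<bullet> w = (x - z) \<bullet> w - q" using N by (simp add: z'_def inner_diff_left inner_add_left)
    moreover have "(x - z) \<bullet> w = x \<bullet> v - z \<bullet> v" if "x - z \<in> span B"
      using w(3)[OF that] by (simp add: inner_diff_left)
    ultimately show "x \<in> {x. x - z \<in> span B} \<inter> hyperplane p v \<longleftrightarrow> x \<in> {x. x - z' \<in> U'}"
      using mem by (auto simp: U'_def hyperplane_def q_def)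
  qed
  have 5: "(norm z')\<^sup>2 = (norm z)\<^sup>2 + (p - z \<bullet> v)\<^sup>2 / (proj_norm B v)\<^sup>2"
  proof -
    have "(norm z')\<^sup>2 = z \<bullet> z + (q / N)\<^sup>2 * N"
      unfolding power2_norm_eq_inner using zw N
      by (simp add: z'_def inner_add_left inner_add_right inner_commute[of w z] power2_eq_square)
    also have "(q / N)\<^sup>2 * N = q\<^sup>2 / N" using N by (simp add: power2_eq_square)
    finally show ?thesis unfolding N(3) q_def power2_norm_eq_inner[of z] .
  qed
  show ?thesis
    by (intro exI[of _ U'] exI[of _ z'] conjI ballI 1 2 3 4 5)
qed

text \<open>\<open>z\<close> is orthogonal to \<open>U\<close>, hence it is the point of the flat
  nearest to the origin. The condition is phrased like the case distinction in
  \<open>gfun\<close>.\<close>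

lemma flat_hits_ball:
  fixes z :: "'a::euclidean_space"
  assumes U: "subspace U" and z: "\<And>u. u \<in> U \<Longrightarrow> z \<bullet> u = 0" and r: "r \<ge> 0"
  shows "{x. x - z \<in> U} \<inter> cball 0 r \<noteq> {} \<longleftrightarrow> \<not> r\<^sup>2 - (norm z)\<^sup>2 < 0"
proof
  assume "{x. x - z \<in> U} \<inter> cball 0 r \<noteq> {}"
  then obtain x where "x \<in> {x. x - z \<in> U}" "x \<in> cball 0 r" by blast
  then have x: "x - z \<in> U" "norm x \<le> r" by (simp_all only: mem_Collect_eq mem_cball_0)
  have "orthogonal z (x - z)" using z[OF x(1)] by (simp only: orthogonal_def)
  then have "(norm (z + (x - z)))\<^sup>2 = (norm z)\<^sup>2 + (norm (x - z))\<^sup>2" by (rule norm_add_Pythagorean)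
  then have "(norm z)\<^sup>2 \<le> (norm x)\<^sup>2" by simp
  also have "\<dots> \<le> r\<^sup>2" by (rule power_mono[OF x(2) norm_ge_zero])
  finally show "\<not> r\<^sup>2 - (norm z)\<^sup>2 < 0" by (simp only: not_less diff_ge_0_iff_ge)
next
  assume "\<not> r\<^sup>2 - (norm z)\<^sup>2 < 0"
  then have "(norm z)\<^sup>2 \<le> r\<^sup>2" by (simp only: not_less diff_ge_0_iff_ge)
  then have "norm z \<le> r" by (rule power2_le_imp_le[OF _ r])
  then have "z \<in> {x. x - z \<in> U} \<inter> cball 0 r" using subspace_0[OF U] by simp
  then show "{x. x - z \<in> U} \<inter> cball 0 r \<noteq> {}" by blast
qed

text \<open>The extra set \<open>A\<close> is the flat formed so far: \<open>hit_insert\<close>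
  moves one hyperplane from the configuration into \<open>A\<close>, which drives the
  induction.\<close>

definition hit :: "'a::euclidean_space set \<Rightarrow> real \<Rightarrow> (real \<times> 'a) set \<Rightarrow> ennreal" where
  "hit A r Y = of_bool (A \<inter> (\<Inter>y\<in>Y. hyperplane (fst y) (snd y)) \<inter> cball 0 r \<noteq> {})"

lemma hit_insert: "hit A r (insert y Y) = hit (A \<inter> hyperplane (fst y) (snd y)) r Y"
  by (simp add: hit_def Int_assoc)

text \<open>Existence of a common point is an uncountable union. By continuity and compactness it
  amounts to approximate solutions in a dense subset \<open>D\<close>, which is countable in
  \<open>hit_measurable\<close> and so yields measurability.\<close>

lemma hit_iff_countable:
  fixes K :: "'a::euclidean_space set"
  assumes K: "compact K" and D: "D \<subseteq> K" "K \<subseteq> closure D" and I: "finite I"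
  shows "K \<inter> (\<Inter>i\<in>I. hyperplane (p i) (v i)) \<noteq> {} \<longleftrightarrow> (\<forall>n::nat. \<exists>d\<in>D. \<forall>i\<in>I. \<bar>d \<bullet> v i - p i\<bar> < 1 / real (Suc n))"
proof
  assume "K \<inter> (\<Inter>i\<in>I. hyperplane (p i) (v i)) \<noteq> {}"
  then obtain x where x: "x \<in> K" "\<And>i. i \<in> I \<Longrightarrow> x \<bullet> v i = p i" by (auto simp: hyperplane_def)
  then have "x \<in> closure D" using D by auto
  show "\<forall>n::nat. \<exists>d\<in>D. \<forall>i\<in>I. \<bar>d \<bullet> v i - p i\<bar> < 1 / real (Suc n)"
  proof
    fix n :: nat
    let ?S = "\<Inter>i\<in>I. {d. \<bar>d \<bullet> v i - p i\<bar> < 1 / real (Suc n)}"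
    have "open {d. \<bar>d \<bullet> v i - p i\<bar> < 1 / real (Suc n)}" for i
      by (rule open_Collect_less) (intro continuous_intros)+
    then have S: "open ?S" using I by (intro open_INT) auto
    moreover have "x \<in> ?S" using x by simp
    ultimately have "?S \<inter> D \<noteq> {}"
      using open_Int_closure_eq_empty[OF S, of D] \<open>x \<in> closure D\<close> by blast
    then show "\<exists>d\<in>D. \<forall>i\<in>I. \<bar>d \<bullet> v i - p i\<bar> < 1 / real (Suc n)" by auto
  qed
next
  assume "\<forall>n::nat. \<exists>d\<in>D. \<forall>i\<in>I. \<bar>d \<bullet> v i - p i\<bar> < 1 / real (Suc n)"
  then obtain d where d: "\<And>n. d n \<in> D" "\<And>n i. i \<in> I \<Longrightarrow> \<bar>d n \<bullet> v i - p i\<bar> < 1 / real (Suc n)" by metis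
  have "\<forall>n. d n \<in> K" using d(1) D by auto
  with K have "\<exists>x\<in>K. \<exists>s. strict_mono s \<and> (d \<circ> s) \<longlonglongrightarrow> x" unfolding compact_def by blast
  then obtain x s where x: "x \<in> K" "strict_mono s" "(d \<circ> s) \<longlonglongrightarrow> x" by blast
  have "x \<bullet> v i = p i" if i: "i \<in> I" for i
  proof -
    have "(\<lambda>n. (d \<circ> s) n \<bullet> v i - p i) \<longlonglongrightarrow> x \<bullet> v i - p i" by (intro tendsto_intros x(3))
    moreover have "(\<lambda>n. (d \<circ> s) n \<bullet> v i - p i) \<longlonglongrightarrow> 0"
    proof (rule Lim_null_comparison)
      show "\<forall>\<^sub>F n in sequentially. norm ((d \<circ> s) n \<bullet> v i - p i) \<le> 1 / real (Suc n)"
      proof (rule always_eventually, rule allI)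
        fix n
        have "\<bar>d (s n) \<bullet> v i - p i\<bar> < 1 / real (Suc (s n))" using d(2)[OF i] .
        also have "\<dots> \<le> 1 / real (Suc n)" using seq_suble[OF x(2), of n] by (simp add: frac_le)
        finally show "norm ((d \<circ> s) n \<bullet> v i - p i) \<le> 1 / real (Suc n)" by simp
      qed
      show "(\<lambda>n. 1 / real (Suc n)) \<longlonglongrightarrow> 0" by (rule LIMSEQ_Suc[OF lim_1_over_n])
    qed
    ultimately have "x \<bullet> v i - p i = 0" by (rule LIMSEQ_unique)
    then show ?thesis by simp
  qed
  then show "K \<inter> (\<Inter>i\<in>I. hyperplane (p i) (v i)) \<noteq> {}" using x(1) by (auto simp: hyperplane_def)
qed

text \<open>
  Given that a hyperplane with normal vector \<open>v\<close> meets an \<open>n\<close>-flat, the section is an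
  \<open>(n - 1)\<close>-flat whose distance from the origin has a density proportional to the norm of the
  projection of \<open>v\<close> to the direction of the flat; averaging over \<open>v\<close> gives the factor
  \<open>mean_proj d n\<close>, and integrating over the distance the factor \<open>kratio m\<close>.
\<close>

fun flatc :: "nat \<Rightarrow> nat \<Rightarrow> nat \<Rightarrow> real" where
  "flatc d n 0 = 1"
| "flatc d n (Suc m) = flatc d (n - 1) m * kratio m * mean_proj d n"

lemma mean_proj_nonneg: "mean_proj d n \<ge> 0"
  by (simp add: mean_proj_def)

lemma flatc_nonneg: "flatc d n m \<ge> 0"
proof (induction m arbitrary: n)
  case (Suc m)
  show ?case unfolding flatc.simps
    by (intro mult_nonneg_nonneg Suc mean_proj_nonneg less_imp_le[OF kratio_pos])
qed simp

section \<open>Mean hitting numbers of the hyperplane process\<close>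

locale isotropic_hyperplanes = marked_poisson M "half_sphere_uniform e" lam X
  for M :: "'w measure" and e :: "'a::euclidean_space" and lam :: real and X :: "nat \<Rightarrow> 'w \<Rightarrow> real \<times> 'a" +
  assumes e: "e \<noteq> 0"
begin

lemma snd_borel_measurable: "snd \<in> \<mu> \<rightarrow>\<^sub>M borel"
  using measurable_compose[OF snd_measurable_mu measurable_half_sphere_uniform[of "\<lambda>x. x" borel e]] by simp

lemma space_muD: "y \<in> space \<mu> \<Longrightarrow> norm (snd y) = 1"
  by (auto simp: space_mu space_half_sphere_uniform half_sphere_def)

lemma hit_measurable:
  assumes A: "closed A" and I: "finite (I :: nat set)"
  shows "(\<lambda>x. hit A r (x ` I)) \<in> borel_measurable (Pi\<^sub>M I (\<lambda>_. \<mu>))"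
proof -
  let ?K = "A \<inter> cball 0 r"
  have K: "compact ?K" using A by (simp add: closed_Int_compact)
  obtain D where D: "countable D" "D \<subseteq> ?K" "?K \<subseteq> closure D" by (rule separable)
  have eq: "A \<inter> (\<Inter>y\<in>x ` I. hyperplane (fst y) (snd y)) \<inter> cball 0 r \<noteq> {} \<longleftrightarrow>
     (\<forall>n::nat. \<exists>d\<in>D. \<forall>i\<in>I. \<bar>d \<bullet> snd (x i) - fst (x i)\<bar> < 1 / real (Suc n))" for x :: "nat \<Rightarrow> real \<times> 'a"
  proof -
    have "A \<inter> (\<Inter>y\<in>x ` I. hyperplane (fst y) (snd y)) \<inter> cball 0 r = ?K \<inter> (\<Inter>i\<in>I. hyperplane (fst (x i)) (snd (x i)))"
      by auto
    then show ?thesis using hit_iff_countable[OF K D(2,3) I] by simp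
  qed
  have 1: "Measurable.pred (Pi\<^sub>M I (\<lambda>_. \<mu>)) (\<lambda>x. \<forall>i\<in>I. \<bar>d \<bullet> snd (x i) - fst (x i)\<bar> < 1 / real (Suc n))" for d and n :: nat
  proof (rule pred_intros_finite(3)[OF I])
    fix i assume i: "i \<in> I"
    have [measurable]: "(\<lambda>x. snd (x i)) \<in> borel_measurable (Pi\<^sub>M I (\<lambda>_. \<mu>))" "(\<lambda>x. fst (x i)) \<in> borel_measurable (Pi\<^sub>M I (\<lambda>_. \<mu>))"
      by (rule measurable_component_mu[OF snd_borel_measurable i], rule measurable_component_mu[OF fst_measurable_mu i])
    show "Measurable.pred (Pi\<^sub>M I (\<lambda>_. \<mu>)) (\<lambda>x. \<bar>d \<bullet> snd (x i) - fst (x i)\<bar> < 1 / real (Suc n))"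
      by measurable
  qed
  have "{x \<in> space (Pi\<^sub>M I (\<lambda>_. \<mu>)). \<forall>n::nat. \<exists>d\<in>D. \<forall>i\<in>I. \<bar>d \<bullet> snd (x i) - fst (x i)\<bar> < 1 / real (Suc n)}
      \<in> sets (Pi\<^sub>M I (\<lambda>_. \<mu>))"
    by (rule sets.sets_Collect_countable_All, rule sets.sets_Collect_countable_Ex', rule 1[unfolded pred_def], rule D(1))
  then show ?thesis unfolding hit_def eq of_bool_def by (intro measurable_If) simp_all
qed

lemma kernel_hit: "kernel (hit UNIV r)"
  unfolding kernel_def by (intro allI impI hit_measurable closed_UNIV)

text \<open>Induction on the hyperplanes with \<open>U\<close> and \<open>z\<close> arbitrary:
  cutting with one hyperplane leaves a section of one dimension less, to which the induction
  hypothesis applies. \<open>card I \<le> dim U\<close> keeps the direction space nontrivial as long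
  as a hyperplane remains.\<close>

lemma nn_integral_hit:
  assumes "finite (I :: nat set)" "subspace U" "\<And>u. u \<in> U \<Longrightarrow> z \<bullet> u = 0" "card I \<le> dim U" "r \<ge> 0"
  shows "(\<integral>\<^sup>+x. hit {x. x - z \<in> U} r (x ` I) \<partial>Pi\<^sub>M I (\<lambda>_. \<mu>)) =
    ennreal (lam ^ card I * flatc DIM('a) (dim U) (card I) * gfun (card I) (r\<^sup>2 - (norm z)\<^sup>2))"
  using assms
proof (induction I arbitrary: U z rule: finite_induct)
  case empty
  have "hit {x. x - z \<in> U} r {} = ennreal (gfun 0 (r\<^sup>2 - (norm z)\<^sup>2))"
    using flat_hits_ball[of U z r] empty by (simp add: hit_def gfun_def)
  moreover have "(\<integral>\<^sup>+x. hit {x. x - z \<in> U} r (x ` {}) \<partial>Pi\<^sub>M ({} :: nat set) (\<lambda>_. \<mu>)) = hit {x. x - z \<in> U} r {}"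
    by (simp only: image_empty) (rule prod.nn_integral_empty[of "\<lambda>_. hit {x. x - z \<in> U} r {}"], simp)
  ultimately show ?case by (simp only: card.empty power_0 flatc.simps mult_1)
next
  case (insert i I)
  let ?A = "{x. x - z \<in> U}"
  let ?m = "card I" and ?n = "dim U" and ?s = "r\<^sup>2 - (norm z)\<^sup>2"
  let ?k = "lam ^ ?m * flatc DIM('a) (?n - 1) ?m"
  have k: "?k \<ge> 0"
    by (intro mult_nonneg_nonneg zero_le_power less_imp_le[OF lam_pos] flatc_nonneg)
  have card: "card (insert i I) = Suc ?m" using insert.hyps by simp
  obtain B where B0: "B \<subseteq> U" "pairwise orthogonal B" "\<And>b. b \<in> B \<Longrightarrow> norm b = 1" "independent B" "card B = dim U" "span B = U"
    by (rule orthonormal_basis_subspace[OF insert.prems(1)]) blast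
  then have B: "orthonormal B" by (simp add: orthonormal_def)
  have "card B \<noteq> 0" using B0(5) insert.prems(3) card by linarith
  then have "B \<noteq> {}" by auto
  have U: "U = span B" using B0 by simp
  have closed: "closed ?A"
  proof -
    have "?A = (\<lambda>x. x - z) -` U" by auto
    moreover have "closed ((\<lambda>x. x - z) -` U)"
      by (rule continuous_closed_vimage[OF closed_subspace[OF insert.prems(1)]]) simp
    ultimately show ?thesis by simp
  qed
  let ?f = "\<lambda>x. hit ?A r (x ` insert i I)"
  have fm: "?f \<in> borel_measurable (Pi\<^sub>M (insert i I) (\<lambda>_. \<mu>))"
    using insert.hyps by (intro hit_measurable closed) auto
  let ?inner = "\<lambda>y. \<integral>\<^sup>+x. ?f (x(i := y)) \<partial>Pi\<^sub>M I (\<lambda>_. \<mu>)"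
  interpret PI: sigma_finite_measure "Pi\<^sub>M I (\<lambda>_. \<mu>)" by (rule prod.sigma_finite[OF insert.hyps(1)])
  have inner_m: "?inner \<in> borel_measurable \<mu>"
  proof -
    have "(\<lambda>z. (\<lambda>(f, y). f(i := y)) ((\<lambda>(x, y). (y, x)) z)) \<in> \<mu> \<Otimes>\<^sub>M Pi\<^sub>M I (\<lambda>_. \<mu>) \<rightarrow>\<^sub>M Pi\<^sub>M (insert i I) (\<lambda>_. \<mu>)"
      by (rule measurable_compose[OF measurable_pair_swap' measurable_add_dim])
    from measurable_compose[OF this fm]
    have "(\<lambda>z. ?f ((\<lambda>(f, y). f(i := y)) ((\<lambda>(x, y). (y, x)) z))) \<in> borel_measurable (\<mu> \<Otimes>\<^sub>M Pi\<^sub>M I (\<lambda>_. \<mu>))" .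
    moreover have "(\<lambda>(y, x). ?f (x(i := y))) = (\<lambda>z. ?f ((\<lambda>(f, y). f(i := y)) ((\<lambda>(x, y). (y, x)) z)))"
    proof
      fix z
      show "(\<lambda>(y, x). ?f (x(i := y))) z = ?f ((\<lambda>(f, y). f(i := y)) ((\<lambda>(x, y). (y, x)) z))"
        by (cases z) (simp only: prod.case)
    qed
    ultimately have "(\<lambda>(y, x). ?f (x(i := y))) \<in> borel_measurable (\<mu> \<Otimes>\<^sub>M Pi\<^sub>M I (\<lambda>_. \<mu>))" by (simp only:)
    then show ?thesis by (rule PI.borel_measurable_nn_integral)
  qed
  have inner: "?inner (p, v) = (\<integral>\<^sup>+x. hit (?A \<inter> hyperplane p v) r (x ` I) \<partial>Pi\<^sub>M I (\<lambda>_. \<mu>))" for p v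
  proof (rule nn_integral_cong)
    fix x :: "nat \<Rightarrow> real \<times> 'a"
    have "(x(i := (p, v))) ` I = x ` I" by (rule image_cong) (use insert.hyps in auto)
    then have "(x(i := (p, v))) ` insert i I = insert (p, v) (x ` I)" by (simp only: image_insert fun_upd_same)
    then show "?f (x(i := (p, v))) = hit (?A \<inter> hyperplane p v) r (x ` I)" by (simp only: hit_insert fst_conv snd_conv)
  qed
  have "(\<integral>\<^sup>+x. ?f x \<partial>Pi\<^sub>M (insert i I) (\<lambda>_. \<mu>)) = (\<integral>\<^sup>+y. ?inner y \<partial>\<mu>)"
    by (rule prod.product_nn_integral_insert_rev[OF insert.hyps fm])
  also have "\<dots> = ennreal lam * (\<integral>\<^sup>+v. (\<integral>\<^sup>+p. ?inner (p, v) \<partial>lborel) \<partial>half_sphere_uniform e)"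
    by (rule nn_integral_mu[OF inner_m])
  also have "\<dots> = ennreal lam * (\<integral>\<^sup>+v. ennreal (?k * kratio ?m * gfun (Suc ?m) ?s) * ennreal (proj_norm B v) \<partial>half_sphere_uniform e)"
  proof (rule arg_cong[where f = "\<lambda>t. ennreal lam * t"], rule nn_integral_cong)
    fix v
    show "(\<integral>\<^sup>+p. ?inner (p, v) \<partial>lborel) = ennreal (?k * kratio ?m * gfun (Suc ?m) ?s) * ennreal (proj_norm B v)"
    proof (cases "proj_norm B v = 0")
      \<comment> \<open>A hyperplane parallel to the flat meets it only for
        \<open>p = z \<bullet> v\<close>, a null set of positions.\<close>
      case True
      have "(\<integral>\<^sup>+p. ?inner (p, v) \<partial>lborel) = (\<integral>\<^sup>+p. 0 \<partial>(lborel :: real measure))"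
      proof (rule nn_integral_cong_AE)
        show "AE p in lborel. ?inner (p, v) = 0"
          using AE_lborel_singleton[of "z \<bullet> v"]
        proof eventually_elim
          case (elim p)
          have "?A \<inter> hyperplane p v = {}" unfolding U by (rule flat_section_empty[OF B True elim])
          then show ?case unfolding inner by (simp add: hit_def)
        qed
      qed
      then show ?thesis using True by simp
    next
      case False
      then have pos: "proj_norm B v > 0" using proj_norm_nonneg[of B v] by simp
      have "?inner (p, v) = ennreal ?k * ennreal (gfun ?m (?s - (p - z \<bullet> v)\<^sup>2 / (proj_norm B v)\<^sup>2))" for p
      proof -
        have zs: "\<And>u. u \<in> span B \<Longrightarrow> z \<bullet> u = 0" using insert.prems(2) U by simp
        obtain U' z' where U': "subspace U'" "\<forall>u\<in>U'. z' \<bullet> u = 0" "dim U' = card B - 1"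
            "{x. x - z \<in> span B} \<inter> hyperplane p v = {x. x - z' \<in> U'}"
            "(norm z')\<^sup>2 = (norm z)\<^sup>2 + (p - z \<bullet> v)\<^sup>2 / (proj_norm B v)\<^sup>2"
          using flat_section[OF B zs False, of p] by blast
        have le: "?m \<le> dim U'" using insert.prems(3) card U'(3) B0(5) by simp
        have "(\<integral>\<^sup>+x. hit {x. x - z' \<in> U'} r (x ` I) \<partial>Pi\<^sub>M I (\<lambda>_. \<mu>))
          = ennreal (lam ^ ?m * flatc DIM('a) (dim U') ?m * gfun ?m (r\<^sup>2 - (norm z')\<^sup>2))"
          by (rule insert.IH[OF U'(1) bspec[OF U'(2)] le insert.prems(4)])
        moreover have "?A \<inter> hyperplane p v = {x. x - z' \<in> U'}" using U'(4) unfolding U .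
        moreover have "r\<^sup>2 - (norm z')\<^sup>2 = ?s - (p - z \<bullet> v)\<^sup>2 / (proj_norm B v)\<^sup>2" unfolding U'(5) by simp
        moreover have "dim U' = ?n - 1" unfolding U'(3) B0(5) ..
        ultimately have "?inner (p, v) = ennreal (?k * gfun ?m (?s - (p - z \<bullet> v)\<^sup>2 / (proj_norm B v)\<^sup>2))"
          unfolding inner by (simp only:)
        then show ?thesis by (simp only: ennreal_mult'[OF k])
      qed
      then have "(\<integral>\<^sup>+p. ?inner (p, v) \<partial>lborel)
        = (\<integral>\<^sup>+p. ennreal ?k * ennreal (gfun ?m (?s - (p - z \<bullet> v)\<^sup>2 / (proj_norm B v)\<^sup>2)) \<partial>lborel)"
        by (intro nn_integral_cong)
      also have "\<dots> = ennreal ?k * (\<integral>\<^sup>+p. ennreal (gfun ?m (?s - (p - z \<bullet> v)\<^sup>2 / (proj_norm B v)\<^sup>2)) \<partial>lborel)"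
      proof (rule nn_integral_cmult)
        have "(\<lambda>p. ?s - (p - z \<bullet> v)\<^sup>2 / (proj_norm B v)\<^sup>2) \<in> borel_measurable lborel" by simp
        from measurable_compose[OF measurable_compose[OF this gfun_measurable] measurable_ennreal]
        show "(\<lambda>p. ennreal (gfun ?m (?s - (p - z \<bullet> v)\<^sup>2 / (proj_norm B v)\<^sup>2))) \<in> borel_measurable lborel" .
      qed
      also have "\<dots> = ennreal ?k * ennreal (proj_norm B v * (kratio ?m * gfun (Suc ?m) ?s))"
        by (simp only: nn_integral_gfun_affine[OF pos])
      also have "\<dots> = ennreal (?k * (proj_norm B v * (kratio ?m * gfun (Suc ?m) ?s)))"
        by (rule ennreal_mult'[OF k, symmetric])
      also have "?k * (proj_norm B v * (kratio ?m * gfun (Suc ?m) ?s)) = (?k * kratio ?m * gfun (Suc ?m) ?s) * proj_norm B v"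
        by (simp only: mult_ac)
      also have "ennreal \<dots> = ennreal (?k * kratio ?m * gfun (Suc ?m) ?s) * ennreal (proj_norm B v)"
        by (rule ennreal_mult') (intro mult_nonneg_nonneg[OF mult_nonneg_nonneg[OF k]] gfun_nonneg less_imp_le[OF kratio_pos])
      finally show ?thesis .
    qed
  qed
  also have "\<dots> = ennreal lam * (ennreal (?k * kratio ?m * gfun (Suc ?m) ?s) * ennreal (mean_proj DIM('a) ?n))"
  proof -
    have m: "(\<lambda>v. ennreal (proj_norm B v)) \<in> borel_measurable (half_sphere_uniform e)"
      by (rule measurable_half_sphere_uniform) measurable
    show ?thesis
      by (subst nn_integral_cmult[OF m]) (simp only: nn_integral_proj_norm_half_sphere[OF B \<open>B \<noteq> {}\<close> e] B0(5))
  qed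
  also have "\<dots> = ennreal (lam * ((?k * kratio ?m * gfun (Suc ?m) ?s) * mean_proj DIM('a) ?n))"
  proof -
    have "?k * kratio ?m * gfun (Suc ?m) ?s \<ge> 0"
      by (intro mult_nonneg_nonneg[OF mult_nonneg_nonneg[OF k]] gfun_nonneg less_imp_le[OF kratio_pos])
    then show ?thesis using lam_pos by (simp only: ennreal_mult' less_imp_le)
  qed
  also have "lam * ((?k * kratio ?m * gfun (Suc ?m) ?s) * mean_proj DIM('a) ?n)
      = lam ^ card (insert i I) * flatc DIM('a) ?n (card (insert i I)) * gfun (card (insert i I)) ?s"
    unfolding card by (simp only: power_Suc flatc.simps mult_ac)
  finally show ?case .
qed

end

section \<open>The central limit theorem\<close>

lemma mean_proj_eq:
  assumes "n > 0"
  shows "mean_proj d n = real n * (unit_ball_vol (real n) / unit_ball_vol (real (n - 1))) *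
    (unit_ball_vol (real (d - 1)) / (real d * unit_ball_vol (real d)))"
  by (simp add: mean_proj_def)

text \<open>Along the recursion the quotients of ball volumes telescope: those of
  \<open>kratio\<close> to the volume in dimension \<open>m\<close>, those of
  \<open>mean_proj\<close> to the last quotient. The dimensions multiply to a falling
  factorial.\<close>

lemma flatc_eq:
  assumes "m \<le> n"
  shows "flatc d n m = unit_ball_vol (real m) * (unit_ball_vol (real (d - 1)) / (real d * unit_ball_vol (real d))) ^ m *
    (fact n / fact (n - m)) * (unit_ball_vol (real n) / unit_ball_vol (real (n - m)))"
  using assms
proof (induction m arbitrary: n)
  case 0
  have "unit_ball_vol (real n) \<noteq> 0" using unit_ball_vol_pos[of "real n"] by linarith
  then show ?case by simp
next
  case (Suc m)
  define R where "R = unit_ball_vol (real (d - 1)) / (real d * unit_ball_vol (real d))"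
  define \<kappa> where "\<kappa> j = unit_ball_vol (real j)" for j
  have \<kappa>: "\<kappa> j \<noteq> 0" for j using unit_ball_vol_pos[of "real j"] unfolding \<kappa>_def by linarith
  obtain n' where n: "n = Suc n'" "m \<le> n'" using Suc.prems by (cases n) auto
  have "flatc d n (Suc m) = flatc d n' m * (\<kappa> (Suc m) / \<kappa> m) * (real n * (\<kappa> n / \<kappa> n') * R)"
    using n mean_proj_eq[of n d] by (simp add: kratio_def \<kappa>_def R_def)
  also have "flatc d n' m = \<kappa> m * R ^ m * (fact n' / fact (n' - m)) * (\<kappa> n' / \<kappa> (n' - m))"
    unfolding \<kappa>_def R_def by (rule Suc.IH[OF n(2)])
  also have "\<kappa> m * R ^ m * (fact n' / fact (n' - m)) * (\<kappa> n' / \<kappa> (n' - m)) * (\<kappa> (Suc m) / \<kappa> m) * (real n * (\<kappa> n / \<kappa> n') * R)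
     = \<kappa> (Suc m) * (R ^ m * R) * ((real n * fact n') / fact (n' - m)) * (\<kappa> n / \<kappa> (n' - m))"
    using \<kappa>[of m] \<kappa>[of n'] by simp
  also have "R ^ m * R = R ^ Suc m" by simp
  also have "real n * fact n' = fact n" using n by simp
  also have "n' - m = n - Suc m" using n by simp
  finally show ?case by (simp only: \<kappa>_def R_def)
qed

text \<open>For \<open>n = d\<close> the falling factorial is \<open>fact m\<close> times a binomial
  coefficient, which belongs to \<open>a_const\<close>. The factor \<open>fact m\<close> accounts
  for ordered tuples, the ball volume for the normalization of the intensity.\<close>

lemma flatc_a_const:
  assumes "m \<le> d"
  shows "flatc d d m = fact m * (unit_ball_vol (real m) * a_const d (d - m))"
proof -
  have "d - (d - m) = m" "d - m \<le> d" using assms by auto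
  then have "real (d choose (d - m)) = fact d / (fact (d - m) * fact m)"
    using binomial_fact[of "d - m" d, where 'a = real] by simp
  then show ?thesis
    using assms by (simp add: flatc_eq a_const_def)
qed

lemma a_const_pos: "m \<le> d \<Longrightarrow> 0 < d \<Longrightarrow> a_const d (d - m) > 0"
  unfolding a_const_def by (intro mult_pos_pos divide_pos_pos zero_less_power) (auto simp: binomial_eq_0_iff)

lemma b_const_pos: "b_const (Suc a) > 0"
  unfolding b_const_def by (intro divide_pos_pos mult_pos_pos) auto

text \<open>The even index arises because the conditional mean is squared. The ball volumes in even
  and odd dimension then give the factorials that appear in \<open>b_const\<close>.\<close>

lemma kratio_even: "kratio (2 * a) = 2 ^ (2 * a + 1) * (fact a)\<^sup>2 / fact (2 * a + 1)"
proof -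
  have "unit_ball_vol (real (2 * a)) = pi ^ a / fact a"
    using unit_ball_vol_even[of a] by simp
  moreover have "unit_ball_vol (real (Suc (2 * a))) = 2 ^ (2 * a + 1) * fact a / fact (2 * a + 1) * pi ^ a"
  proof -
    \<comment> \<open>The odd-dimensional volume comes with \<open>a + 1\<close> in place of
      \<open>a\<close>; the common factor \<open>2 * (a + 1)\<close> is cancelled.\<close>
    define x where "x = 1 + real a"
    have x: "x \<noteq> 0" unfolding x_def by linarith
    have f: "fact (2 * (a + 1)) = (2 * x) * fact (2 * a + 1)" "fact (a + 1) = x * fact a"
      by (simp_all add: x_def)
    have "2 ^ (2 * (a + 1)) * fact (a + 1) / fact (2 * (a + 1)) = (2 * x) * (2 ^ (2 * a + 1) * fact a) / ((2 * x) * fact (2 * a + 1))"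
      unfolding f by (simp add: mult_ac)
    also have "\<dots> = 2 ^ (2 * a + 1) * fact a / fact (2 * a + 1)"
      by (rule nonzero_mult_divide_mult_cancel_left) (use x in simp)
    finally have *: "2 ^ (2 * (a + 1)) * fact (a + 1) / fact (2 * (a + 1)) = 2 ^ (2 * a + 1) * fact a / (fact (2 * a + 1) :: real)" .
    have "unit_ball_vol (real (Suc (2 * a))) = unit_ball_vol (2 * real a + 1)" by (simp add: add.commute)
    also have "\<dots> = 2 ^ (2 * (a + 1)) * fact (a + 1) / fact (2 * (a + 1)) * pi ^ a"
      using unit_ball_vol_odd[of a] by (simp add: add.commute)
    finally show ?thesis unfolding * .
  qed
  ultimately show ?thesis unfolding kratio_def by (simp add: power2_eq_square)
qed

lemma hyperplane_misses_ball:
  assumes "norm v = 1" "\<bar>p\<bar> > r"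
  shows "hyperplane p v \<inter> cball 0 r = {}"
proof -
  have "\<bar>p\<bar> \<le> r" if "x \<in> hyperplane p v" "x \<in> cball 0 r" for x
    using Cauchy_Schwarz_ineq2[of x v] assms(1) that by (simp add: hyperplane_def)
  then show ?thesis using assms(2) by fastforce
qed

text \<open>One factor of the cubic Taylor remainder is bounded by the maximum of \<open>g\<close>,
  so that the second moment controls the remainder.\<close>

lemma cube_le:
  fixes A g c :: real
  assumes "0 \<le> g" "g \<le> c"
  shows "\<bar>A * g\<bar> ^ Suc 2 / fact (Suc 2) \<le> \<bar>A\<bar> ^ 3 * c * g\<^sup>2"
proof -
  have "\<bar>A * g\<bar> ^ Suc 2 / fact (Suc 2) \<le> \<bar>A * g\<bar> ^ Suc 2 / 1"
    by (rule divide_left_mono) (simp_all add: fact_ge_1)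
  also have "\<dots> = \<bar>A\<bar> ^ 3 * g * g\<^sup>2"
    using assms(1) by (simp add: abs_mult power_mult_distrib power2_eq_square power3_eq_cube)
  also have "\<dots> \<le> \<bar>A\<bar> ^ 3 * c * g\<^sup>2"
    using assms by (intro mult_right_mono mult_left_mono) auto
  finally show ?thesis .
qed

lemma cube_scale:
  fixes u s c :: real
  assumes "s > 0"
  shows "\<bar>u / s\<bar> ^ 3 * c * s\<^sup>2 = \<bar>u\<bar> ^ 3 * c / s"
  using assms by (simp add: abs_divide power_divide power2_eq_square power3_eq_cube)

lemma iexp_taylor2: "(\<Sum>k\<le>2. (\<i> * complex_of_real y) ^ k / fact k) = 1 + \<i> * complex_of_real y - complex_of_real (y\<^sup>2 / 2)"
  by (simp add: numeral_2_eq_2 power_mult_distrib)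

lemma diff_one_diff_eq: "(z - 1) - (w - v) = z - ((1::'b::ring_1) + w - v)"
  by (simp add: algebra_simps)

section \<open>Conditional mean and variance of the number of flats\<close>

context isotropic_hyperplanes
begin

lemma nn_integral_hit_UNIV:
  assumes "finite (I :: nat set)" "card I \<le> DIM('a)" "r \<ge> 0"
  shows "(\<integral>\<^sup>+x. hit UNIV r (x ` I) \<partial>Pi\<^sub>M I (\<lambda>_. \<mu>)) =
    ennreal (lam ^ card I * flatc DIM('a) DIM('a) (card I) * r ^ card I)"
proof -
  have "gfun (card I) (r\<^sup>2) = r ^ card I" using assms(3) by (simp add: gfun_def not_less)
  then show ?thesis
    using nn_integral_hit[OF assms(1) subspace_UNIV, of 0 r] assms by simp
qed

text \<open>The hyperplane is itself a flat from which the cutting can start: its foot point is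
  \<open>p *\<^sub>R v\<close> and its direction space is the orthogonal complement of
  \<open>v\<close>.\<close>

lemma nn_integral_hit_hyperplane:
  assumes I: "finite (I :: nat set)" "Suc (card I) \<le> DIM('a)" and r: "r \<ge> 0" and y: "y \<in> space \<mu>"
  shows "(\<integral>\<^sup>+x. hit UNIV r (insert y (x ` I)) \<partial>Pi\<^sub>M I (\<lambda>_. \<mu>)) =
    ennreal (lam ^ card I * flatc DIM('a) (DIM('a) - 1) (card I) * gfun (card I) (r\<^sup>2 - (fst y)\<^sup>2))"
proof -
  obtain p v where pv: "y = (p, v)" by (cases y)
  have v: "norm v = 1" "v \<noteq> 0" using space_muD[OF y] by (auto simp: pv)
  let ?U = "{x. v \<bullet> x = 0}" and ?z = "p *\<^sub>R v"
  have dim: "dim ?U = DIM('a) - 1" using v(2) by (rule dim_hyperplane)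
  have vv: "v \<bullet> v = 1" using v(1) by (simp add: dot_square_norm)
  have "hyperplane p v = {x. x - ?z \<in> ?U}"
    by (auto simp: hyperplane_def inner_diff_right vv inner_commute)
  then have "hit UNIV r (insert y Y) = hit {x. x - ?z \<in> ?U} r Y" for Y
    by (simp only: hit_insert pv fst_conv snd_conv Int_UNIV_left)
  moreover have "(\<integral>\<^sup>+x. hit {x. x - ?z \<in> ?U} r (x ` I) \<partial>Pi\<^sub>M I (\<lambda>_. \<mu>)) =
     ennreal (lam ^ card I * flatc DIM('a) (dim ?U) (card I) * gfun (card I) (r\<^sup>2 - (norm ?z)\<^sup>2))"
    by (rule nn_integral_hit[OF I(1) subspace_hyperplane]) (use I r dim in auto)
  moreover have "(norm ?z)\<^sup>2 = (fst y)\<^sup>2" using v by (simp add: pv)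
  ultimately show ?thesis by (simp only: dim)
qed

text \<open>As the normal vectors have norm 1, these are the hyperplanes that can meet the ball of
  radius \<open>r\<close>. Their mean number \<open>2 * lam * r\<close> is the parameter of the
  overlap bound.\<close>

definition window :: "real \<Rightarrow> (real \<times> 'a) set" where
  "window r = {- r..r} \<times> half_sphere e"

lemma window: "window r \<in> sets \<mu>" "r \<ge> 0 \<Longrightarrow> emeasure \<mu> (window r) = ennreal (2 * lam * r)"
proof -
  have eq: "window r = {- r..r} \<times> space (half_sphere_uniform e)"
    by (simp add: window_def space_half_sphere_uniform)
  show "window r \<in> sets \<mu>" unfolding eq by auto
  show "emeasure \<mu> (window r) = ennreal (2 * lam * r)" if "r \<ge> 0"
    unfolding eq using that lam_pos by (simp add: emeasure_mu_strip ennreal_mult'[symmetric])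
qed

lemma window_iff: "y \<in> space \<mu> \<Longrightarrow> y \<in> window r \<longleftrightarrow> \<bar>fst y\<bar> \<le> r"
  by (cases y) (auto simp: window_def space_mu space_half_sphere_uniform abs_le_iff)

lemma hit_outside_window:
  assumes "Y \<subseteq> space \<mu>" "\<not> Y \<subseteq> window r"
  shows "hit UNIV r Y = 0"
proof -
  obtain y where y: "y \<in> Y" "y \<notin> window r" using assms(2) by blast
  then have ys: "y \<in> space \<mu>" using assms(1) by blast
  have "hyperplane (fst y) (snd y) \<inter> cball 0 r = {}"
    using hyperplane_misses_ball[OF space_muD[OF ys]] window_iff[OF ys] y(2) by simp
  then have "UNIV \<inter> (\<Inter>y\<in>Y. hyperplane (fst y) (snd y)) \<inter> cball 0 r = {}" using y(1) by blast
  then show ?thesis unfolding hit_def by simp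
qed

lemma hit_le_1: "hit A r Y \<le> 1"
  by (simp add: hit_def)

text \<open>The conditional mean number of flats of dimension \<open>DIM('a) - Suc a\<close> hitting the ball that lie in a given hyperplane.\<close>

definition proj_coeff :: "nat \<Rightarrow> real" where
  "proj_coeff a = lam ^ a * flatc DIM('a) (DIM('a) - 1) a / fact a"

definition proj_fun :: "nat \<Rightarrow> real \<Rightarrow> real \<times> 'a \<Rightarrow> real" where
  "proj_fun a r y = proj_coeff a * gfun a (r\<^sup>2 - (fst y)\<^sup>2)"

lemma proj_coeff_nonneg: "proj_coeff a \<ge> 0"
  unfolding proj_coeff_def
  by (intro divide_nonneg_nonneg mult_nonneg_nonneg zero_le_power less_imp_le[OF lam_pos] flatc_nonneg) simp

lemma proj_fun_nonneg: "proj_fun a r y \<ge> 0"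
  unfolding proj_fun_def by (intro mult_nonneg_nonneg proj_coeff_nonneg gfun_nonneg)

lemma proj_fun_measurable: "proj_fun a r \<in> borel_measurable \<mu>"
proof -
  have "(\<lambda>y. r\<^sup>2 - (fst y)\<^sup>2) \<in> borel_measurable \<mu>"
    by (intro borel_measurable_diff borel_measurable_power fst_measurable_mu borel_measurable_const)
  from measurable_compose[OF this gfun_measurable] show ?thesis
    unfolding proj_fun_def[abs_def] by (intro borel_measurable_times borel_measurable_const)
qed

lemma gfun_le: "r \<ge> 0 \<Longrightarrow> gfun a (r\<^sup>2 - p\<^sup>2) \<le> r ^ a"
proof -
  assume r: "r \<ge> 0"
  have "sqrt (r\<^sup>2 - p\<^sup>2) \<le> sqrt (r\<^sup>2)" by (rule real_sqrt_le_mono) simp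
  then have "sqrt (r\<^sup>2 - p\<^sup>2) \<le> r" using r by simp
  then show ?thesis using r by (auto simp: gfun_def not_less intro!: power_mono)
qed

lemma proj_fun_le: "r \<ge> 0 \<Longrightarrow> proj_fun a r y \<le> proj_coeff a * r ^ a"
  unfolding proj_fun_def by (intro mult_left_mono gfun_le proj_coeff_nonneg)

lemma proj_fun_outside: "r \<ge> 0 \<Longrightarrow> y \<in> space \<mu> \<Longrightarrow> y \<notin> window r \<Longrightarrow> proj_fun a r y = 0"
proof -
  assume "r \<ge> 0" "y \<in> space \<mu>" "y \<notin> window r"
  then have "r < \<bar>fst y\<bar>" by (simp add: window_iff)
  then have "r\<^sup>2 < (fst y)\<^sup>2" using \<open>r \<ge> 0\<close> power_strict_mono[of r "\<bar>fst y\<bar>" 2] by simp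
  then show ?thesis by (simp add: proj_fun_def gfun_def)
qed

lemma nn_integral_mu_gfun:
  "(\<integral>\<^sup>+y. ennreal (gfun n (r\<^sup>2 - (fst y)\<^sup>2)) \<partial>\<mu>) = ennreal (lam * (kratio n * gfun (Suc n) (r\<^sup>2)))"
proof -
  have m: "(\<lambda>y. ennreal (gfun n (r\<^sup>2 - (fst y)\<^sup>2))) \<in> borel_measurable \<mu>"
    by (intro measurable_compose[OF _ measurable_ennreal] measurable_compose[OF _ gfun_measurable]
      borel_measurable_diff borel_measurable_power fst_measurable_mu borel_measurable_const)
  have "(\<integral>\<^sup>+y. ennreal (gfun n (r\<^sup>2 - (fst y)\<^sup>2)) \<partial>\<mu>)
    = ennreal lam * (\<integral>\<^sup>+v. (\<integral>\<^sup>+p. ennreal (gfun n (r\<^sup>2 - p\<^sup>2)) \<partial>lborel) \<partial>half_sphere_uniform e)"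
    unfolding nn_integral_mu[OF m] by simp
  also have "\<dots> = ennreal lam * ennreal (kratio n * gfun (Suc n) (r\<^sup>2))"
    unfolding nn_integral_gfun by (simp add: Q.emeasure_space_1)
  finally show ?thesis using lam_pos by (simp only: ennreal_mult' less_imp_le)
qed

lemma gfun_r: "r \<ge> 0 \<Longrightarrow> gfun n (r\<^sup>2) = r ^ n"
  by (simp add: gfun_def not_less)

lemma nn_integral_proj_fun:
  assumes r: "r \<ge> 0"
  shows "(\<integral>\<^sup>+y. ennreal (proj_fun a r y) \<partial>\<mu>) = ennreal (proj_coeff a * (lam * (kratio a * r ^ Suc a)))"
    and "(\<integral>\<^sup>+y. ennreal (proj_fun a r y) * ennreal (proj_fun a r y) \<partial>\<mu>)
      = ennreal ((proj_coeff a)\<^sup>2 * (lam * (kratio (2 * a) * r ^ Suc (2 * a))))"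
proof -
  have m: "(\<lambda>y. ennreal (gfun n (r\<^sup>2 - (fst y)\<^sup>2))) \<in> borel_measurable \<mu>" for n
    by (intro measurable_compose[OF _ measurable_ennreal] measurable_compose[OF _ gfun_measurable]
      borel_measurable_diff borel_measurable_power fst_measurable_mu borel_measurable_const)
  have "(\<integral>\<^sup>+y. ennreal (proj_fun a r y) \<partial>\<mu>) = (\<integral>\<^sup>+y. ennreal (proj_coeff a) * ennreal (gfun a (r\<^sup>2 - (fst y)\<^sup>2)) \<partial>\<mu>)"
    by (simp only: proj_fun_def ennreal_mult'[OF proj_coeff_nonneg])
  also have "\<dots> = ennreal (proj_coeff a) * ennreal (lam * (kratio a * gfun (Suc a) (r\<^sup>2)))"
    by (simp only: nn_integral_cmult[OF m] nn_integral_mu_gfun)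
  finally show "(\<integral>\<^sup>+y. ennreal (proj_fun a r y) \<partial>\<mu>) = ennreal (proj_coeff a * (lam * (kratio a * r ^ Suc a)))"
    by (simp only: ennreal_mult'[OF proj_coeff_nonneg] gfun_r[OF r])
  have "ennreal (proj_fun a r y) * ennreal (proj_fun a r y) = ennreal ((proj_coeff a)\<^sup>2) * ennreal (gfun (2 * a) (r\<^sup>2 - (fst y)\<^sup>2))" for y
  proof -
    have "ennreal (proj_fun a r y) * ennreal (proj_fun a r y) = ennreal (proj_fun a r y * proj_fun a r y)"
      by (rule ennreal_mult'[OF proj_fun_nonneg, symmetric])
    also have "proj_fun a r y * proj_fun a r y = (proj_coeff a)\<^sup>2 * gfun (2 * a) (r\<^sup>2 - (fst y)\<^sup>2)"
      unfolding gfun_square[symmetric] proj_fun_def power2_eq_square[of "proj_coeff a"] by (simp only: mult_ac)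
    also have "ennreal \<dots> = ennreal ((proj_coeff a)\<^sup>2) * ennreal (gfun (2 * a) (r\<^sup>2 - (fst y)\<^sup>2))"
      by (rule ennreal_mult') simp
    finally show ?thesis .
  qed
  then have "(\<integral>\<^sup>+y. ennreal (proj_fun a r y) * ennreal (proj_fun a r y) \<partial>\<mu>)
    = ennreal ((proj_coeff a)\<^sup>2) * ennreal (lam * (kratio (2 * a) * gfun (Suc (2 * a)) (r\<^sup>2)))"
    by (simp only: nn_integral_cmult[OF m] nn_integral_mu_gfun)
  also have "\<dots> = ennreal ((proj_coeff a)\<^sup>2 * (lam * (kratio (2 * a) * gfun (Suc (2 * a)) (r\<^sup>2))))"
    by (rule ennreal_mult'[symmetric]) simp
  finally show "(\<integral>\<^sup>+y. ennreal (proj_fun a r y) * ennreal (proj_fun a r y) \<partial>\<mu>)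
      = ennreal ((proj_coeff a)\<^sup>2 * (lam * (kratio (2 * a) * r ^ Suc (2 * a))))"
    by (simp only: gfun_r[OF r])
qed

definition flats :: "nat \<Rightarrow> real \<Rightarrow> 'w \<Rightarrow> real" where
  "flats a r \<omega> = enn2real (ustat (Suc a) (hit UNIV r) \<omega>)"

definition mean_flats :: "nat \<Rightarrow> real \<Rightarrow> real" where
  "mean_flats a r = lam ^ Suc a * (unit_ball_vol (real (Suc a)) * a_const DIM('a) (DIM('a) - Suc a)) * r ^ Suc a"

text \<open>The factor of \<open>r ^ Suc (2 * a)\<close> in the integral of the squared conditional
  mean, which is the variance of the linear statistic.\<close>

definition var_coeff :: "nat \<Rightarrow> real" where
  "var_coeff a = (proj_coeff a)\<^sup>2 * (lam * kratio (2 * a))"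

definition lin_flats :: "nat \<Rightarrow> real \<Rightarrow> 'w \<Rightarrow> real" where
  "lin_flats a r \<omega> = enn2real (lin (proj_fun a r) \<omega>)"

text \<open>For \<open>Suc a \<le> DIM('a)\<close> this is \<open>Suc a\<close> times
  \<open>mean_flats a r\<close>: each flat is counted once in every one of the \<open>Suc a\<close>
  hyperplanes that define it.\<close>

definition mean_lin :: "nat \<Rightarrow> real \<Rightarrow> real" where
  "mean_lin a r = proj_coeff a * (lam * (kratio a * r ^ Suc a))"

text \<open>The overlap bound is used with \<open>T = 2 * lam * r\<close>. Its order
  \<open>r ^ (2 * a)\<close> is one power below the variance, so the difference vanishes after
  standardization.\<close>

lemma flats_L2:
  assumes a: "Suc a \<le> DIM('a)" and r: "2 * lam * r \<ge> 1" "r \<ge> 0"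
  defines "D \<equiv> \<lambda>\<omega>. (flats a r \<omega> - mean_flats a r) - (lin_flats a r \<omega> - mean_lin a r)"
  shows "integrable M (\<lambda>\<omega>. (D \<omega>)\<^sup>2)"
    "(\<integral>\<omega>. (D \<omega>)\<^sup>2 \<partial>M) \<le> 4 ^ (2 * a) * fact (2 * a) * exp 2 * (2 * lam) ^ (2 * a) * r ^ (2 * a)"
proof -
  have q: "2 * Suc a - 2 = 2 * a" by simp
  have ov: "(\<integral>\<^sup>+\<omega>. overlap (Suc a) (Suc a) (hit UNIV r) (hit UNIV r) \<omega> \<partial>M)
      \<le> ennreal (4 ^ (2 * a) * fact (2 * a) * exp 2 * (2 * lam * r) ^ (2 * a))"
    using nn_integral_overlap_le[where F = "hit UNIV r" and n = "Suc a", OF window(1) window(2)[OF r(2)] r(1) hit_le_1 hit_outside_window]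
    unfolding q .
  have fact: "(fact n :: ennreal) = ennreal (fact n)" for n
    by (metis ennreal_of_nat_eq_real_of_nat of_nat_fact)
  have m: "(\<integral>\<^sup>+x. hit UNIV r (x ` I) \<partial>Pi\<^sub>M I (\<lambda>_. \<mu>)) = fact (Suc a) * ennreal (mean_flats a r)"
    if I: "finite I" "card I = Suc a" for I :: "nat set"
  proof -
    have "lam ^ card I * flatc DIM('a) DIM('a) (card I) * r ^ card I = fact (Suc a) * mean_flats a r"
      unfolding I(2) flatc_a_const[OF a] mean_flats_def by (simp only: mult_ac)
    then show ?thesis
      using nn_integral_hit_UNIV[OF I(1) _ r(2)] I a unfolding fact by (simp only: ennreal_mult' fact_ge_zero)
  qed
  have g: "(\<integral>\<^sup>+x. hit UNIV r (insert y (x ` I)) \<partial>Pi\<^sub>M I (\<lambda>_. \<mu>)) = fact a * ennreal (proj_fun a r y)"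
    if I: "finite I" "card I = a" and y: "y \<in> space \<mu>" for I :: "nat set" and y
  proof -
    have "lam ^ a * flatc DIM('a) (DIM('a) - 1) a * gfun a (r\<^sup>2 - (fst y)\<^sup>2) = fact a * proj_fun a r y"
      by (simp add: proj_fun_def proj_coeff_def)
    then show ?thesis
      using nn_integral_hit_hyperplane[OF I(1) _ r(2) y] I a unfolding fact by (simp only: ennreal_mult' fact_ge_zero)
  qed
  have nn: "mean_flats a r \<ge> 0"
    unfolding mean_flats_def
    by (intro mult_nonneg_nonneg zero_le_power less_imp_le[OF lam_pos] less_imp_le[OF a_const_pos] unit_ball_vol_nonneg r(2) a) simp_all
  have k: "kratio j \<ge> 0" for j using kratio_pos[of j] by simp
  have nn2: "proj_coeff a * (lam * (kratio a * r ^ Suc a)) \<ge> 0"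
    "(proj_coeff a)\<^sup>2 * (lam * (kratio (2 * a) * r ^ Suc (2 * a))) \<ge> 0"
    by (intro mult_nonneg_nonneg zero_le_power zero_le_power2 less_imp_le[OF lam_pos] proj_coeff_nonneg r(2) k)+
  have nn3: "4 ^ (2 * a) * fact (2 * a) * exp 2 * (2 * lam * r) ^ (2 * a) \<ge> (0::real)"
    using r lam_pos by simp
  note L2 = ustat_lin_L2[OF kernel_hit proj_fun_measurable proj_fun_nonneg m nn g
    nn_integral_proj_fun(1)[OF r(2)] nn2(1) nn_integral_proj_fun(2)[OF r(2)] nn2(2) ov nn3]
  show "integrable M (\<lambda>\<omega>. (D \<omega>)\<^sup>2)"
    unfolding D_def flats_def lin_flats_def mean_lin_def by (rule L2(1))
  have "(\<integral>\<omega>. (D \<omega>)\<^sup>2 \<partial>M) \<le> 4 ^ (2 * a) * fact (2 * a) * exp 2 * (2 * lam * r) ^ (2 * a)"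
    unfolding D_def flats_def lin_flats_def mean_lin_def by (rule L2(2))
  then show "(\<integral>\<omega>. (D \<omega>)\<^sup>2 \<partial>M) \<le> 4 ^ (2 * a) * fact (2 * a) * exp 2 * (2 * lam) ^ (2 * a) * r ^ (2 * a)"
    by (simp only: power_mult_distrib mult.assoc)
qed

lemma flats_measurable[measurable]: "flats a r \<in> borel_measurable M"
  unfolding flats_def[abs_def] using ustat_measurable[OF kernel_hit] by measurable

lemma lin_flats_measurable[measurable]: "lin_flats a r \<in> borel_measurable M"
  unfolding lin_flats_def[abs_def] using lin_measurable[OF proj_fun_measurable] by measurable

lemma expectation_flats:
  assumes a: "Suc a \<le> DIM('a)" and r: "r \<ge> 0"
  shows "(\<integral>\<omega>. flats a r \<omega> \<partial>M) = mean_flats a r"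
proof -
  have fact: "(fact n :: ennreal) = ennreal (fact n)" for n
    by (metis ennreal_of_nat_eq_real_of_nat of_nat_fact)
  have nn: "mean_flats a r \<ge> 0"
    unfolding mean_flats_def
    by (intro mult_nonneg_nonneg zero_le_power less_imp_le[OF lam_pos] less_imp_le[OF a_const_pos] unit_ball_vol_nonneg r a) simp_all
  have "lam ^ Suc a * flatc DIM('a) DIM('a) (Suc a) * r ^ Suc a = fact (Suc a) * mean_flats a r"
    unfolding flatc_a_const[OF a] mean_flats_def by (simp only: mult_ac)
  then have "(\<integral>\<^sup>+x. hit UNIV r (x ` {..<Suc a}) \<partial>Pi\<^sub>M {..<Suc a} (\<lambda>_. \<mu>)) = fact (Suc a) * ennreal (mean_flats a r)"
    using nn_integral_hit_UNIV[of "{..<Suc a}" r] a r unfolding fact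
    by (simp only: ennreal_mult' fact_ge_zero finite_lessThan card_lessThan)
  then have "ennreal (fact (Suc a)) * (\<integral>\<^sup>+\<omega>. ustat (Suc a) (hit UNIV r) \<omega> \<partial>M) = ennreal (fact (Suc a)) * ennreal (mean_flats a r)"
    using nn_integral_ustat[OF kernel_hit, of "Suc a" r] unfolding fact by (simp only:)
  then have "(\<integral>\<^sup>+\<omega>. ustat (Suc a) (hit UNIV r) \<omega> \<partial>M) = ennreal (mean_flats a r)"
    by (rule ennreal_mult_left_cancel_real[rotated]) (rule fact_gt_zero)
  from enn2real_moment(2)[OF ustat_measurable[OF kernel_hit] this nn]
  show ?thesis unfolding flats_def .
qed

text \<open>Second-order Taylor expansion of \<open>iexp\<close> under the integral. The linear term
  is the mean, and the choice of \<open>s\<close> normalizes the quadratic term to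
  \<open>u\<^sup>2 / 2\<close>. The cubic remainder carries the ratio of the maximal conditional
  mean, of order \<open>r ^ a\<close>, to \<open>s\<close>, of order
  \<open>r ^ a * sqrt r\<close>.\<close>

lemma char_lin_flats:
  assumes r: "r > 0" and v: "var_coeff a > 0"
  defines "s \<equiv> sqrt (var_coeff a * r ^ Suc (2 * a))"
  shows "cmod ((CLINT x|\<mu>. iexp (u / s * proj_fun a r x) - 1) - \<i> * complex_of_real (u / s * mean_lin a r) + complex_of_real (u\<^sup>2 / 2))
    \<le> \<bar>u\<bar> ^ 3 * proj_coeff a * r ^ a / s"
proof -
  let ?g = "proj_fun a r" and ?t = "u / s"
  have r0: "r \<ge> 0" using r by simp
  have s: "s > 0" "s\<^sup>2 = var_coeff a * r ^ Suc (2 * a)" unfolding s_def using r v by (simp_all add: less_imp_le)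
  note proj_fun_measurable[measurable]
  have k: "kratio j \<ge> 0" for j using kratio_pos[of j] by simp
  have int1: "integrable \<mu> ?g" "(\<integral>x. ?g x \<partial>\<mu>) = mean_lin a r"
  proof -
    have nn: "mean_lin a r \<ge> 0" unfolding mean_lin_def
      by (intro mult_nonneg_nonneg zero_le_power less_imp_le[OF lam_pos] proj_coeff_nonneg r0 k)
    have I: "(\<integral>\<^sup>+x. ennreal (?g x) \<partial>\<mu>) = ennreal (mean_lin a r)"
      unfolding mean_lin_def by (rule nn_integral_proj_fun(1)[OF r0])
    show "integrable \<mu> ?g"
      by (rule integrableI_nn_integral_finite[OF proj_fun_measurable _ I]) (simp add: proj_fun_nonneg)
    show "(\<integral>x. ?g x \<partial>\<mu>) = mean_lin a r"
      by (rule integral_eq_nn_integral[THEN trans]) (use I nn in \<open>auto simp: proj_fun_nonneg\<close>)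
  qed
  have int2: "integrable \<mu> (\<lambda>x. (?g x)\<^sup>2)" "(\<integral>x. (?g x)\<^sup>2 \<partial>\<mu>) = s\<^sup>2"
  proof -
    have "ennreal ((?g x)\<^sup>2) = ennreal (?g x) * ennreal (?g x)" for x
      unfolding power2_eq_square by (rule ennreal_mult'[OF proj_fun_nonneg])
    then have I: "(\<integral>\<^sup>+x. ennreal ((?g x)\<^sup>2) \<partial>\<mu>) = ennreal (s\<^sup>2)"
      unfolding s(2) var_coeff_def using nn_integral_proj_fun(2)[OF r0, of a] by (simp only: mult.assoc)
    show "integrable \<mu> (\<lambda>x. (?g x)\<^sup>2)"
      by (rule integrableI_nn_integral_finite[OF _ _ I]) simp_all
    show "(\<integral>x. (?g x)\<^sup>2 \<partial>\<mu>) = s\<^sup>2"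
      by (rule integral_eq_nn_integral[THEN trans]) (use I in auto)
  qed
  let ?h = "\<lambda>x. iexp (?t * ?g x) - 1"
  \<comment> \<open>The Taylor polynomial of second order without its constant term, which
    \<open>?h\<close> has already subtracted.\<close>
  let ?q = "\<lambda>x. \<i> * complex_of_real (?t * ?g x) - complex_of_real (?t\<^sup>2 / 2 * (?g x)\<^sup>2)"
  have h_int: "integrable \<mu> ?h"
  proof (rule Bochner_Integration.integrable_bound[of \<mu> "\<lambda>x. \<bar>?t\<bar> * ?g x"])
    show "integrable \<mu> (\<lambda>x. \<bar>?t\<bar> * ?g x)" using int1 by simp
    show "AE x in \<mu>. norm (?h x) \<le> norm (\<bar>?t\<bar> * ?g x)"
      using norm_iexp_diff[of "?t * ?g x" 0 for x] by (intro AE_I2) (simp add: abs_mult)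
  qed measurable
  have q_int: "integrable \<mu> ?q" "(CLINT x|\<mu>. ?q x) = \<i> * complex_of_real (?t * mean_lin a r) - complex_of_real (u\<^sup>2 / 2)"
  proof -
    have i1: "integrable \<mu> (\<lambda>x. \<i> * complex_of_real (?t * ?g x))"
      by (intro integrable_mult_right integrable_of_real int1)
    have i2: "integrable \<mu> (\<lambda>x. complex_of_real (?t\<^sup>2 / 2 * (?g x)\<^sup>2))"
      by (intro integrable_mult_right integrable_of_real int2)
    show "integrable \<mu> ?q" by (rule Bochner_Integration.integrable_diff[OF i1 i2])
    have "(CLINT x|\<mu>. ?q x) = (CLINT x|\<mu>. \<i> * complex_of_real (?t * ?g x)) - (CLINT x|\<mu>. complex_of_real (?t\<^sup>2 / 2 * (?g x)\<^sup>2))"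
      by (rule Bochner_Integration.integral_diff[OF i1 i2])
    also have "(CLINT x|\<mu>. \<i> * complex_of_real (?t * ?g x)) = \<i> * complex_of_real (?t * mean_lin a r)"
      by (simp only: integral_mult_right_zero integral_complex_of_real int1)
    also have "(CLINT x|\<mu>. complex_of_real (?t\<^sup>2 / 2 * (?g x)\<^sup>2)) = complex_of_real (?t\<^sup>2 / 2 * s\<^sup>2)"
      by (simp only: integral_mult_right_zero integral_complex_of_real int2)
    also have "?t\<^sup>2 / 2 * s\<^sup>2 = u\<^sup>2 / 2" using s(1) by (simp add: power_divide)
    finally show "(CLINT x|\<mu>. ?q x) = \<i> * complex_of_real (?t * mean_lin a r) - complex_of_real (u\<^sup>2 / 2)" .
  qed
  have bd: "cmod (?h x - ?q x) \<le> \<bar>?t\<bar> ^ 3 * (proj_coeff a * r ^ a) * (?g x)\<^sup>2" for x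
  proof -
    have e2: "(?t * ?g x)\<^sup>2 / 2 = ?t\<^sup>2 / 2 * (?g x)\<^sup>2"
      by (simp add: power_mult_distrib power_divide)
    have "?h x - ?q x = iexp (?t * ?g x) - (\<Sum>k\<le>2. (\<i> * complex_of_real (?t * ?g x)) ^ k / fact k)"
      unfolding iexp_taylor2 e2 by (rule diff_one_diff_eq)
    also have "cmod \<dots> \<le> \<bar>?t * ?g x\<bar> ^ Suc 2 / fact (Suc 2)" by (rule iexp_approx1)
    also have "\<dots> \<le> \<bar>?t\<bar> ^ 3 * (proj_coeff a * r ^ a) * (?g x)\<^sup>2"
      by (rule cube_le[OF proj_fun_nonneg proj_fun_le[OF r0]])
    finally show ?thesis .
  qed
  have eq: "(CLINT x|\<mu>. ?h x) - \<i> * complex_of_real (?t * mean_lin a r) + complex_of_real (u\<^sup>2 / 2) = (CLINT x|\<mu>. ?h x - ?q x)"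
    unfolding Bochner_Integration.integral_diff[OF h_int q_int(1)] q_int(2) by simp
  have "cmod (CLINT x|\<mu>. ?h x - ?q x) \<le> (\<integral>x. \<bar>?t\<bar> ^ 3 * (proj_coeff a * r ^ a) * (?g x)\<^sup>2 \<partial>\<mu>)"
  proof (rule integral_norm_le_AE)
    show "integrable \<mu> (\<lambda>x. ?h x - ?q x)" by (rule Bochner_Integration.integrable_diff[OF h_int q_int(1)])
    show "integrable \<mu> (\<lambda>x. \<bar>?t\<bar> ^ 3 * (proj_coeff a * r ^ a) * (?g x)\<^sup>2)" by (rule integrable_mult_right[OF int2(1)])
    show "AE x in \<mu>. cmod (?h x - ?q x) \<le> \<bar>?t\<bar> ^ 3 * (proj_coeff a * r ^ a) * (?g x)\<^sup>2" by (intro AE_I2 bd)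
  qed
  also have "\<dots> = \<bar>?t\<bar> ^ 3 * (proj_coeff a * r ^ a) * s\<^sup>2"
    unfolding integral_mult_right_zero int2(2) by (rule refl)
  also have "\<dots> = \<bar>u\<bar> ^ 3 * proj_coeff a * r ^ a / s"
    by (rule trans[OF cube_scale[OF s(1)]]) (rule arg_cong[where f = "\<lambda>x. x / s", OF mult.assoc[symmetric]])
  finally show ?thesis unfolding eq .
qed

end

section \<open>Convergence of the characteristic functions\<close>

context isotropic_hyperplanes
begin

text \<open>The scale is the standard deviation of the linear statistic, which agrees asymptotically
  with that of the number of flats when \<open>var_coeff a > 0\<close>.\<close>

definition std_flats :: "nat \<Rightarrow> real \<Rightarrow> 'w \<Rightarrow> real" where
  "std_flats a r \<omega> = (flats a r \<omega> - mean_flats a r) / sqrt (var_coeff a * r ^ Suc (2 * a))"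

lemma std_flats_measurable[measurable]: "std_flats a r \<in> borel_measurable M"
  unfolding std_flats_def[abs_def] by measurable

lemma char_lin_part:
  assumes r: "r > 0"
  shows "(CLINT \<omega>|M. iexp (u * ((lin_flats a r \<omega> - mean_lin a r) / s))) =
    exp ((CLINT x|\<mu>. iexp (u / s * proj_fun a r x) - 1) - \<i> * complex_of_real (u / s * mean_lin a r))"
proof -
  have r0: "r \<ge> 0" "0 \<le> 2 * lam * r" using r lam_pos by simp_all
  have C: "(CLINT \<omega>|M. iexp (u / s * lin_flats a r \<omega>)) = exp (CLINT x|\<mu>. iexp (u / s * proj_fun a r x) - 1)"
    unfolding lin_flats_def
    by (rule char_lin[OF proj_fun_measurable proj_fun_nonneg proj_fun_le[OF r0(1)] proj_fun_outside[OF r0(1)]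
      window(1) window(2)[OF r0(1)] r0(2)])
  have "iexp (u * ((lin_flats a r \<omega> - mean_lin a r) / s)) =
      iexp (- (u / s * mean_lin a r)) * iexp (u / s * lin_flats a r \<omega>)" for \<omega>
  proof -
    have "u * ((lin_flats a r \<omega> - mean_lin a r) / s) = - (u / s * mean_lin a r) + u / s * lin_flats a r \<omega>"
      by (simp add: algebra_simps diff_divide_distrib)
    then show ?thesis by (simp only: of_real_add distrib_left exp_add)
  qed
  then have "(CLINT \<omega>|M. iexp (u * ((lin_flats a r \<omega> - mean_lin a r) / s))) =
      iexp (- (u / s * mean_lin a r)) * exp (CLINT x|\<mu>. iexp (u / s * proj_fun a r x) - 1)"
    by (simp only: integral_mult_right_zero C)
  then show ?thesis by (simp only: of_real_minus mult_minus_right exp_add[symmetric] add.commute[of "- _"] diff_conv_add_uminus)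
qed

text \<open>Only the second moment of the difference is available, whereas the Lipschitz bound of
  \<open>iexp\<close> asks for a first moment. The inequality
  \<open>\<bar>x\<bar> \<le> (\<delta> + x\<^sup>2 / \<delta>) / 2\<close> bridges the gap.\<close>

lemma cmod_char_diff:
  assumes a: "Suc a \<le> DIM('a)" and v: "var_coeff a > 0" and r: "2 * lam * r \<ge> 1" "r > 0"
  defines "s \<equiv> sqrt (var_coeff a * r ^ Suc (2 * a))"
  shows "cmod (char (distr M borel (std_flats a r)) u - (CLINT \<omega>|M. iexp (u * ((lin_flats a r \<omega> - mean_lin a r) / s))))
    \<le> \<bar>u\<bar> * (1 + 4 ^ (2 * a) * fact (2 * a) * exp 2 * (2 * lam) ^ (2 * a) / var_coeff a) / 2 / sqrt r"
proof -
  let ?D = "\<lambda>\<omega>. (flats a r \<omega> - mean_flats a r) - (lin_flats a r \<omega> - mean_lin a r)"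
  let ?K = "4 ^ (2 * a) * fact (2 * a) * exp 2 * (2 * lam) ^ (2 * a)"
  let ?Y = "\<lambda>\<omega>. (lin_flats a r \<omega> - mean_lin a r) / s"
  have s: "s > 0" "s\<^sup>2 = var_coeff a * r ^ Suc (2 * a)" unfolding s_def using r v by (simp_all add: less_imp_le)
  note L2 = flats_L2[OF a r(1) less_imp_le[OF r(2)]]
  \<comment> \<open>The squared standardized difference has a mean of order \<open>1 / r\<close>;
    this weight makes both terms of the bound of order \<open>1 / sqrt r\<close>.\<close>
  define \<delta> where "\<delta> = 1 / sqrt r"
  have \<delta>: "\<delta> > 0" unfolding \<delta>_def using r by simp
  have iY: "integrable M (\<lambda>\<omega>. iexp (u * ?Y \<omega>))"
    by (rule integrable_const_bound[of _ 1]) auto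
  have iZ: "integrable M (\<lambda>\<omega>. iexp (u * std_flats a r \<omega>))"
    by (rule integrable_const_bound[of _ 1]) auto
  have Z: "std_flats a r \<omega> - ?Y \<omega> = ?D \<omega> / s" for \<omega>
    unfolding std_flats_def s_def[symmetric] by (simp only: diff_divide_distrib)
  have amgm: "\<bar>x\<bar> \<le> (\<delta> + x\<^sup>2 / \<delta>) / 2" for x
  proof -
    have "0 \<le> (\<bar>x\<bar> - \<delta>)\<^sup>2" by simp
    then have "2 * \<bar>x\<bar> * \<delta> \<le> x\<^sup>2 + \<delta>\<^sup>2" by (simp add: power2_diff)
    then show ?thesis using \<delta> by (simp add: field_simps power2_eq_square)
  qed
  have bd: "cmod (iexp (u * std_flats a r \<omega>) - iexp (u * ?Y \<omega>)) \<le> \<bar>u\<bar> * (\<delta> + (?D \<omega>)\<^sup>2 / s\<^sup>2 / \<delta>) / 2" for \<omega>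
  proof -
    have "cmod (iexp (u * std_flats a r \<omega>) - iexp (u * ?Y \<omega>)) \<le> \<bar>u * std_flats a r \<omega> - u * ?Y \<omega>\<bar>"
      by (rule norm_iexp_diff)
    also have "\<dots> = \<bar>u\<bar> * \<bar>?D \<omega> / s\<bar>" unfolding right_diff_distrib[symmetric] Z abs_mult ..
    also have "\<dots> \<le> \<bar>u\<bar> * ((\<delta> + (?D \<omega> / s)\<^sup>2 / \<delta>) / 2)" by (intro mult_left_mono amgm) simp
    finally show ?thesis by (simp only: power_divide times_divide_eq_right)
  qed
  have ib: "integrable M (\<lambda>\<omega>. \<bar>u\<bar> * (\<delta> + (?D \<omega>)\<^sup>2 / s\<^sup>2 / \<delta>) / 2)"
    by (intro integrable_divide integrable_mult_right Bochner_Integration.integrable_add integrable_const L2(1))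
  have "char (distr M borel (std_flats a r)) u = (CLINT \<omega>|M. iexp (u * std_flats a r \<omega>))"
    unfolding char_def by (rule integral_distr) auto
  then have "char (distr M borel (std_flats a r)) u - (CLINT \<omega>|M. iexp (u * ?Y \<omega>)) =
      (CLINT \<omega>|M. iexp (u * std_flats a r \<omega>) - iexp (u * ?Y \<omega>))"
    by (simp only: Bochner_Integration.integral_diff[OF iZ iY])
  moreover have "cmod (CLINT \<omega>|M. iexp (u * std_flats a r \<omega>) - iexp (u * ?Y \<omega>)) \<le>
      (\<integral>\<omega>. \<bar>u\<bar> * (\<delta> + (?D \<omega>)\<^sup>2 / s\<^sup>2 / \<delta>) / 2 \<partial>M)"
    by (rule integral_norm_le_AE[OF Bochner_Integration.integrable_diff[OF iZ iY] ib]) (intro AE_I2 bd)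
  moreover have "(\<integral>\<omega>. \<bar>u\<bar> * (\<delta> + (?D \<omega>)\<^sup>2 / s\<^sup>2 / \<delta>) / 2 \<partial>M) = \<bar>u\<bar> * (\<delta> + (\<integral>\<omega>. (?D \<omega>)\<^sup>2 \<partial>M) / s\<^sup>2 / \<delta>) / 2"
  proof -
    have "(\<integral>\<omega>. \<delta> + (?D \<omega>)\<^sup>2 / s\<^sup>2 / \<delta> \<partial>M) = (\<integral>\<omega>. \<delta> \<partial>M) + (\<integral>\<omega>. (?D \<omega>)\<^sup>2 / s\<^sup>2 / \<delta> \<partial>M)"
      by (intro Bochner_Integration.integral_add integrable_divide integrable_const L2(1))
    also have "(\<integral>\<omega>. \<delta> \<partial>M) = \<delta>" by (simp add: prob_space)
    finally show ?thesis by (simp only: integral_divide_zero integral_mult_right_zero)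
  qed
  moreover have "\<bar>u\<bar> * (\<delta> + (\<integral>\<omega>. (?D \<omega>)\<^sup>2 \<partial>M) / s\<^sup>2 / \<delta>) / 2 \<le> \<bar>u\<bar> * (\<delta> + ?K * r ^ (2 * a) / s\<^sup>2 / \<delta>) / 2"
    using \<delta> by (intro divide_right_mono mult_left_mono add_left_mono L2(2)) simp_all
  moreover have "?K * r ^ (2 * a) / s\<^sup>2 / \<delta> = ?K / var_coeff a * \<delta>"
  proof -
    have "K * r ^ (2 * a) / (var_coeff a * (r * r ^ (2 * a))) * sqrt r = K / var_coeff a * (1 / sqrt r)" for K
      using v r by (simp add: divide_simps)
    then show ?thesis unfolding s(2) power_Suc \<delta>_def by simp
  qed
  ultimately have "cmod (char (distr M borel (std_flats a r)) u - (CLINT \<omega>|M. iexp (u * ?Y \<omega>)))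
    \<le> \<bar>u\<bar> * (\<delta> + ?K / var_coeff a * \<delta>) / 2" by (simp only: order_trans)
  moreover have "\<bar>u\<bar> * (\<delta> + K * \<delta>) / 2 = \<bar>u\<bar> * (1 + K) / 2 / sqrt r" for K
    unfolding \<delta>_def by (simp add: algebra_simps add_divide_distrib)
  ultimately show ?thesis by (simp only:)
qed

lemma char_std_flats_tendsto:
  assumes a: "Suc a \<le> DIM('a)" and v: "var_coeff a > 0"
  shows "((\<lambda>r. char (distr M borel (std_flats a r)) u) \<longlongrightarrow> complex_of_real (exp (- u\<^sup>2 / 2))) at_top"
proof -
  let ?s = "\<lambda>r. sqrt (var_coeff a * r ^ Suc (2 * a))"
  let ?w = "\<lambda>r. (CLINT x|\<mu>. iexp (u / ?s r * proj_fun a r x) - 1) - \<i> * complex_of_real (u / ?s r * mean_lin a r)"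
  let ?c = "\<lambda>r. (CLINT \<omega>|M. iexp (u * ((lin_flats a r \<omega> - mean_lin a r) / ?s r)))"
  have s0: "((\<lambda>r. K / sqrt r) \<longlongrightarrow> 0) at_top" for K
    by (rule real_tendsto_divide_at_top[OF tendsto_const sqrt_at_top])
  have ev: "eventually (\<lambda>r. r > 0 \<and> 2 * lam * r \<ge> 1) at_top"
    using eventually_ge_at_top[of "1 / (2 * lam)"] eventually_gt_at_top[of 0]
    by eventually_elim (use lam_pos in \<open>simp add: field_simps\<close>)
  have "((\<lambda>r. ?w r + complex_of_real (u\<^sup>2 / 2)) \<longlongrightarrow> 0) at_top"
  proof (rule Lim_null_comparison[OF _ s0[of "\<bar>u\<bar> ^ 3 * proj_coeff a / sqrt (var_coeff a)"]])
    show "eventually (\<lambda>r. cmod (?w r + complex_of_real (u\<^sup>2 / 2)) \<le> \<bar>u\<bar> ^ 3 * proj_coeff a / sqrt (var_coeff a) / sqrt r) at_top"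
      using ev
    proof eventually_elim
      case (elim r)
      \<comment> \<open>The power \<open>r ^ a\<close> of the maximal conditional mean cancels, and
        \<open>1 / sqrt r\<close> remains.\<close>
      have "sqrt (var_coeff a * r ^ Suc (2 * a)) = sqrt (var_coeff a) * (r ^ a * sqrt r)"
        using elim by (simp add: real_sqrt_mult real_sqrt_power power_mult power2_eq_square power_even_eq)
      then have "\<bar>u\<bar> ^ 3 * proj_coeff a * r ^ a / ?s r = \<bar>u\<bar> ^ 3 * proj_coeff a / sqrt (var_coeff a) / sqrt r"
        using elim by simp
      then show ?case using char_lin_flats[of r a u] elim v by simp
    qed
  qed
  then have "((\<lambda>r. exp ((?w r + complex_of_real (u\<^sup>2 / 2)) - complex_of_real (u\<^sup>2 / 2))) \<longlongrightarrow> exp (0 - complex_of_real (u\<^sup>2 / 2))) at_top"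
    by (intro tendsto_intros)
  moreover have "exp (0 - complex_of_real (u\<^sup>2 / 2)) = complex_of_real (exp (- u\<^sup>2 / 2))"
    by (simp add: exp_of_real[symmetric])
  ultimately have w: "((\<lambda>r. exp (?w r)) \<longlongrightarrow> complex_of_real (exp (- u\<^sup>2 / 2))) at_top"
    by (simp only: add_diff_cancel_right')
  have "eventually (\<lambda>r. ?c r = exp (?w r)) at_top"
    using ev by eventually_elim (rule char_lin_part, simp)
  then have c: "(?c \<longlongrightarrow> complex_of_real (exp (- u\<^sup>2 / 2))) at_top"
    by (intro Lim_transform_eventually[OF w]) (auto elim: eventually_mono)
  have "((\<lambda>r. char (distr M borel (std_flats a r)) u - ?c r) \<longlongrightarrow> 0) at_top"
    by (rule Lim_null_comparison[OF eventually_mono[OF ev] s0]) (use cmod_char_diff[OF a v] in blast)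
  then show ?thesis using tendsto_add[OF _ c] by fastforce
qed

text \<open>The continuity theorem concerns sequences of laws; the limit at infinity is determined
  by the sequences that tend to infinity, so it is applied along each of them.\<close>

lemma cdf_std_flats_tendsto:
  assumes a: "Suc a \<le> DIM('a)" and v: "var_coeff a > 0" and x: "isCont (cdf std_normal_distribution) x"
  shows "((\<lambda>r. prob {\<omega>\<in>space M. std_flats a r \<omega> \<le> x}) \<longlongrightarrow> cdf std_normal_distribution x) at_top"
proof (rule tendsto_at_topI_sequentially)
  fix R :: "nat \<Rightarrow> real" assume R: "filterlim R at_top sequentially"
  have "weak_conv_m (\<lambda>n. distr M borel (std_flats a (R n))) std_normal_distribution"
  proof (rule levy_continuity)
    show "(\<lambda>n. char (distr M borel (std_flats a (R n))) u) \<longlonglongrightarrow> char std_normal_distribution u" for u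
      unfolding char_std_normal_distribution
      by (rule filterlim_compose[OF char_std_flats_tendsto[OF a v] R])
  qed (auto simp: real_dist_normal_dist)
  then have "(\<lambda>n. cdf (distr M borel (std_flats a (R n))) x) \<longlonglongrightarrow> cdf std_normal_distribution x"
    using x unfolding weak_conv_m_def weak_conv_def by blast
  moreover have "cdf (distr M borel (std_flats a (R n))) x = prob {\<omega>\<in>space M. std_flats a (R n) \<omega> \<le> x}" for n
    unfolding cdf_def by (subst measure_distr) (auto intro!: arg_cong[where f = prob])
  ultimately show "(\<lambda>n. prob {\<omega>\<in>space M. std_flats a (R n) \<omega> \<le> x}) \<longlonglongrightarrow> cdf std_normal_distribution x"
    by simp
qed

end

section \<open>The normal distribution and the delta method\<close>

lemma measure_std_normal_singleton: "measure std_normal_distribution {x} = 0"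
proof -
  have "{x} \<in> null_sets std_normal_distribution"
    using eventually_mono[OF AE_lborel_singleton[of x], of "\<lambda>y. y \<in> {x} \<longrightarrow> ennreal (std_normal_density y) = 0"]
    by (subst null_sets_density_iff) auto
  then show ?thesis by (simp add: null_sets_def measure_def)
qed

lemma isCont_cdf_std_normal: "isCont (cdf std_normal_distribution) x"
proof -
  interpret real_distribution std_normal_distribution by (rule real_dist_normal_dist)
  show ?thesis by (simp only: isCont_cdf measure_std_normal_singleton)
qed

lemma cdf_std_normal_minus: "cdf std_normal_distribution (- x) = 1 - cdf std_normal_distribution x"
proof -
  interpret real_distribution std_normal_distribution by (rule real_dist_normal_dist)
  have "emeasure std_normal_distribution {..- x} =
      (\<integral>\<^sup>+y. ennreal (std_normal_density y) * indicator {..- x} y \<partial>lborel)"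
    by (rule emeasure_density) auto
  also have "\<dots> = (\<integral>\<^sup>+y. ennreal (std_normal_density (- y)) * indicator {..- x} (- y) \<partial>lborel)"
    by (rule nn_integral_lborel_reflect[symmetric]) measurable
  also have "\<dots> = (\<integral>\<^sup>+y. ennreal (std_normal_density y) * indicator {x..} y \<partial>lborel)"
    by (intro nn_integral_cong) (auto simp: std_normal_density_def indicator_def)
  also have "\<dots> = emeasure std_normal_distribution {x..}"
    by (rule emeasure_density[symmetric]) auto
  finally have "cdf std_normal_distribution (- x) = prob {x..}"
    by (simp add: cdf_def measure_def)
  moreover have "prob (UNIV - {x..}) = 1 - prob {x..}"
    using prob_compl[of "{x..}"] by simp
  moreover have "UNIV - {x..} = {..<x}" by auto
  moreover have "prob ({..<x} \<union> {x}) = prob {..<x} + prob {x}"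
    by (rule finite_measure_Union) auto
  moreover have "{..<x} \<union> {x} = {..x}" by auto
  ultimately show ?thesis using measure_std_normal_singleton[of x] by (simp add: cdf_def)
qed

text \<open>Continuity of the distribution function provides a point with value exactly
  \<open>q\<close> and makes the set in the definition closed, so its infimum belongs to it.\<close>

lemma cdf_std_normal_quantile:
  assumes "0 < q" "q < 1"
  shows "cdf std_normal_distribution (std_normal_quantile q) = q"
proof -
  interpret real_distribution std_normal_distribution by (rule real_dist_normal_dist)
  let ?F = "cdf std_normal_distribution"
  have cont: "continuous_on A ?F" for A
    by (simp add: continuous_at_imp_continuous_on isCont_cdf_std_normal)
  have "eventually (\<lambda>x. ?F x < q) at_bot" by (rule order_tendstoD(2)[OF cdf_lim_at_bot assms(1)])
  then obtain l where l: "\<And>x. x \<le> l \<Longrightarrow> ?F x < q" unfolding eventually_at_bot_linorder by blast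
  have "eventually (\<lambda>x. q < ?F x) at_top" by (rule order_tendstoD(1)[OF cdf_lim_at_top_prob assms(2)])
  then obtain u where u: "\<And>x. x \<ge> u \<Longrightarrow> q < ?F x" unfolding eventually_at_top_linorder by blast
  have "l \<le> u" using l[of l] u[of l] by (cases "l \<le> u") auto
  with l[of l] u[of u] obtain x0 where x0: "?F x0 = q"
    using IVT'[of ?F l q u] cont by force
  let ?S = "{x. q \<le> ?F x}"
  have S: "x0 \<in> ?S" "bdd_below ?S"
  proof -
    show "bdd_below ?S" by (rule bdd_belowI[of _ l]) (use l in \<open>metis mem_Collect_eq linorder_not_le nle_le\<close>)
  qed (use x0 in simp)
  have "closed ?S" by (rule closed_Collect_le) (auto intro: cont)
  then have "Inf ?S \<in> ?S" using S by (intro closed_contains_Inf) auto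
  moreover have "?F (Inf ?S) \<le> ?F x0" by (intro cdf_nondecreasing cInf_lower S)
  ultimately show ?thesis using x0 unfolding std_normal_quantile_def by auto
qed

lemma std_normal_quantile_pos:
  assumes "1 / 2 < q" "q < 1"
  shows "std_normal_quantile q > 0"
proof (rule ccontr)
  interpret real_distribution std_normal_distribution by (rule real_dist_normal_dist)
  assume "\<not> ?thesis"
  then have "cdf std_normal_distribution (std_normal_quantile q) \<le> cdf std_normal_distribution 0"
    by (intro cdf_nondecreasing) simp
  moreover have "cdf std_normal_distribution 0 = 1 / 2" using cdf_std_normal_minus[of 0] by simp
  ultimately show False using cdf_std_normal_quantile[of q] assms by simp
qed

text \<open>A moving argument, or a strict inequality, is caught between the fixed arguments
  \<open>x - d\<close> and \<open>x + d\<close>; continuity of the limit then lets \<open>d\<close>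
  shrink.\<close>

lemma tendsto_squeeze_shift:
  fixes G :: "real \<Rightarrow> real"
  assumes F: "\<And>x. ((\<lambda>i. F i x) \<longlongrightarrow> G x) L" and G: "isCont G x"
    and H: "\<And>d. d > 0 \<Longrightarrow> eventually (\<lambda>i. F i (x - d) \<le> H i \<and> H i \<le> F i (x + d)) L"
  shows "(H \<longlongrightarrow> G x) L"
proof (rule tendstoI)
  fix \<epsilon> :: real assume \<epsilon>: "\<epsilon> > 0"
  obtain d where d: "d > 0" "\<And>y. dist y x < d \<Longrightarrow> dist (G y) (G x) < \<epsilon> / 2"
    using G \<epsilon> unfolding continuous_at_eps_delta by (metis half_gt_zero dist_commute)
  have "eventually (\<lambda>i. dist (F i (x - d / 2)) (G (x - d / 2)) < \<epsilon> / 2) L"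
    "eventually (\<lambda>i. dist (F i (x + d / 2)) (G (x + d / 2)) < \<epsilon> / 2) L"
    using \<epsilon> by (intro tendstoD[OF F]; simp)+
  moreover have "dist (G (x - d / 2)) (G x) < \<epsilon> / 2" "dist (G (x + d / 2)) (G x) < \<epsilon> / 2"
    by (rule d(2), use d(1) in \<open>simp add: dist_real_def\<close>)+
  ultimately show "eventually (\<lambda>i. dist (H i) (G x) < \<epsilon>) L"
  proof -
    assume e: "eventually (\<lambda>i. dist (F i (x - d / 2)) (G (x - d / 2)) < \<epsilon> / 2) L"
      "eventually (\<lambda>i. dist (F i (x + d / 2)) (G (x + d / 2)) < \<epsilon> / 2) L"
      and g: "dist (G (x - d / 2)) (G x) < \<epsilon> / 2" "dist (G (x + d / 2)) (G x) < \<epsilon> / 2"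
    have "eventually (\<lambda>i. F i (x - d / 2) \<le> H i \<and> H i \<le> F i (x + d / 2)) L" using H[of "d / 2"] d(1) by simp
    then show "eventually (\<lambda>i. dist (H i) (G x) < \<epsilon>) L"
      using e by eventually_elim (use g in \<open>unfold dist_real_def, linarith\<close>)
  qed
qed

text \<open>The derivative of the \<open>q\<close>-th power at \<open>w\<close> along the increment
  \<open>y / sqrt r\<close>. The factorization of a difference of powers covers \<open>y = 0\<close>
  as well, without a division by the increment.\<close>

lemma tendsto_sqrt_power_diff:
  fixes w y :: real
  shows "((\<lambda>r. sqrt r * ((w + y / sqrt r) ^ q - w ^ q)) \<longlongrightarrow> real q * w ^ (q - 1) * y) at_top"
proof -
  have h: "((\<lambda>r. y / sqrt r) \<longlongrightarrow> 0) at_top"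
    by (rule real_tendsto_divide_at_top[OF tendsto_const sqrt_at_top])
  have "((\<lambda>r. y * (\<Sum>i<q. w ^ (q - Suc i) * (w + y / sqrt r) ^ i)) \<longlongrightarrow>
      y * (\<Sum>i<q. w ^ (q - Suc i) * (w + 0) ^ i)) at_top"
    by (intro tendsto_intros h)
  also have "y * (\<Sum>i<q. w ^ (q - Suc i) * (w + 0) ^ i) = real q * w ^ (q - 1) * y"
  proof -
    have "(\<Sum>i<q. w ^ (q - Suc i) * (w + 0) ^ i) = (\<Sum>i<q. w ^ (q - 1))"
      by (intro sum.cong refl) (auto simp: power_add[symmetric])
    then show ?thesis by simp
  qed
  finally show ?thesis
  proof (rule Lim_transform_eventually)
    show "eventually (\<lambda>r. y * (\<Sum>i<q. w ^ (q - Suc i) * (w + y / sqrt r) ^ i) =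
      sqrt r * ((w + y / sqrt r) ^ q - w ^ q)) at_top"
    using eventually_gt_at_top[of 0] by eventually_elim (simp add: power_diff_sumr2)
  qed
qed

lemma powr_inverse_power:
  fixes E :: real
  assumes "E \<ge> 0" "q > 0"
  shows "(E powr (1 / real q)) ^ q = E"
  using assms by (cases "E = 0") (simp_all add: powr_realpow[symmetric] powr_powr)

lemma powr_inverse_le_iff:
  assumes "E \<ge> 0" "t \<ge> 0" "q > 0"
  shows "E powr (1 / real q) \<le> t \<longleftrightarrow> E \<le> t ^ q"
  using power_mono_iff[of "E powr (1 / real q)" t q] powr_inverse_power[of E q] assms by simp

lemma (in prob_space) delta_method_root:
  fixes E :: "real \<Rightarrow> 'a \<Rightarrow> real"
  assumes E[measurable]: "\<And>r. E r \<in> borel_measurable M" and nn: "\<And>r \<omega>. r > 0 \<Longrightarrow> E r \<omega> \<ge> 0"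
    and pos: "w > 0" "q > 0" "\<sigma> > 0" and G: "isCont G x"
    and conv: "\<And>x. ((\<lambda>r. prob {\<omega>\<in>space M. sqrt r * (E r \<omega> - w ^ q) \<le> \<sigma> * x}) \<longlongrightarrow> G x) at_top"
  shows "((\<lambda>r. prob {\<omega>\<in>space M. sqrt r * (E r \<omega> powr (1 / real q) - w) \<le> \<sigma> / (real q * w ^ (q - 1)) * x})
    \<longlongrightarrow> G x) at_top"
proof (rule tendsto_squeeze_shift[OF conv G])
  fix d :: real assume d: "d > 0"
  let ?y = "\<sigma> / (real q * w ^ (q - 1)) * x"
  \<comment> \<open>The threshold for the root, turned into a threshold for \<open>E\<close>. It
    tends to \<open>\<sigma> * x\<close>, so it eventually lies between
    \<open>\<sigma> * (x - d)\<close> and \<open>\<sigma> * (x + d)\<close>.\<close>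
  let ?x = "\<lambda>r. sqrt r * ((w + ?y / sqrt r) ^ q - w ^ q)"
  have y: "real q * w ^ (q - 1) * ?y = \<sigma> * x" using pos by simp
  have t: "(?x \<longlongrightarrow> \<sigma> * x) at_top" unfolding y[symmetric] by (rule tendsto_sqrt_power_diff)
  \<comment> \<open>For large \<open>r\<close> the threshold of the root is positive, so raising
    both sides to the power \<open>q\<close> preserves the event.\<close>
  have "((\<lambda>r. w + ?y / sqrt r) \<longlongrightarrow> w + 0) at_top"
    by (intro tendsto_add tendsto_const real_tendsto_divide_at_top[OF tendsto_const sqrt_at_top])
  then have "eventually (\<lambda>r. 0 < w + ?y / sqrt r) at_top" using pos by (intro order_tendstoD(1)) auto
  moreover have "eventually (\<lambda>r. \<sigma> * (x - d) < ?x r) at_top" "eventually (\<lambda>r. ?x r < \<sigma> * (x + d)) at_top"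
    using pos d by (intro order_tendstoD[OF t]; simp)+
  moreover have "eventually (\<lambda>r::real. 0 < r) at_top" by (rule eventually_gt_at_top)
  ultimately show "eventually (\<lambda>r.
      prob {\<omega>\<in>space M. sqrt r * (E r \<omega> - w ^ q) \<le> \<sigma> * (x - d)}
        \<le> prob {\<omega>\<in>space M. sqrt r * (E r \<omega> powr (1 / real q) - w) \<le> ?y} \<and>
      prob {\<omega>\<in>space M. sqrt r * (E r \<omega> powr (1 / real q) - w) \<le> ?y}
        \<le> prob {\<omega>\<in>space M. sqrt r * (E r \<omega> - w ^ q) \<le> \<sigma> * (x + d)}) at_top"
  proof eventually_elim
    case (elim r)
    have r: "sqrt r > 0" using elim(4) by simp
    have div: "sqrt r * (F - w) \<le> y \<longleftrightarrow> F \<le> w + y / sqrt r" for F y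
      using pos_le_divide_eq[OF r, of "F - w" y] by (simp only: mult.commute diff_le_eq add.commute)
    have "sqrt r * (E r \<omega> powr (1 / real q) - w) \<le> ?y \<longleftrightarrow> sqrt r * (E r \<omega> - w ^ q) \<le> ?x r" for \<omega>
      unfolding div powr_inverse_le_iff[OF nn[OF elim(4)] less_imp_le[OF elim(1)] pos(2)]
        mult_le_cancel_left_pos[OF r] by simp
    then have eq: "{\<omega>\<in>space M. sqrt r * (E r \<omega> powr (1 / real q) - w) \<le> ?y} =
        {\<omega>\<in>space M. sqrt r * (E r \<omega> - w ^ q) \<le> ?x r}"
      by (simp only:)
    have mono: "prob {\<omega>\<in>space M. sqrt r * (E r \<omega> - w ^ q) \<le> y} \<le> prob {\<omega>\<in>space M. sqrt r * (E r \<omega> - w ^ q) \<le> z}"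
      if "y \<le> z" for y z
      by (rule finite_measure_mono) (use that in auto)
    show ?case unfolding eq using elim(2,3) by (intro conjI mono less_imp_le)
  qed
qed

text \<open>The left end point belongs to the event, so the probability of
  \<open>T r \<omega> < - z\<close> has to be subtracted; continuity of \<open>G\<close> gives it
  the same limit as for the weak inequality.\<close>

lemma (in prob_space) prob_abs_le_tendsto:
  fixes T :: "'i \<Rightarrow> 'a \<Rightarrow> real"
  assumes T[measurable]: "\<And>r. T r \<in> borel_measurable M" and G: "\<And>x. isCont G x" and z: "z \<ge> 0"
    and conv: "\<And>x. ((\<lambda>r. prob {\<omega>\<in>space M. T r \<omega> \<le> x}) \<longlongrightarrow> G x) L"
  shows "((\<lambda>r. prob {\<omega>\<in>space M. \<bar>T r \<omega>\<bar> \<le> z}) \<longlongrightarrow> G z - G (- z)) L"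
proof -
  have "((\<lambda>r. prob {\<omega>\<in>space M. T r \<omega> < - z}) \<longlongrightarrow> G (- z)) L"
    by (rule tendsto_squeeze_shift[OF conv G]) (auto intro!: always_eventually finite_measure_mono)
  then have "((\<lambda>r. prob {\<omega>\<in>space M. T r \<omega> \<le> z} - prob {\<omega>\<in>space M. T r \<omega> < - z}) \<longlongrightarrow> G z - G (- z)) L"
    by (intro tendsto_diff conv)
  moreover have "prob {\<omega>\<in>space M. T r \<omega> \<le> z} - prob {\<omega>\<in>space M. T r \<omega> < - z} = prob {\<omega>\<in>space M. \<bar>T r \<omega>\<bar> \<le> z}" for r
  proof -
    have "prob ({\<omega>\<in>space M. T r \<omega> \<le> z} - {\<omega>\<in>space M. T r \<omega> < - z}) =
        prob {\<omega>\<in>space M. T r \<omega> \<le> z} - prob {\<omega>\<in>space M. T r \<omega> < - z}"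
      using z by (intro finite_measure_Diff) auto
    moreover have "{\<omega>\<in>space M. T r \<omega> \<le> z} - {\<omega>\<in>space M. T r \<omega> < - z} = {\<omega>\<in>space M. \<bar>T r \<omega>\<bar> \<le> z}"
      by (auto simp: abs_le_iff)
    ultimately show ?thesis by simp
  qed
  ultimately show ?thesis by simp
qed

text \<open>Even powers compare absolute values. If \<open>E - h\<close> is negative, then
  \<open>h - E \<le> h \<le> w\<close>, so the lower end point imposes no condition, in accordance
  with \<open>E \<le> w + h\<close>.\<close>

lemma mem_even_power_interval_iff:
  fixes E h w :: real
  assumes "even q" "q > 0" "E \<ge> 0" "0 \<le> h" "h \<le> w"
  shows "w ^ q \<in> {(E - h) ^ q..(E + h) ^ q} \<longleftrightarrow> \<bar>E - w\<bar> \<le> h"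
proof -
  have "(E - h) ^ q \<le> w ^ q \<longleftrightarrow> \<bar>E - h\<bar> \<le> w"
    using power_mono_iff[of "\<bar>E - h\<bar>" w q] assms by (simp add: power_even_abs)
  moreover have "w ^ q \<le> (E + h) ^ q \<longleftrightarrow> w \<le> E + h" using power_mono_iff[of w "E + h" q] assms by simp
  ultimately show ?thesis using assms by auto
qed

section \<open>Normalization and confidence intervals\<close>

text \<open>Valid without summability too: \<open>infsum\<close> is then 0 by convention, and so is
  \<open>enn2real\<close> of infinity.\<close>

lemma infsum_eq_nn_integral_count_space:
  fixes f :: "'a \<Rightarrow> real"
  assumes f: "\<And>x. f x \<ge> 0"
  shows "infsum f A = enn2real (\<integral>\<^sup>+x. ennreal (f x) \<partial>count_space A)"
proof (cases "integrable (count_space A) f")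
  case True
  then have "infsum f A = (\<integral>x. f x \<partial>count_space A)"
    by (metis infsetsum_infsum infsetsum_def abs_summable_on_def)
  then show ?thesis using f by (simp add: integral_eq_nn_integral)
next
  case False
  then have "\<not> f summable_on A"
    by (metis summable_on_iff_abs_summable_on_real abs_summable_equivalent abs_summable_on_def)
  moreover have "(\<integral>\<^sup>+x. ennreal (f x) \<partial>count_space A) = \<infinity>"
    using False f by (simp add: integrable_iff_bounded not_less top_unique)
  ultimately show ?thesis by (simp add: infsum_not_exists)
qed

lemma a_const_root:
  assumes "A > 0" "lam > 0"
  shows "(A * lam ^ Suc a) powr (1 / real (2 * Suc a)) = A powr (1 / real (2 * Suc a)) * sqrt lam"
proof -
  have "(lam ^ Suc a) powr (1 / real (2 * Suc a)) = lam powr (real (Suc a) * (1 / real (2 * Suc a)))"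
    using assms by (simp only: powr_realpow[symmetric] powr_powr)
  also have "real (Suc a) * (1 / real (2 * Suc a)) = 1 / 2" by simp
  finally show ?thesis using assms by (simp add: powr_mult powr_half_sqrt)
qed

text \<open>The origin of \<open>b_const\<close>: up to ball volumes its square is
  \<open>kratio (2 * a)\<close>, the integral of the squared profile of the conditional
  mean.\<close>

lemma kratio_b_const:
  "kratio (2 * a) * (unit_ball_vol (real a))\<^sup>2 = (2 * b_const (Suc a) * unit_ball_vol (real (Suc a)))\<^sup>2"
proof -
  define \<kappa> where "\<kappa> = unit_ball_vol (real (Suc a))"
  have \<kappa>: "\<kappa> \<noteq> 0" unfolding \<kappa>_def by (metis less_irrefl of_nat_0_le_iff unit_ball_vol_pos)
  have "b_const (Suc a) = 2 ^ a * fact a * unit_ball_vol (real a) / (sqrt (2 * fact (2 * a + 1)) * \<kappa>)"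
    by (simp add: b_const_def \<kappa>_def)
  then have "2 * b_const (Suc a) * \<kappa> = 2 * (2 ^ a * fact a * unit_ball_vol (real a)) / sqrt (2 * fact (2 * a + 1))"
    using \<kappa> by simp
  then have "(2 * b_const (Suc a) * \<kappa>)\<^sup>2 = (2 * (2 ^ a * fact a * unit_ball_vol (real a)))\<^sup>2 / (2 * fact (2 * a + 1))"
    by (simp only: power_divide) (simp del: fact_Suc)
  also have "\<dots> = 2 * (2 ^ a)\<^sup>2 * (fact a)\<^sup>2 * (unit_ball_vol (real a))\<^sup>2 / fact (2 * a + 1)"
    by (simp add: power_mult_distrib del: fact_Suc)
  also have "(2 ^ a)\<^sup>2 = (2::real) ^ (2 * a)" by (simp add: power_mult[symmetric] mult.commute)
  finally show ?thesis unfolding kratio_even \<kappa>_def by simp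
qed

context isotropic_hyperplanes
begin

text \<open>True for every outcome, as both sides are 0 when infinitely many tuples contribute. The
  factorial in \<open>flat_count\<close> is the number of orderings of an index set.\<close>

lemma flat_count_eq_flats:
  assumes "Suc a = DIM('a) - k"
  shows "flat_count k r (\<lambda>i. fst (X i \<omega>)) (\<lambda>i. snd (X i \<omega>)) = flats a r \<omega>"
proof -
  let ?f = "\<lambda>is::nat list. of_bool ((\<Inter>i\<in>set is. hyperplane (fst (X i \<omega>)) (snd (X i \<omega>))) \<inter> cball 0 r \<noteq> {}) :: real"
  have "infsum ?f (dlists (Suc a)) = enn2real (\<integral>\<^sup>+is. ennreal (?f is) \<partial>count_space (dlists (Suc a)))"
    by (rule infsum_eq_nn_integral_count_space) simp
  also have "(\<integral>\<^sup>+is. ennreal (?f is) \<partial>count_space (dlists (Suc a))) =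
      (\<integral>\<^sup>+is. hit UNIV r (pts \<omega> (set is)) \<partial>count_space (dlists (Suc a)))"
    by (intro nn_integral_cong) (simp add: hit_def pts_def)
  also have "\<dots> = fact (Suc a) * ustat (Suc a) (hit UNIV r) \<omega>"
    unfolding ustat_def by (rule nn_integral_dlists)
  also have "enn2real \<dots> = fact (Suc a) * flats a r \<omega>"
    unfolding flats_def enn2real_mult by (metis enn2real_ennreal ennreal_of_nat_eq_real_of_nat of_nat_0_le_iff of_nat_fact)
  finally have "infsum ?f (dlists (Suc a)) = fact (Suc a) * flats a r \<omega>" .
  then show ?thesis unfolding flat_count_def assms[symmetric] dlists_def[symmetric]
    by (simp del: fact_Suc)
qed

text \<open>A unit vector projects to the whole space with norm 1, so the first hyperplane
  contributes only the factor \<open>kratio a\<close>. This links the constant of the conditional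
  mean to that of the total mean, hence to \<open>a_const\<close>; \<open>kratio_b_const\<close>
  then brings in \<open>b_const\<close>.\<close>

lemma sqrt_var_coeff:
  assumes a: "Suc a \<le> DIM('a)"
  shows "sqrt (var_coeff a) = 2 * real (Suc a) * a_const DIM('a) (DIM('a) - Suc a) * b_const (Suc a) *
    unit_ball_vol (real (Suc a)) * (lam ^ a * sqrt lam)"
proof -
  let ?A = "a_const DIM('a) (DIM('a) - Suc a)"
  let ?v = "unit_ball_vol :: real \<Rightarrow> real"
  have v: "?v (real j) \<noteq> 0" for j by (metis less_irrefl of_nat_0_le_iff unit_ball_vol_pos)
  have d: "real DIM('a) \<noteq> 0" using DIM_positive[where 'a = 'a] by simp
  have "mean_proj DIM('a) DIM('a) = 1"
    unfolding mean_proj_def using v[of "DIM('a)"] v[of "DIM('a) - 1"] d by simp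
  then have "flatc DIM('a) (DIM('a) - 1) a * kratio a = fact (Suc a) * (?v (real (Suc a)) * ?A)"
    using flatc_a_const[OF a] by (simp del: fact_Suc)
  then have "flatc DIM('a) (DIM('a) - 1) a * (?v (real (Suc a)) / ?v (real a)) = fact a * (real (Suc a) * ?v (real (Suc a)) * ?A)"
    by (simp add: kratio_def)
  then have "flatc DIM('a) (DIM('a) - 1) a * ?v (real (Suc a)) = fact a * (real (Suc a) * ?A * ?v (real a)) * ?v (real (Suc a))"
    using v[of a] by (simp add: field_simps)
  then have "flatc DIM('a) (DIM('a) - 1) a = fact a * (real (Suc a) * ?A * ?v (real a))"
    using v[of "Suc a"] by (simp only: mult_cancel_right) simp
  then have "proj_coeff a = lam ^ a * (real (Suc a) * ?A * ?v (real a))"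
    unfolding proj_coeff_def by simp
  then have "var_coeff a = (lam ^ a * (real (Suc a) * ?A))\<^sup>2 * (lam * (kratio (2 * a) * (?v (real a))\<^sup>2))"
    unfolding var_coeff_def by (simp only: power_mult_distrib mult_ac)
  also have "\<dots> = (2 * real (Suc a) * ?A * b_const (Suc a) * ?v (real (Suc a)) * (lam ^ a * sqrt lam))\<^sup>2"
    unfolding kratio_b_const using lam_pos by (simp only: power_mult_distrib real_sqrt_pow2 less_imp_le mult_ac)
  finally have "sqrt (var_coeff a) = \<bar>2 * real (Suc a) * ?A * b_const (Suc a) * ?v (real (Suc a)) * (lam ^ a * sqrt lam)\<bar>"
    by simp
  moreover have "0 < 2 * real (Suc a) * ?A * b_const (Suc a) * ?v (real (Suc a)) * (lam ^ a * sqrt lam)"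
    by (intro mult_pos_pos a_const_pos a b_const_pos zero_less_power lam_pos DIM_positive unit_ball_vol_pos)
      (simp_all add: lam_pos)
  ultimately show ?thesis by simp
qed

text \<open>Inside, \<open>w\<close> is the root of the limiting intensity and
  \<open>\<sigma>\<close> the asymptotic standard deviation of \<open>sqrt r\<close> times the error
  of the estimator.\<close>

lemma clt_root:
  assumes a: "Suc a \<le> DIM('a)"
  defines "A \<equiv> a_const DIM('a) (DIM('a) - Suc a)" and "s \<equiv> 1 / real (2 * Suc a)"
    and "E \<equiv> \<lambda>r \<omega>. flats a r \<omega> / (unit_ball_vol (real (Suc a)) * r ^ Suc a)"
  shows "((\<lambda>r. prob {\<omega>\<in>space M. sqrt r / b_const (Suc a) * A powr - s *
      (E r \<omega> powr s - (A * lam ^ Suc a) powr s) \<le> x}) \<longlongrightarrow> cdf std_normal_distribution x) at_top"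
proof -
  let ?q = "2 * Suc a"
  define w where "w = (A * lam ^ Suc a) powr s"
  define \<kappa> where "\<kappa> = unit_ball_vol (real (Suc a))"
  define \<sigma> where "\<sigma> = sqrt (var_coeff a) / \<kappa>"
  have \<kappa>: "\<kappa> > 0" unfolding \<kappa>_def by (rule unit_ball_vol_pos) simp
  have A: "A > 0" unfolding A_def by (rule a_const_pos[OF a DIM_positive])
  have b: "b_const (Suc a) > 0" by (rule b_const_pos)
  have l: "A * lam ^ Suc a > 0" by (intro mult_pos_pos A zero_less_power lam_pos)
  have w: "w > 0" unfolding w_def using A lam_pos by simp
  have wq: "w ^ ?q = A * lam ^ Suc a"
    unfolding w_def s_def by (rule powr_inverse_power[OF less_imp_le[OF l]]) simp
  have \<sigma>_eq: "\<sigma> = 2 * real (Suc a) * A * b_const (Suc a) * (lam ^ a * sqrt lam)"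
    unfolding \<sigma>_def sqrt_var_coeff[OF a] A_def[symmetric] \<kappa>_def[symmetric] using \<kappa> by simp
  have \<sigma>: "\<sigma> > 0" unfolding \<sigma>_eq using A b lam_pos by simp
  have v: "var_coeff a > 0" using \<sigma> \<kappa> unfolding \<sigma>_def by (simp add: zero_less_divide_iff)
  have E_m: "E r \<in> borel_measurable M" for r unfolding E_def by measurable
  have E_nn: "r > 0 \<Longrightarrow> E r \<omega> \<ge> 0" for r \<omega>
    unfolding E_def \<kappa>_def[symmetric] flats_def using \<kappa> by simp
  have std: "std_flats a r \<omega> \<le> x \<longleftrightarrow> sqrt r * (E r \<omega> - w ^ ?q) \<le> \<sigma> * x" if r: "r > 0" for r x \<omega>
  proof -
    \<comment> \<open>One factor \<open>sqrt r\<close> scales the error of the estimator, the rest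
      cancels against the standard deviation.\<close>
    have rr: "r ^ Suc a = r ^ a * sqrt r * sqrt r" using r by simp
    have e1: "sqrt (var_coeff a * r ^ Suc (2 * a)) = \<kappa> * (r ^ a * sqrt r) * \<sigma>"
      unfolding \<sigma>_def using r \<kappa> by (simp add: real_sqrt_mult power_even_eq)
    have e2: "flats a r \<omega> - mean_flats a r = \<kappa> * (r ^ a * sqrt r) * (sqrt r * (E r \<omega> - w ^ ?q))"
    proof -
      have "\<kappa> * r ^ Suc a * E r \<omega> = flats a r \<omega>" unfolding E_def \<kappa>_def[symmetric] using \<kappa> r by simp
      moreover have "\<kappa> * r ^ Suc a * w ^ ?q = mean_flats a r"
        unfolding wq mean_flats_def A_def \<kappa>_def by (simp only: mult_ac)
      ultimately have "flats a r \<omega> - mean_flats a r = \<kappa> * r ^ Suc a * (E r \<omega> - w ^ ?q)" by (simp only: right_diff_distrib)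
      then show ?thesis unfolding rr by (simp only: mult.assoc)
    qed
    have "\<kappa> * (r ^ a * sqrt r) \<noteq> 0" using r \<kappa> by simp
    then have "std_flats a r \<omega> = sqrt r * (E r \<omega> - w ^ ?q) / \<sigma>"
      unfolding std_flats_def e1 e2 by (rule mult_divide_mult_cancel_left)
    then show ?thesis using pos_divide_le_eq[OF \<sigma>] by (simp only: mult.commute[of \<sigma> x])
  qed
  have conv: "((\<lambda>r. prob {\<omega>\<in>space M. sqrt r * (E r \<omega> - w ^ ?q) \<le> \<sigma> * x}) \<longlongrightarrow> cdf std_normal_distribution x) at_top" for x
  proof (rule Lim_transform_eventually[OF cdf_std_flats_tendsto[OF a v isCont_cdf_std_normal]])
    show "eventually (\<lambda>r. prob {\<omega>\<in>space M. std_flats a r \<omega> \<le> x} =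
        prob {\<omega>\<in>space M. sqrt r * (E r \<omega> - w ^ ?q) \<le> \<sigma> * x}) at_top"
      using eventually_gt_at_top[of 0] by eventually_elim (simp only: std)
  qed
  have q0: "?q > 0" by simp
  have "((\<lambda>r. prob {\<omega>\<in>space M. sqrt r * (E r \<omega> powr s - w) \<le> \<sigma> / (real ?q * w ^ (?q - 1)) * x})
      \<longlongrightarrow> cdf std_normal_distribution x) at_top"
    unfolding s_def by (rule delta_method_root[OF E_m E_nn w q0 \<sigma> isCont_cdf_std_normal conv])
  \<comment> \<open>The power \<open>w ^ (?q - 1)\<close> carries the same factor
    \<open>lam ^ a * sqrt lam\<close> as \<open>\<sigma>\<close>, so the intensity drops out of the
    scale.\<close>
  moreover have "\<sigma> / (real ?q * w ^ (?q - 1)) = b_const (Suc a) * A powr s"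
  proof -
    have "w * w ^ (?q - 1) = A * lam ^ Suc a" using wq by simp
    moreover have "w = A powr s * sqrt lam" unfolding w_def s_def by (rule a_const_root[OF A lam_pos])
    ultimately have "A powr s * sqrt lam * w ^ (?q - 1) = A * lam ^ Suc a" by (simp only:)
    moreover have "A * lam ^ Suc a = A * lam ^ a * sqrt lam * sqrt lam"
      using lam_pos by (simp add: mult.assoc)
    ultimately have "sqrt lam * (A powr s * w ^ (?q - 1)) = sqrt lam * (A * lam ^ a * sqrt lam)"
      by (simp only: mult_ac)
    moreover have "sqrt lam \<noteq> 0" using lam_pos by simp
    ultimately have *: "A powr s * w ^ (?q - 1) = A * lam ^ a * sqrt lam"
      by (rule mult_left_cancel[THEN iffD1, rotated])
    have "b_const (Suc a) * A powr s * (real ?q * w ^ (?q - 1)) = b_const (Suc a) * (2 * real (Suc a)) * (A powr s * w ^ (?q - 1))"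
      by (simp only: of_nat_mult of_nat_numeral mult_ac)
    also have "\<dots> = \<sigma>" unfolding * \<sigma>_eq by (simp only: mult_ac)
    finally have eq: "\<sigma> = b_const (Suc a) * A powr s * (real ?q * w ^ (?q - 1))" ..
    have "real ?q * w ^ (?q - 1) \<noteq> 0" using w by simp
    then show ?thesis unfolding eq by (rule nonzero_mult_div_cancel_right)
  qed
  moreover have "sqrt r * (E r \<omega> powr s - w) \<le> b_const (Suc a) * A powr s * x \<longleftrightarrow>
      sqrt r / b_const (Suc a) * A powr - s * (E r \<omega> powr s - w) \<le> x" for r \<omega>
  proof -
    have "sqrt r / b_const (Suc a) * A powr - s * (E r \<omega> powr s - w) =
        sqrt r * (E r \<omega> powr s - w) / (b_const (Suc a) * A powr s)"
      unfolding powr_minus_divide by simp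
    moreover have "b_const (Suc a) * A powr s > 0" using b A by simp
    ultimately show ?thesis by (simp only: pos_divide_le_eq mult.commute[of x])
  qed
  ultimately show ?thesis unfolding w_def[symmetric] by (simp only:)
qed

end

text \<open>On the scale of the root the half width is the quantile divided by \<open>c\<close>, and
  for the second interval divided also by \<open>a_const d k powr s\<close>. The last assumption
  says that it is at most the root to be covered, the range where an even power can be
  inverted.\<close>

lemma mem_conf_interval_I_iff:
  assumes a: "d - k = Suc a" and A: "a_const d k > 0" and l: "l \<ge> 0"
    and z: "std_normal_quantile (1 - \<alpha> / 2) \<ge> 0" and r: "r > 0"
  defines "s \<equiv> 1 / real (2 * Suc a)" and "c \<equiv> sqrt r / b_const (Suc a) * a_const d k powr - (1 / real (2 * Suc a))"
  assumes w: "w > 0" and h: "std_normal_quantile (1 - \<alpha> / 2) \<le> c * w"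
  shows "w ^ (2 * Suc a) \<in> conf_interval_I d k \<alpha> r l \<longleftrightarrow> \<bar>c * (l powr s - w)\<bar> \<le> std_normal_quantile (1 - \<alpha> / 2)"
    "(w / a_const d k powr s)\<^sup>2 \<in> conf_interval_J d k \<alpha> r l \<longleftrightarrow> \<bar>c * (l powr s - w)\<bar> \<le> std_normal_quantile (1 - \<alpha> / 2)"
proof -
  let ?z = "std_normal_quantile (1 - \<alpha> / 2)"
  define A where "A = a_const d k powr s"
  have A0: "A > 0" unfolding A_def using A by simp
  have b: "b_const (Suc a) > 0" by (rule b_const_pos)
  have c: "c = sqrt r / (b_const (Suc a) * A)" unfolding c_def A_def s_def powr_minus_divide by simp
  have c0: "c > 0" unfolding c using r b A0 by simp
  have hI: "A * b_const (Suc a) / sqrt r * ?z = ?z / c" unfolding c by simp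
  have hJ: "b_const (Suc a) / sqrt r * ?z = ?z / (c * A)" unfolding c using A0 by simp
  have key: "\<bar>x - w\<bar> \<le> ?z / c \<longleftrightarrow> \<bar>c * (x - w)\<bar> \<le> ?z" for x
    using c0 by (simp add: pos_le_divide_eq abs_mult mult.commute)
  have s2: "1 / (2 * real (Suc a)) = s" unfolding s_def by simp
  have hw: "0 \<le> ?z / c" "?z / c \<le> w" using z h c0 by (simp_all add: pos_divide_le_eq mult.commute)
  have "w ^ (2 * Suc a) \<in> conf_interval_I d k \<alpha> r l \<longleftrightarrow> \<bar>l powr s - w\<bar> \<le> ?z / c"
    unfolding conf_interval_I_def a Let_def s2 A_def[symmetric] hI
    by (rule mem_even_power_interval_iff[OF _ _ _ hw]) simp_all
  then show "w ^ (2 * Suc a) \<in> conf_interval_I d k \<alpha> r l \<longleftrightarrow> \<bar>c * (l powr s - w)\<bar> \<le> ?z"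
    unfolding key .
  have l_root: "(l / a_const d k) powr s = l powr s / A"
    unfolding A_def using A l by (simp add: powr_divide)
  have hw': "0 \<le> ?z / (c * A)" "?z / (c * A) \<le> w / A"
    using hw A0 by (simp_all add: divide_divide_eq_left[symmetric] divide_right_mono del: divide_divide_eq_left)
  have "(w / A)\<^sup>2 \<in> conf_interval_J d k \<alpha> r l \<longleftrightarrow> \<bar>l powr s / A - w / A\<bar> \<le> ?z / (c * A)"
    unfolding conf_interval_J_def a Let_def s2 l_root hJ
    by (rule mem_even_power_interval_iff[OF _ _ _ hw']) (use A0 in simp_all)
  also have "\<dots> \<longleftrightarrow> \<bar>l powr s - w\<bar> / A \<le> ?z / c / A"
    using A0 by (simp only: diff_divide_distrib[symmetric] abs_divide abs_of_pos divide_divide_eq_left)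
  also have "\<dots> \<longleftrightarrow> \<bar>l powr s - w\<bar> \<le> ?z / c"
    using A0 by (simp only: divide_le_cancel) auto
  finally show "(w / a_const d k powr s)\<^sup>2 \<in> conf_interval_J d k \<alpha> r l \<longleftrightarrow> \<bar>c * (l powr s - w)\<bar> \<le> ?z"
    unfolding key A_def .
qed

theorem corollary4p2:
  fixes M :: "'w measure" and e :: "'a::euclidean_space"
    and P :: "nat \<Rightarrow> 'w \<Rightarrow> real" and V :: "nat \<Rightarrow> 'w \<Rightarrow> 'a"
    and lam :: real and k :: nat
  assumes "prob_space M"
    and "e \<in> Basis"
    and "lam > 0"
    and "poisson_hyperplane_process M e lam P V"
    and "k < DIM('a)"
  shows "let d = DIM('a);
             a = a_const d k;
             b = b_const (d - k);
             s = 1 / (2 * real (d - k));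
             lam_k = a * lam ^ (d - k);
             \<Psi> = (\<lambda>r \<omega>. flat_count k r (\<lambda>i. P i \<omega>) (\<lambda>i. V i \<omega>));
             est = (\<lambda>r \<omega>. intensity_estimator k r (\<lambda>i. P i \<omega>) (\<lambda>i. V i \<omega>));
             clt = conv_in_distr M
               (\<lambda>r \<omega>. sqrt r / b * a powr (- s) * (est r \<omega> powr s - lam_k powr s))
               std_normal_distribution at_top
         in (\<forall>r>0. integral\<^sup>L M (\<Psi> r) / (unit_ball_vol (real (d - k)) * r ^ (d - k)) = lam_k) \<and>
            clt \<and>
            (clt \<longleftrightarrow> (\<forall>\<alpha>\<in>{0<..<1}.
               ((\<lambda>r. measure M {\<omega>\<in>space M. lam_k \<in> conf_interval_I d k \<alpha> r (est r \<omega>)})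
                  \<longlongrightarrow> 1 - \<alpha>) at_top)) \<and>
            (\<forall>\<alpha>\<in>{0<..<1}.
               ((\<lambda>r. measure M {\<omega>\<in>space M. lam \<in> conf_interval_J d k \<alpha> r (est r \<omega>)})
                  \<longlongrightarrow> 1 - \<alpha>) at_top)"
proof -
  interpret prob_space M by fact
  define X where "X = (\<lambda>i \<omega>. (P i \<omega>, V i \<omega>))"
  have e: "e \<noteq> 0" using assms(2) nonzero_Basis by blast
  have pp: "poisson_process M (scale_measure (ennreal lam) (lborel \<Otimes>\<^sub>M half_sphere_uniform e)) X"
    using assms(4) unfolding poisson_hyperplane_process_def X_def .
  interpret isotropic_hyperplanes M e lam X
    by (intro isotropic_hyperplanes.intro marked_poisson.intro marked_poisson_axioms.intro
      isotropic_hyperplanes_axioms.intro prob_space_half_sphere_uniform assms(1,3) e pp)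
  obtain a where a: "Suc a = DIM('a) - k" using assms(5) by (metis Suc_diff_Suc)
  have a_le: "Suc a \<le> DIM('a)" and kk: "DIM('a) - Suc a = k" using a assms(5) by auto
  define A where "A = a_const DIM('a) k"
  define B where "B = b_const (Suc a)"
  define s where "s = 1 / (2 * real (Suc a))"
  define w where "w = (A * lam ^ Suc a) powr s"
  define est where "est r \<omega> = intensity_estimator k r (\<lambda>i. P i \<omega>) (\<lambda>i. V i \<omega>)" for r \<omega>
  define T where "T = (\<lambda>r \<omega>. sqrt r / B * A powr (- s) * (est r \<omega> powr s - w))"
  have s2: "1 / real (2 * Suc a) = s" unfolding s_def by simp
  have A: "A > 0" unfolding A_def kk[symmetric] by (rule a_const_pos[OF a_le DIM_positive])
  have B: "B > 0" unfolding B_def by (rule b_const_pos)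
  have l: "A * lam ^ Suc a > 0" by (intro mult_pos_pos A zero_less_power lam_pos)
  have w: "w > 0" unfolding w_def using A lam_pos by simp
  have \<kappa>: "unit_ball_vol (real (Suc a)) > 0" by (rule unit_ball_vol_pos) simp
  have count: "flat_count k r (\<lambda>i. P i \<omega>) (\<lambda>i. V i \<omega>) = flats a r \<omega>" for r \<omega>
    using flat_count_eq_flats[OF a, of r \<omega>] unfolding X_def by simp
  have est: "est r \<omega> = flats a r \<omega> / (unit_ball_vol (real (Suc a)) * r ^ Suc a)" for r \<omega>
    unfolding est_def intensity_estimator_def count a ..
  have est_nn: "r > 0 \<Longrightarrow> est r \<omega> \<ge> 0" for r \<omega>
    unfolding est flats_def using \<kappa> by simp
  have T_m: "T r \<in> borel_measurable M" for r unfolding T_def est by measurable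
  have conv: "((\<lambda>r. prob {\<omega>\<in>space M. T r \<omega> \<le> x}) \<longlongrightarrow> cdf std_normal_distribution x) at_top" for x
    using clt_root[OF a_le, of x] unfolding kk s2 A_def[symmetric] B_def[symmetric] w_def[symmetric] T_def est .
  have clt: "conv_in_distr M T std_normal_distribution at_top"
  proof -
    have "cdf (distr M borel (T r)) x = prob {\<omega>\<in>space M. T r \<omega> \<le> x}" for r x
      unfolding cdf_def using T_m by (subst measure_distr) (auto intro!: arg_cong[where f = prob])
    then show ?thesis unfolding conv_in_distr_def using conv by simp
  qed
  have mean: "(\<integral>\<omega>. flats a r \<omega> \<partial>M) / (unit_ball_vol (real (Suc a)) * r ^ Suc a) = A * lam ^ Suc a" if r: "r > 0" for r
  proof -
    have "(\<integral>\<omega>. flats a r \<omega> \<partial>M) = A * lam ^ Suc a * (unit_ball_vol (real (Suc a)) * r ^ Suc a)"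
      using expectation_flats[OF a_le less_imp_le[OF r]]
      unfolding mean_flats_def kk A_def[symmetric] by (simp only: mult_ac)
    moreover have "unit_ball_vol (real (Suc a)) * r ^ Suc a \<noteq> 0" by (metis \<kappa> r less_irrefl mult_pos_pos zero_less_power)
    ultimately show ?thesis by (simp only: nonzero_mult_div_cancel_right not_False_eq_True)
  qed
  have ci: "((\<lambda>r. prob {\<omega>\<in>space M. A * lam ^ Suc a \<in> conf_interval_I DIM('a) k \<alpha> r (est r \<omega>)}) \<longlongrightarrow> 1 - \<alpha>) at_top"
      "((\<lambda>r. prob {\<omega>\<in>space M. lam \<in> conf_interval_J DIM('a) k \<alpha> r (est r \<omega>)}) \<longlongrightarrow> 1 - \<alpha>) at_top"
    if \<alpha>: "\<alpha> \<in> {0<..<1}" for \<alpha>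
  proof -
    define z where "z = std_normal_quantile (1 - \<alpha> / 2)"
    have z: "z > 0" unfolding z_def using \<alpha> by (intro std_normal_quantile_pos) auto
    have "cdf std_normal_distribution z = 1 - \<alpha> / 2"
      unfolding z_def using \<alpha> by (intro cdf_std_normal_quantile) auto
    then have "cdf std_normal_distribution z - cdf std_normal_distribution (- z) = 1 - \<alpha>"
      by (simp add: cdf_std_normal_minus)
    then have lim: "((\<lambda>r. prob {\<omega>\<in>space M. \<bar>T r \<omega>\<bar> \<le> z}) \<longlongrightarrow> 1 - \<alpha>) at_top"
      using prob_abs_le_tendsto[OF T_m isCont_cdf_std_normal less_imp_le[OF z] conv] by (simp only:)
    let ?K = "A powr (- s) / B * w"
    have K: "?K > 0" using A B w by simp
    \<comment> \<open>The half widths are of order \<open>1 / sqrt r\<close>, so they eventually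
      fall below the root, as the inversion of even powers requires.\<close>
    have ev: "eventually (\<lambda>r. r > 0 \<and> z \<le> sqrt r / B * A powr (- s) * w) at_top"
    proof -
      have "eventually (\<lambda>r. z / ?K \<le> sqrt r) at_top"
        using sqrt_at_top unfolding filterlim_at_top by blast
      with eventually_gt_at_top[of 0] show ?thesis
      proof eventually_elim
        case (elim r)
        then have "z \<le> sqrt r * ?K" using K by (simp only: pos_divide_le_eq)
        also have "sqrt r * ?K = sqrt r / B * A powr (- s) * w" by simp
        finally show ?case using elim by simp
      qed
    qed
    have iff: "A * lam ^ Suc a \<in> conf_interval_I DIM('a) k \<alpha> r (est r \<omega>) \<longleftrightarrow> \<bar>T r \<omega>\<bar> \<le> z"
        "lam \<in> conf_interval_J DIM('a) k \<alpha> r (est r \<omega>) \<longleftrightarrow> \<bar>T r \<omega>\<bar> \<le> z"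
      if r: "r > 0 \<and> z \<le> sqrt r / B * A powr (- s) * w" for r \<omega>
    proof -
      have wq: "w ^ (2 * Suc a) = A * lam ^ Suc a"
        unfolding w_def s2[symmetric] by (rule powr_inverse_power[OF less_imp_le[OF l]]) simp
      have "w = A powr s * sqrt lam" unfolding w_def s2[symmetric] by (rule a_const_root[OF A lam_pos])
      then have w2: "(w / A powr s)\<^sup>2 = lam" using A lam_pos by simp
      note mem = mem_conf_interval_I_iff[OF a[symmetric] A[unfolded A_def] est_nn[of r \<omega>] less_imp_le[OF z[unfolded z_def]] _ w,
          unfolded s2 A_def[symmetric] B_def[symmetric] z_def[symmetric] wq w2]
      show "A * lam ^ Suc a \<in> conf_interval_I DIM('a) k \<alpha> r (est r \<omega>) \<longleftrightarrow> \<bar>T r \<omega>\<bar> \<le> z"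
        "lam \<in> conf_interval_J DIM('a) k \<alpha> r (est r \<omega>) \<longleftrightarrow> \<bar>T r \<omega>\<bar> \<le> z"
        unfolding T_def using r by (intro mem; simp)+
    qed
    show "((\<lambda>r. prob {\<omega>\<in>space M. A * lam ^ Suc a \<in> conf_interval_I DIM('a) k \<alpha> r (est r \<omega>)}) \<longlongrightarrow> 1 - \<alpha>) at_top"
      by (rule Lim_transform_eventually[OF lim]) (use ev in \<open>eventually_elim, simp only: iff\<close>)
    show "((\<lambda>r. prob {\<omega>\<in>space M. lam \<in> conf_interval_J DIM('a) k \<alpha> r (est r \<omega>)}) \<longlongrightarrow> 1 - \<alpha>) at_top"
      by (rule Lim_transform_eventually[OF lim]) (use ev in \<open>eventually_elim, simp only: iff\<close>)
  qed
  \<comment> \<open>The equivalence in the statement follows because both of its sides have been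
    established.\<close>
  show ?thesis
    unfolding Let_def a[symmetric] s_def[symmetric] A_def[symmetric] B_def[symmetric] w_def[symmetric]
      est_def[symmetric] T_def[symmetric] count
    using mean clt ci by blast
qed

end
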